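(* Let $f_0,\ldots,f_{m-1}\in R=k[x_0,\ldots,x_{n-1}]$ be forms of degree $d$ satisfying the canonical restrictions, and let $\mathfrak{F}:\mathbb{P}^{n-1}\dashrightarrow\mathbb{P}^{m-1}$ denote the corresponding rational map. Set $I:=(f_0,\ldots,f_{m-1})\subset R$. Let $x_n$ be a new variable, and let $f\in R$ and $g\in IR[x_n]$ be nonzero forms such that $\deg(g)=\deg(f)+d$ and $\gcd(f,g)=1$ in $R[x_n]$. Suppose that: (i) the base ideal $I$ is a codimension $2$ perfect ideal; (ii) $g$ is an $x_n$-monoid; (iii) $\mathfrak{F}$ is birational onto its image (hence $m\ge n$). Then the rational map $\mathfrak{G}:\mathbb{P}^{n}\dashrightarrow\mathbb{P}^{m}$ defined by the forms $\{f_0f,\ldots,f_{m-1}f,g\}\subset R[x_n]$ is a birational map onto its image whose base ideal is perfect of codimension $2$. In particular, if $\mathfrak{F}$ is a perfect codimension $2$ Cremona map of $\mathbb{P}^{n-1}$, then $\mathfrak{G}$ is a perfect codimension $2$ Cremona map of $\mathbb{P}^{n}$.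
   Context: $k$ is an infinite field (taken to be algebraically closed for geometric purposes). Canonical restrictions: a set of forms of the same degree $\ge 1$, not all zero, satisfies the canonical restrictions if their gcd is $1$ and every variable of the polynomial ring appears effectively in at least one of them. $x_n$-monoid: a form $g=g_{e-1}x_n+g_e\in R[x_n]$ of degree $e$, where $g_{e-1}\ne 0$ and $g_e$ (possibly zero) are forms in $R$ of degrees $e-1$ and $e$ respectively. The base ideal of a rational map defined by forms of the same degree is the ideal generated by these forms. Codimension of an ideal means height; an ideal $J$ is perfect if the projective dimension of the quotient by $J$ equals the grade of $J$. A rational map defined by forms $g_0,\ldots,g_s$ of the same degree $e$ in $k[x_0,\ldots,x_r]$ is birational onto its image iff $k(g_0,\ldots,g_s)=k(\mathbf{x}_e)$, where $\mathbf{x}_e$ is the set of all monomials of degree $e$ in $x_0,\ldots,x_r$. A Cremona map of $\mathbb{P}^r$ is a birational map $\mathbb{P}^r\dashrightarrow\mathbb{P}^r$ (given by $r+1$ forms); it is called perfect of codimension $2$ if its base ideal is. *)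

theory Defs
  imports
    "HOL-Library.Poly_Mapping"
    "HOL-Library.Extended_Nat"
    "HOL-Algebra.Algebra"
    "HOL-Algebra.Algebraic_Closure_Type"
    "HOL-Computational_Algebra.Fraction_Field"
begin

section \<open>Polynomial rings in finitely many variables\<close>

text \<open>
  The type below is the polynomial ring in countably many variables; the exponent vector
  \<open>t\<close> stands for the product of the \<open>x\<^sub>i\<close> raised to \<open>lookup t i\<close>. The ring
  \<open>k[x\<^sub>0,\<dots>,x\<^sub>N\<^sub>-\<^sub>1]\<close> is the subring \<open>mpoly_ring N\<close>, so that
  \<open>mpoly_ring n\<close> is literally a subring of \<open>mpoly_ring (Suc n)\<close>, the new variable being
  number \<open>n\<close>.
\<close>

type_synonym 'k mpoly = "(nat \<Rightarrow>\<^sub>0 nat) \<Rightarrow>\<^sub>0 'k"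

definition Const :: "'k::field \<Rightarrow> 'k mpoly"
  where "Const c = Poly_Mapping.single 0 c"

definition Var :: "nat \<Rightarrow> 'k::field mpoly"
  where "Var i = Poly_Mapping.single (Poly_Mapping.single i 1) 1"

definition mvars :: "'k::field mpoly \<Rightarrow> nat set"
  where "mvars p = (\<Union>t\<in>Poly_Mapping.keys p. Poly_Mapping.keys t)"

definition mpoly_ring :: "nat \<Rightarrow> 'k::field mpoly ring"
  where "mpoly_ring N = \<lparr>carrier = {p. mvars p \<subseteq> {..<N}}, monoid.mult = (*), one = 1,
    ring.zero = 0, add = (+)\<rparr>"

definition mdeg :: "(nat \<Rightarrow>\<^sub>0 nat) \<Rightarrow> nat"
  where "mdeg t = (\<Sum>i\<in>Poly_Mapping.keys t. Poly_Mapping.lookup t i)"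

text \<open>As usual, the zero polynomial counts as a form of every degree.\<close>

definition forms :: "nat \<Rightarrow> nat \<Rightarrow> 'k::field mpoly set"
  where "forms N e = {p \<in> carrier (mpoly_ring N). \<forall>t\<in>Poly_Mapping.keys p. mdeg t = e}"

definition monomials :: "nat \<Rightarrow> nat \<Rightarrow> 'k::field mpoly set"
  where "monomials N e = {Poly_Mapping.single t 1 |t. Poly_Mapping.keys t \<subseteq> {..<N} \<and> mdeg t = e}"

definition eval_mpoly :: "(nat \<Rightarrow> 'k::field mpoly) \<Rightarrow> 'k mpoly \<Rightarrow> 'k mpoly"
  where "eval_mpoly v p = 
    (\<Sum>t\<in>Poly_Mapping.keys p. Const (Poly_Mapping.lookup p t) *
      (\<Prod>i\<in>Poly_Mapping.keys t. v i ^ Poly_Mapping.lookup t i))"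

text \<open>The set version of \<^const>\<open>isgcd\<close>, for the candidate \<open>\<one>\<close>.\<close>

definition gcd_is_one :: "('a, 'b) ring_scheme \<Rightarrow> 'a set \<Rightarrow> bool"
  where "gcd_is_one R A \<longleftrightarrow>
    (\<forall>h\<in>carrier R. (\<forall>a\<in>A. h divides\<^bsub>R\<^esub> a) \<longrightarrow> h divides\<^bsub>R\<^esub> \<one>\<^bsub>R\<^esub>)"

definition canonical_restrictions :: "nat \<Rightarrow> nat \<Rightarrow> 'k::field mpoly list \<Rightarrow> bool"
  where "canonical_restrictions N d fs \<longleftrightarrow>
    1 \<le> d \<and> set fs \<subseteq> forms N d \<and> (\<exists>f\<in>set fs. f \<noteq> 0) \<and>
    gcd_is_one (mpoly_ring N) (set fs) \<and>
    (\<forall>j<N. \<exists>f\<in>set fs. j \<in> mvars f)"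

definition xn_monoid :: "nat \<Rightarrow> nat \<Rightarrow> 'k::field mpoly \<Rightarrow> bool"
  where "xn_monoid n e g \<longleftrightarrow> 1 \<le> e \<and>
    (\<exists>p\<in>forms n (e - 1). \<exists>q\<in>forms n e. p \<noteq> 0 \<and> g = p * Var n + q)"


section \<open>Height, grade, projective dimension, perfect ideals\<close>

definition prime_height :: "('a, 'b) ring_scheme \<Rightarrow> 'a set \<Rightarrow> enat"
  where "prime_height R P = Sup {enat l |l. \<exists>Q :: nat \<Rightarrow> 'a set.
    (\<forall>i\<le>l. primeideal (Q i) R) \<and> (\<forall>i<l. Q i \<subset> Q (Suc i)) \<and> Q l = P}"

definition height :: "('a, 'b) ring_scheme \<Rightarrow> 'a set \<Rightarrow> enat"
  where "height R J = Inf {prime_height R P |P. primeideal P R \<and> J \<subseteq> P}"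

definition regular_sequence :: "('a, 'b) ring_scheme \<Rightarrow> 'a list \<Rightarrow> bool"
  where "regular_sequence R as \<longleftrightarrow>
    set as \<subseteq> carrier R \<and> Idl\<^bsub>R\<^esub> (set as) \<noteq> carrier R \<and>
    (\<forall>i<length as. \<forall>r\<in>carrier R.
       r \<otimes>\<^bsub>R\<^esub> as ! i \<in> Idl\<^bsub>R\<^esub> (set (take i as)) \<longrightarrow> r \<in> Idl\<^bsub>R\<^esub> (set (take i as)))"

definition grade :: "('a, 'b) ring_scheme \<Rightarrow> 'a set \<Rightarrow> enat"
  where "grade R J = Sup {enat (length as) |as. regular_sequence R as \<and> set as \<subseteq> J}"

definition module_hom ::
    "('a, 'b) ring_scheme \<Rightarrow> ('a, 'm, 'c) module_scheme \<Rightarrow> ('a, 'n, 'd) module_scheme \<Rightarrow> ('m \<Rightarrow> 'n) set"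
  where "module_hom R M N = {h \<in> carrier M \<rightarrow> carrier N.
    (\<forall>x\<in>carrier M. \<forall>y\<in>carrier M. h (x \<oplus>\<^bsub>M\<^esub> y) = h x \<oplus>\<^bsub>N\<^esub> h y) \<and>
    (\<forall>a\<in>carrier R. \<forall>x\<in>carrier M. h (a \<odot>\<^bsub>M\<^esub> x) = a \<odot>\<^bsub>N\<^esub> h x)}"

text \<open>
  The lifting property. The element types of the test modules are no restriction: the free
  module on the set \<open>carrier P\<close> lives on finitely supported functions \<open>'p \<Rightarrow> 'a\<close>, and
  lifting the identity of \<open>P\<close> along its canonical surjection onto \<open>P\<close> already makes \<open>P\<close> a
  direct summand of a free module.
\<close>

definition projective_module :: "('a, 'b) ring_scheme \<Rightarrow> ('a, 'p) module \<Rightarrow> bool"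
  where "projective_module R P \<longleftrightarrow> module R P \<and>
    (\<forall>(M :: ('a, 'p \<Rightarrow> 'a) module) (N :: ('a, 'p) module) \<pi> h.
       module R M \<and> module R N \<and> \<pi> \<in> module_hom R M N \<and> \<pi> ` carrier M = carrier N \<and>
       h \<in> module_hom R P N \<longrightarrow>
       (\<exists>l\<in>module_hom R P M. \<forall>x\<in>carrier P. \<pi> (l x) = h x))"

text \<open>
  An exact sequence \<open>\<cdots> \<rightarrow> P 1 \<rightarrow> P 0 \<rightarrow> M \<rightarrow> 0\<close> with \<open>P i\<close> projective, where
  \<open>\<delta> i\<close> maps \<open>P (Suc i)\<close> to \<open>P i\<close>.
\<close>

definition projective_resolution ::
    "('a, 'b) ring_scheme \<Rightarrow> ('a, 'm) module \<Rightarrow> (nat \<Rightarrow> ('a, 'p) module)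
      \<Rightarrow> (nat \<Rightarrow> 'p \<Rightarrow> 'p) \<Rightarrow> ('p \<Rightarrow> 'm) \<Rightarrow> bool"
  where "projective_resolution R M P \<delta> \<epsilon> \<longleftrightarrow>
    (\<forall>i. projective_module R (P i)) \<and>
    (\<forall>i. \<delta> i \<in> module_hom R (P (Suc i)) (P i)) \<and>
    \<epsilon> \<in> module_hom R (P 0) M \<and>
    \<epsilon> ` carrier (P 0) = carrier M \<and>
    \<delta> 0 ` carrier (P 1) = {x \<in> carrier (P 0). \<epsilon> x = \<zero>\<^bsub>M\<^esub>} \<and>
    (\<forall>i. \<delta> (Suc i) ` carrier (P (Suc (Suc i))) =
         {x \<in> carrier (P (Suc i)). \<delta> i x = \<zero>\<^bsub>P i\<^esub>})"

text \<open>
  The modules of the resolutions are arbitrary module structures on subsets of \<open>nat \<Rightarrow> 'a\<close>.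
  This is no restriction for the quotients \<open>R/J\<close> considered here: such a module has a free
  resolution by modules of cardinality at most \<open>max \<bar>R\<bar> \<aleph>\<^sub>0\<close>, and the projective dimension
  can be read off from the kernels of any one resolution.
\<close>

definition proj_dim :: "('a, 'b) ring_scheme \<Rightarrow> ('a, 'm) module \<Rightarrow> enat"
  where "proj_dim R M = Inf {enat l |l.
    \<exists>(P :: nat \<Rightarrow> ('a, nat \<Rightarrow> 'a) module) \<delta> \<epsilon>.
      projective_resolution R M P \<delta> \<epsilon> \<and> (\<forall>i>l. carrier (P i) = {\<zero>\<^bsub>P i\<^esub>})}"

definition quotient_module :: "('a, 'b) ring_scheme \<Rightarrow> 'a set \<Rightarrow> ('a, 'a set) module"
  where "quotient_module R J =
    \<lparr>carrier = carrier (R Quot J), monoid.mult = monoid.mult (R Quot J), one = one (R Quot J),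
     ring.zero = ring.zero (R Quot J), add = add (R Quot J),
     module.smult = (\<lambda>a C. (J +>\<^bsub>R\<^esub> a) \<otimes>\<^bsub>R Quot J\<^esub> C)\<rparr>"

definition perfect_ideal :: "('a, 'b) ring_scheme \<Rightarrow> 'a set \<Rightarrow> bool"
  where "perfect_ideal R J \<longleftrightarrow> ideal J R \<and> J \<noteq> carrier R \<and>
    proj_dim R (quotient_module R J) = grade R J"

definition perfect_codim2 :: "('a, 'b) ring_scheme \<Rightarrow> 'a set \<Rightarrow> bool"
  where "perfect_codim2 R J \<longleftrightarrow> perfect_ideal R J \<and> height R J = 2"


section \<open>Rational maps\<close>

text \<open>
  A rational map from projective \<open>(N - 1)\<close>-space to projective \<open>(length gs - 1)\<close>-space is given
  by the list \<open>gs\<close> of its defining forms, of common degree \<open>e\<close> in \<open>N\<close> variables.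
\<close>

definition rational_map :: "nat \<Rightarrow> nat \<Rightarrow> 'k::field mpoly list \<Rightarrow> bool"
  where "rational_map N e gs \<longleftrightarrow> 1 \<le> e \<and> set gs \<subseteq> forms N e \<and> (\<exists>g\<in>set gs. g \<noteq> 0)"

definition base_ideal :: "nat \<Rightarrow> 'k::field mpoly list \<Rightarrow> 'k mpoly set"
  where "base_ideal N gs = Idl\<^bsub>mpoly_ring N\<^esub> (set gs)"

text \<open>The field \<open>k(A)\<close>, inside the field of fractions of the polynomial ring.\<close>

definition field_adjoin :: "'k::field mpoly set \<Rightarrow> 'k mpoly fract set"
  where "field_adjoin A =
    generate_field ring_of_type_algebra ((\<lambda>p. Fract p 1) ` (range Const \<union> A))"

text \<open>
  The graded form of the criterion that the map induces an isomorphism of function fields: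
  the defining forms generate the same field as all monomials of their degree.
\<close>

definition birational_onto_image :: "nat \<Rightarrow> nat \<Rightarrow> 'k::field mpoly list \<Rightarrow> bool"
  where "birational_onto_image N e gs \<longleftrightarrow>
    rational_map N e gs \<and> field_adjoin (set gs) = field_adjoin (monomials N e)"

text \<open>The image is dense in the target iff no nonzero polynomial vanishes on the forms.\<close>

definition dominant :: "'k::field mpoly list \<Rightarrow> bool"
  where "dominant gs \<longleftrightarrow>
    (\<forall>p\<in>carrier (mpoly_ring (length gs)). eval_mpoly (\<lambda>i. gs ! i) p = 0 \<longrightarrow> p = 0)"

definition cremona_map :: "nat \<Rightarrow> nat \<Rightarrow> 'k::field mpoly list \<Rightarrow> bool"
  where "cremona_map N e gs \<longleftrightarrow>
    length gs = N \<and> birational_onto_image N e gs \<and> dominant gs"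

definition perfect_codim2_cremona :: "nat \<Rightarrow> nat \<Rightarrow> 'k::field mpoly list \<Rightarrow> bool"
  where "perfect_codim2_cremona N e gs \<longleftrightarrow>
    cremona_map N e gs \<and> perfect_codim2 (mpoly_ring N) (base_ideal N gs)"


section \<open>The polynomial rings are commutative rings\<close>

lemma mvars_add: "mvars (p + q) \<subseteq> mvars p \<union> mvars q"
  using Poly_Mapping.keys_add[of p q] by (fastforce simp: mvars_def)

lemma mvars_uminus: "mvars (- p) = mvars p"
  by (simp add: mvars_def)

lemma mvars_mult: "mvars (p * q) \<subseteq> mvars p \<union> mvars q"
proof
  fix i assume "i \<in> mvars (p * q)"
  then obtain t where t: "t \<in> Poly_Mapping.keys (p * q)" "i \<in> Poly_Mapping.keys t" by (auto simp: mvars_def)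
  then obtain a b where "t = a + b" "a \<in> Poly_Mapping.keys p" "b \<in> Poly_Mapping.keys q"
    using keys_mult[of p q] by blast
  then show "i \<in> mvars p \<union> mvars q"
    using t(2) Poly_Mapping.keys_add[of a b] by (fastforce simp: mvars_def)
qed

lemma cring_mpoly_ring: "cring (mpoly_ring N :: 'k::field mpoly ring)"
proof (rule cringI)
  show "abelian_group (mpoly_ring N :: 'k mpoly ring)"
  proof (rule abelian_groupI)
    fix x :: "'k mpoly" assume "x \<in> carrier (mpoly_ring N)"
    then show "\<exists>y\<in>carrier (mpoly_ring N). y \<oplus>\<^bsub>mpoly_ring N\<^esub> x = \<zero>\<^bsub>mpoly_ring N\<^esub>"
      by (intro bexI[of _ "- x"]) (auto simp: mpoly_ring_def mvars_uminus)
  qed (use mvars_add in \<open>fastforce simp: mpoly_ring_def mvars_def add_ac\<close>)+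
  show "Group.comm_monoid (mpoly_ring N :: 'k mpoly ring)"
    by (rule comm_monoidI)
       (use mvars_mult in \<open>fastforce simp: mpoly_ring_def mvars_def mult_ac\<close>)+
qed (auto simp: mpoly_ring_def algebra_simps)

end

theory Submission
  imports Defs
begin

text \<open>
  Let \<open>R = k[x\<^sub>0,\<dots>,x\<^sub>n\<^sub>-\<^sub>1]\<close> and \<open>S = R[x\<^sub>n]\<close>, let \<open>I\<close> be the base ideal of the given map and
  \<open>J = fI S + gS\<close> the base ideal of the new one.

  \<^emph>\<open>Birationality\<close> (\<open>birational_monoid_forms\<close>). Let \<open>K\<close> be the field generated by the new
  forms. It contains \<open>(h f) / (h' f) = h / h'\<close> for the old forms \<open>h, h'\<close>. As these generate
  all monomials of degree \<open>d\<close>, comparing homogeneous components shows that \<open>K\<close> contains the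
  fractions of such monomials (\<open>degree_zero_quotient\<close>), in particular \<open>x\<^sub>i / x\<^sub>0\<close> for \<open>i < n\<close>.
  So the quotient of \<open>h f\<close> by \<open>x\<^sub>0\<^sup>a\<^sup>+\<^sup>d\<close> lies in \<open>K\<close>, hence so does \<open>x\<^sub>0\<^sup>a\<^sup>+\<^sup>d\<close>, and since \<open>g\<close> is linear
  in \<open>x\<^sub>n\<close> one can solve for \<open>x\<^sub>n / x\<^sub>0\<close>.

  \<^emph>\<open>Projective dimension\<close> (\<open>perfect_codim2_monoid_forms\<close>). Write \<open>g = \<Sum> \<gamma>\<^sub>i f\<^sub>i\<close>. In a
  relation \<open>f \<Sum> v\<^sub>i f\<^sub>i + v g = 0\<close> the polynomial \<open>f\<close> divides \<open>v\<close>, because it is coprime to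
  \<open>g\<close>; if \<open>v = q f\<close>, then \<open>v\<^sub>i + q \<gamma>\<^sub>i\<close> are the coefficients of a relation between the \<open>f\<^sub>i\<close>. Hence
  the syzygies of the new forms are the direct sum of the syzygies of the \<open>f\<^sub>i\<close> over \<open>S\<close> and
  a copy of \<open>S\<close>. For every finite system of generators the quotient has projective
  dimension at most \<open>2\<close> iff the syzygies are projective (\<open>syz_dual_basis_if_proj_dim_le_2\<close>,
  \<open>proj_dim_le_2_if_syz_dual_basis\<close>), and projectivity survives the passage from \<open>R\<close> to \<open>S\<close>
  (\<open>syz_dual_basis_base_change\<close>). As \<open>pd R/I = grade I \<le> height I = 2\<close>, this gives
  \<open>pd S/J \<le> 2\<close>. Conversely, no prime divides all elements of \<open>J\<close>, so by unique factorisation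
  \<open>J\<close> contains a regular sequence of length \<open>2\<close>; a projective proper ideal cannot contain
  one (\<open>proj_dim_ge_2\<close>). So \<open>pd S/J = 2 \<le> grade J\<close>.

  \<^emph>\<open>Height.\<close> In every commutative ring \<open>grade J \<le> height J\<close> (\<open>grade_le_height\<close>), so it remains
  to see that \<open>height J \<le> 2\<close>. There is a prime \<open>P \<supseteq> I\<close> of height \<open>2\<close> in \<open>R\<close>, and \<open>J\<close> lies in the
  prime \<open>PS\<close>, which has at most the height of \<open>P\<close> (\<open>prime_height_extended_ideal_le\<close>). Krull's
  principal ideal theorem is avoided: in \<open>N\<close> variables, the height of a prime \<open>Q\<close> is \<open>N\<close> minus
  the largest number of variables that are algebraically independent modulo \<open>Q\<close>. Adjoining
  one variable at a time produces a chain of primes of this length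
  (\<open>long_prime_chain_exists\<close>). A longer chain is impossible: elements \<open>b\<^sub>i\<close> of the successive
  differences, together with the independent variables, would be more than \<open>N\<close> elements,
  hence algebraically dependent, and the relation can be reduced along the chain to a
  nonzero polynomial in the independent variables that lies in \<open>Q\<close>
  (\<open>prime_chain_length_le\<close>).

  \<^emph>\<open>Cremona maps.\<close> A polynomial that vanishes on the new forms is expanded in powers of \<open>g\<close>;
  as \<open>g\<close> has degree \<open>1\<close> in \<open>x\<^sub>n\<close> and the other forms are free of \<open>x\<^sub>n\<close>, every coefficient vanishes
  on the \<open>f\<^sub>i f\<close>. Taking homogeneous components cancels \<open>f\<close> (\<open>dominant_monoid_forms\<close>).
\<close>

section \<open>Polynomials, substitutions and gradings\<close>

abbreviation "lookup \<equiv> Poly_Mapping.lookup"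
abbreviation "keys \<equiv> Poly_Mapping.keys"
abbreviation "single \<equiv> Poly_Mapping.single"

definition is_hom :: "('a::comm_ring_1 \<Rightarrow> 'b::comm_ring_1) \<Rightarrow> bool"
  where "is_hom h \<longleftrightarrow> h 1 = 1 \<and> (\<forall>a b. h (a + b) = h a + h b) \<and> (\<forall>a b. h (a * b) = h a * h b)"

lemma is_homD:
  assumes "is_hom h"
  shows "h 1 = 1" "h (a + b) = h a + h b" "h (a * b) = h a * h b" "h 0 = 0" "h (- a) = - h a"
    "h (a - b) = h a - h b" "h (a ^ n) = h a ^ n" "h (sum u A) = (\<Sum>x\<in>A. h (u x))"
    "h (prod u A) = (\<Prod>x\<in>A. h (u x))"
proof -
  show one: "h 1 = 1" and add: "h (a + b) = h a + h b" and mult: "h (a * b) = h a * h b" for a b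
    using assms by (auto simp: is_hom_def)
  show zero: "h 0 = 0" using add[of 0 0] by simp
  show minus: "h (- a) = - h a" for a
    using add[of a "- a"] zero by (simp add: eq_neg_iff_add_eq_0 add.commute)
  show "h (a - b) = h a - h b" using add[of a "- b"] minus by simp
  show "h (a ^ n) = h a ^ n" by (induction n) (auto simp: one mult)
  show "h (sum u A) = (\<Sum>x\<in>A. h (u x))"
    by (induction A rule: infinite_finite_induct) (auto simp: zero add)
  show "h (prod u A) = (\<Prod>x\<in>A. h (u x))"
    by (induction A rule: infinite_finite_induct) (auto simp: one mult)
qed

lemma is_hom_comp: "is_hom f \<Longrightarrow> is_hom h \<Longrightarrow> is_hom (\<lambda>x. f (h x))"
  by (auto simp: is_hom_def)

lemma is_hom_id: "is_hom (\<lambda>x. x)"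
  by (auto simp: is_hom_def)

lemma is_hom_poly: "is_hom (\<lambda>p. poly p x)"
  by (auto simp: is_hom_def)

lemma is_hom_const_poly: "is_hom (\<lambda>c. [:c:])"
  by (auto simp: is_hom_def one_pCons)

lemma is_hom_Const: "is_hom (Const :: 'k::field \<Rightarrow> 'k mpoly)"
  by (auto simp: is_hom_def Const_def single_add mult_single)

lemma Const_eq_0_iff [simp]: "Const c = 0 \<longleftrightarrow> c = 0"
  by (metis Const_def lookup_single_eq lookup_zero single_zero)

lemma Const_0 [simp]: "Const 0 = 0" and Const_1 [simp]: "Const 1 = 1"
  using is_homD(1,4)[OF is_hom_Const] by auto

lemma mpoly_sum_singles:
  "(p :: 'k::field mpoly) = (\<Sum>t\<in>keys p. single t (lookup p t))"
proof (rule poly_mapping_eqI)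
  fix s
  have "(\<Sum>t\<in>keys p. lookup (single t (lookup p t)) s)
      = (\<Sum>t\<in>keys p. if t = s then lookup p t else 0)"
    by (rule sum.cong) (auto simp: lookup_single when_def)
  also have "\<dots> = lookup p s"
    by (auto simp: sum.delta in_keys_iff)
  finally show "lookup p s = lookup
     (\<Sum>t\<in>keys p. single t (lookup p t)) s"
    by (simp add: lookup_sum)
qed

definition eval_monom :: "(nat \<Rightarrow> 'b::comm_ring_1) \<Rightarrow> (nat \<Rightarrow>\<^sub>0 nat) \<Rightarrow> 'b"
  where "eval_monom v t = (\<Prod>i\<in>keys t. v i ^ lookup t i)"

lemma eval_monom_superset:
  assumes "finite A" "keys t \<subseteq> A"
  shows "eval_monom v t = (\<Prod>i\<in>A. v i ^ lookup t i)"
  unfolding eval_monom_def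
  by (rule prod.mono_neutral_left) (use assms in \<open>auto simp: in_keys_iff\<close>)

lemma eval_monom_add: "eval_monom v (s + t) = eval_monom v s * eval_monom v t"
proof -
  let ?A = "keys s \<union> keys t"
  have "eval_monom v (s + t) = (\<Prod>i\<in>?A. v i ^ lookup (s + t) i)"
    by (rule eval_monom_superset) (use Poly_Mapping.keys_add[of s t] in auto)
  also have "\<dots> = (\<Prod>i\<in>?A. v i ^ lookup s i) * (\<Prod>i\<in>?A. v i ^ lookup t i)"
    by (simp add: lookup_add power_add prod.distrib)
  also have "\<dots> = eval_monom v s * eval_monom v t"
    by (subst (1 2) eval_monom_superset[where A="?A"]) auto
  finally show ?thesis .
qed

lemma eval_monom_0 [simp]: "eval_monom v 0 = 1"
  by (simp add: eval_monom_def)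

text \<open>
  Evaluation in an arbitrary commutative ring. Evaluating a polynomial at polynomials,
  separating one variable and grading by the degree are all of this form, so one proof
  of multiplicativity serves them all.
\<close>

definition mpoly_subst :: "('k::field \<Rightarrow> 'b::comm_ring_1) \<Rightarrow> (nat \<Rightarrow> 'b) \<Rightarrow> 'k mpoly \<Rightarrow> 'b"
  where "mpoly_subst \<phi> v p =
    (\<Sum>t\<in>keys p. \<phi> (lookup p t) * eval_monom v t)"

lemma eval_mpoly_conv: "eval_mpoly v = mpoly_subst Const v"
  by (simp add: fun_eq_iff eval_mpoly_def mpoly_subst_def eval_monom_def)

lemma mpoly_subst_superset:
  assumes "is_hom \<phi>" "finite A" "keys p \<subseteq> A"
  shows "mpoly_subst \<phi> v p = (\<Sum>t\<in>A. \<phi> (lookup p t) * eval_monom v t)"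
  unfolding mpoly_subst_def
  by (rule sum.mono_neutral_left)
     (use assms is_homD(4)[OF assms(1)] in \<open>auto simp: in_keys_iff\<close>)

lemma mpoly_subst_single:
  assumes "is_hom \<phi>"
  shows "mpoly_subst \<phi> v (single t c) = \<phi> c * eval_monom v t"
  by (subst mpoly_subst_superset[where A="{t}"])
     (use assms in \<open>auto simp: lookup_single\<close>)

lemma mpoly_subst_add:
  assumes "is_hom \<phi>"
  shows "mpoly_subst \<phi> v (p + q) = mpoly_subst \<phi> v p + mpoly_subst \<phi> v q"
proof -
  let ?A = "keys p \<union> keys q"
  have "mpoly_subst \<phi> v (p + q) = (\<Sum>t\<in>?A. \<phi> (lookup (p + q) t) * eval_monom v t)"
    by (rule mpoly_subst_superset) (use assms Poly_Mapping.keys_add[of p q] in auto)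
  also have "\<dots> = (\<Sum>t\<in>?A. \<phi> (lookup p t) * eval_monom v t)
      + (\<Sum>t\<in>?A. \<phi> (lookup q t) * eval_monom v t)"
    by (simp add: lookup_add is_homD[OF assms] sum.distrib algebra_simps)
  also have "\<dots> = mpoly_subst \<phi> v p + mpoly_subst \<phi> v q"
    by (subst (1 2) mpoly_subst_superset[where A="?A"]) (use assms in auto)
  finally show ?thesis .
qed

lemma mpoly_induct [case_names single add]:
  assumes "\<And>t c. P (single t (c::'k::field))" "\<And>p q. P p \<Longrightarrow> P q \<Longrightarrow> P (p + q)"
  shows "P (p :: 'k mpoly)"
proof -
  have "P (\<Sum>t\<in>A. single t (lookup p t))" if "finite A" for A
    using that
  proof induction
    case empty
    show ?case using assms(1)[of 0 0] by simp
  qed (use assms in auto)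
  then show ?thesis using mpoly_sum_singles[of p] by (metis finite_keys)
qed

lemma is_hom_subst:
  assumes "is_hom \<phi>"
  shows "is_hom (mpoly_subst \<phi> v :: 'k::field mpoly \<Rightarrow> 'b::comm_ring_1)"
proof -
  have single: "mpoly_subst \<phi> v (single t c * q)
      = mpoly_subst \<phi> v (single t c) * mpoly_subst \<phi> v q" for t c q
    by (induction q rule: mpoly_induct)
       (simp_all add: mult_single mpoly_subst_single[OF assms] mpoly_subst_add[OF assms]
          is_homD[OF assms] eval_monom_add algebra_simps)
  have "mpoly_subst \<phi> v (p * q) = mpoly_subst \<phi> v p * mpoly_subst \<phi> v q" for p q
    by (induction p rule: mpoly_induct)
       (simp_all add: single distrib_right mpoly_subst_add[OF assms])
  moreover have "mpoly_subst \<phi> v 1 = 1"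
    using mpoly_subst_single[OF assms, of v 0 1] is_homD(1)[OF assms] by simp
  ultimately show ?thesis
    using mpoly_subst_add[OF assms] by (auto simp: is_hom_def)
qed

lemma mpoly_subst_Const: "is_hom \<phi> \<Longrightarrow> mpoly_subst \<phi> v (Const c) = \<phi> c"
  by (simp add: Const_def mpoly_subst_single)

lemma mpoly_subst_Var:
  assumes "is_hom \<phi>" shows "mpoly_subst \<phi> v (Var i) = v i"
  using is_homD(1)[OF assms] by (simp add: Var_def mpoly_subst_single[OF assms] eval_monom_def)

lemma single_as_product:
  "single t (c::'k::field) = Const c * eval_monom Var t"
proof -
  have *: "(Var i :: 'k mpoly) ^ n = single (single i n) 1" for i n
    by (induction n) (auto simp: Var_def mult_single single_add[symmetric])
  have "(\<Prod>i\<in>A. (Var i :: 'k mpoly) ^ lookup t i)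
      = single (\<Sum>i\<in>A. single i (lookup t i)) 1" if "finite A" for A
    using that by induction (auto simp: * mult_single)
  moreover have "(\<Sum>i\<in>keys t. single i (lookup t i)) = t"
  proof (rule poly_mapping_eqI)
    fix s
    have "(\<Sum>i\<in>keys t. lookup (single i (lookup t i)) s)
        = (\<Sum>i\<in>keys t. if i = s then lookup t i else 0)"
      by (rule sum.cong) (auto simp: lookup_single when_def)
    then show "lookup (\<Sum>i\<in>keys t. single i (lookup t i)) s
        = lookup t s"
      by (auto simp: lookup_sum sum.delta in_keys_iff)
  qed
  ultimately show ?thesis
    by (simp add: eval_monom_def Const_def mult_single)
qed

definition poly_over :: "nat set \<Rightarrow> 'k::field mpoly set"
  where "poly_over V = {p. mvars p \<subseteq> V}"

lemma carrier_mpoly_ring: "carrier (mpoly_ring N) = poly_over {..<N}"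
  by (simp add: mpoly_ring_def poly_over_def)

lemma poly_over_mono: "V \<subseteq> W \<Longrightarrow> p \<in> poly_over V \<Longrightarrow> p \<in> poly_over W"
  by (auto simp: poly_over_def)

lemma poly_over_add: "p \<in> poly_over V \<Longrightarrow> q \<in> poly_over V \<Longrightarrow> p + q \<in> poly_over V"
  and poly_over_mult: "p \<in> poly_over V \<Longrightarrow> q \<in> poly_over V \<Longrightarrow> p * q \<in> poly_over V"
  and poly_over_uminus: "p \<in> poly_over V \<Longrightarrow> - p \<in> poly_over V"
  and poly_over_0: "0 \<in> poly_over V"
  and poly_over_1: "1 \<in> poly_over V"
  and poly_over_Const: "Const c \<in> poly_over V"
  and poly_over_Var: "i \<in> V \<Longrightarrow> Var i \<in> poly_over V"
  using mvars_add[of p q] mvars_mult[of p q] mvars_uminus[of p]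
  by (auto 0 3 simp: poly_over_def) (auto simp: Const_def Var_def mvars_def split: if_splits)

lemma poly_over_diff: "p \<in> poly_over V \<Longrightarrow> q \<in> poly_over V \<Longrightarrow> p - q \<in> poly_over V"
  using poly_over_add[of p V "- q"] poly_over_uminus[of q V] by simp

lemma poly_over_sum: "(\<And>x. x \<in> A \<Longrightarrow> u x \<in> poly_over V) \<Longrightarrow> sum u A \<in> poly_over V"
  by (induction A rule: infinite_finite_induct) (auto simp: poly_over_0 poly_over_add)

lemma poly_over_prod: "(\<And>x. x \<in> A \<Longrightarrow> u x \<in> poly_over V) \<Longrightarrow> prod u A \<in> poly_over V"
  by (induction A rule: infinite_finite_induct) (auto simp: poly_over_1 poly_over_mult)

lemma poly_over_power: "p \<in> poly_over V \<Longrightarrow> p ^ n \<in> poly_over V"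
  by (induction n) (auto simp: poly_over_1 poly_over_mult)

lemmas poly_over_intros = poly_over_add poly_over_mult poly_over_uminus poly_over_0 poly_over_1
  poly_over_Const poly_over_Var poly_over_diff poly_over_sum poly_over_prod poly_over_power

lemma in_some_poly_over: "\<exists>N. (p::'k::field mpoly) \<in> poly_over {..<N}"
proof -
  have "finite (mvars p)" by (auto simp: mvars_def)
  then obtain N where "\<forall>i\<in>mvars p. i < N" by (metis finite_nat_set_iff_bounded)
  then show ?thesis by (auto simp: poly_over_def)
qed

lemma mpoly_expand:
  "(p::'k::field mpoly) = (\<Sum>t\<in>keys p. Const (lookup p t) * eval_monom Var t)"
  using mpoly_sum_singles[of p] by (simp add: single_as_product)

text \<open>
  Most identities between substitutions below come from this: both sides are
  homomorphisms, and one compares them on constants and on variables.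
\<close>

lemma hom_unique:
  fixes p :: "'k::field mpoly"
  assumes "is_hom h1" "is_hom h2" "\<And>c. h1 (Const c) = h2 (Const c)"
    "\<And>i. i \<in> V \<Longrightarrow> h1 (Var i) = h2 (Var i)" "p \<in> poly_over V"
  shows "h1 p = h2 p"
proof -
  have "h1 (Const (lookup p t) * eval_monom Var t)
      = h2 (Const (lookup p t) * eval_monom Var t)" if "t \<in> keys p" for t
    using assms(3,4,5) that
    by (auto simp: is_homD[OF assms(1)] is_homD[OF assms(2)] eval_monom_def poly_over_def mvars_def
        intro!: prod.cong arg_cong2[of _ _ _ _ "(*)"])
  then show ?thesis
    by (subst (1 2) mpoly_expand) (simp add: is_homD[OF assms(1)] is_homD[OF assms(2)])
qed

lemma mpoly_subst_closed:
  assumes "p \<in> poly_over V" "\<And>c. \<phi> c \<in> S" "\<And>i. i \<in> V \<Longrightarrow> v i \<in> S" "0 \<in> S" "1 \<in> S"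
    "\<And>a b. a \<in> S \<Longrightarrow> b \<in> S \<Longrightarrow> a + b \<in> S" "\<And>a b. a \<in> S \<Longrightarrow> b \<in> S \<Longrightarrow> a * b \<in> S"
  shows "mpoly_subst \<phi> v p \<in> S"
proof -
  have sums: "sum u A \<in> S" if "\<And>x. x \<in> A \<Longrightarrow> u x \<in> S" for u and A :: "(nat \<Rightarrow>\<^sub>0 nat) set"
    using that by (induction A rule: infinite_finite_induct) (auto simp: assms)
  have pow: "v i ^ n \<in> S" if "i \<in> V" for i n
    using that by (induction n) (auto simp: assms)
  have prods: "prod u A \<in> S" if "\<And>x. x \<in> A \<Longrightarrow> u x \<in> S" for u and A :: "nat set"
    using that by (induction A rule: infinite_finite_induct) (auto simp: assms)
  show ?thesis
    unfolding mpoly_subst_def eval_monom_def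
    by (intro sums assms(7) assms(2) prods pow) (use assms(1) in \<open>auto simp: poly_over_def mvars_def\<close>)
qed

text \<open>
  The polynomial \<open>p\<close> as a univariate polynomial in \<open>x\<^sub>j\<close>. The coefficients live in the same
  type; that they are free of \<open>x\<^sub>j\<close> is the content of \<open>split_var_coeff\<close>.
\<close>

definition split_var :: "nat \<Rightarrow> 'k::field mpoly \<Rightarrow> 'k mpoly poly"
  where "split_var j = mpoly_subst (\<lambda>c. [:Const c:]) (\<lambda>i. if i = j then [:0, 1:] else [:Var i:])"

lemma is_hom_const_const: "is_hom (\<lambda>c::'k::field. [:Const c :: 'k mpoly:])"
  using is_hom_comp[OF is_hom_const_poly is_hom_Const] .

lemma is_hom_split_var: "is_hom (split_var j)"
  unfolding split_var_def by (rule is_hom_subst[OF is_hom_const_const])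

lemmas split_var_simps = is_homD[OF is_hom_split_var]

lemma split_var_Const: "split_var j (Const c) = [:Const c:]"
  and split_var_Var: "split_var j (Var i) = (if i = j then [:0, 1:] else [:Var i:])"
  by (simp_all add: split_var_def mpoly_subst_Const[OF is_hom_const_const] mpoly_subst_Var[OF is_hom_const_const])

lemma poly_split_var [simp]: "poly (split_var j p) (Var j) = p"
  by (rule hom_unique[where V=UNIV, OF is_hom_comp[OF is_hom_poly is_hom_split_var] is_hom_id])
     (auto simp: split_var_Const split_var_Var poly_over_def)

lemma split_var_inject: "split_var j p = split_var j q \<longleftrightarrow> p = q"
  by (metis poly_split_var)

lemma split_var_eq_0 [simp]: "split_var j p = 0 \<longleftrightarrow> p = 0"
  using split_var_inject[of j p 0] by (simp add: split_var_simps)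

lemma split_var_free:
  assumes "p \<in> poly_over V" "j \<notin> V"
  shows "split_var j p = [:p:]"
  by (rule hom_unique[OF is_hom_split_var is_hom_const_poly _ _ assms(1)])
     (use assms(2) in \<open>auto simp: split_var_Const split_var_Var\<close>)

lemma split_var_poly:
  assumes "\<And>e. coeff P e \<in> poly_over V" "j \<notin> V"
  shows "split_var j (poly P (Var j)) = P"
proof -
  have "split_var j (poly P (Var j)) = (\<Sum>i\<le>degree P. monom (coeff P i) i)"
    by (simp add: poly_altdef split_var_simps split_var_Var split_var_free[OF assms] Polynomial.monom_altdef)
  then show ?thesis by (simp add: poly_as_sum_of_monoms)
qed

definition polys_with_coeffs :: "'a set \<Rightarrow> 'a::comm_ring_1 poly set"
  where "polys_with_coeffs A = {P. \<forall>e. coeff P e \<in> A}"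

lemma split_var_coeff:
  assumes "p \<in> poly_over V"
  shows "coeff (split_var j p) e \<in> poly_over (V - {j})"
proof -
  have "split_var j p \<in> polys_with_coeffs (poly_over (V - {j}))"
    unfolding split_var_def
    by (rule mpoly_subst_closed[OF assms])
       (auto simp: polys_with_coeffs_def coeff_mult coeff_pCons one_pCons
          intro!: poly_over_intros split: nat.splits)
  then show ?thesis by (simp add: polys_with_coeffs_def)
qed

lemma split_var_coeff_Suc:
  "p \<in> poly_over {..<Suc N} \<Longrightarrow> coeff (split_var N p) e \<in> poly_over {..<N}"
  using split_var_coeff[of p "{..<Suc N}" N e]
  by (rule poly_over_mono[rotated]) auto

lemma poly_in_poly_over:
  assumes "\<And>e. coeff P e \<in> poly_over V" "x \<in> poly_over V"
  shows "poly P x \<in> poly_over V"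
  using assms by (auto simp: poly_altdef intro!: poly_over_intros)

lemma poly_in_poly_over_Suc:
  assumes "\<And>e. coeff P e \<in> poly_over {..<N}"
  shows "poly P (Var N) \<in> poly_over {..<Suc N}"
  by (rule poly_in_poly_over) (use assms poly_over_mono[of "{..<N}" "{..<Suc N}"] in \<open>auto intro!: poly_over_Var\<close>)

lemma split_var_poly_Suc:
  assumes "\<And>e. coeff P e \<in> poly_over {..<N}"
  shows "split_var N (poly P (Var N)) = P"
  by (rule split_var_poly[OF assms]) auto

lemma split_var_const: "p \<in> poly_over {..<N} \<Longrightarrow> split_var N p = [:p:]"
  by (rule split_var_free) auto

text \<open>
  The substitution of \<open>x\<^sub>i T\<close> for \<open>x\<^sub>i\<close>: the coefficient of \<open>T\<^sup>e\<close> is the homogeneous component of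
  degree \<open>e\<close>.
\<close>

definition grade_poly :: "'k::field mpoly \<Rightarrow> 'k mpoly poly"
  where "grade_poly = mpoly_subst (\<lambda>c. [:Const c:]) (\<lambda>i. [:0, Var i:])"

lemma is_hom_grade_poly: "is_hom grade_poly"
  unfolding grade_poly_def by (rule is_hom_subst[OF is_hom_const_const])

lemmas grade_poly_simps = is_homD[OF is_hom_grade_poly]

lemma grade_poly_Const: "grade_poly (Const c) = [:Const c:]"
  and grade_poly_Var: "grade_poly (Var i) = [:0, Var i:]"
  by (simp_all add: grade_poly_def mpoly_subst_Const[OF is_hom_const_const] mpoly_subst_Var[OF is_hom_const_const])

lemma poly_grade_poly [simp]: "poly (grade_poly p) 1 = p"
  by (rule hom_unique[where V=UNIV, OF is_hom_comp[OF is_hom_poly is_hom_grade_poly] is_hom_id])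
     (auto simp: grade_poly_Const grade_poly_Var poly_over_def)

lemma grade_poly_eq_0 [simp]: "grade_poly p = 0 \<longleftrightarrow> p = 0"
  by (metis poly_grade_poly grade_poly_simps(4))

lemma monom_linear_power: "[:0, x:] ^ n = monom (x ^ n) n" for x :: "'b::comm_ring_1"
proof (induction n)
  case (Suc n)
  have "[:0, x:] = monom x 1" by (simp add: monom_Suc monom_0)
  then show ?case using Suc by (simp add: mult_monom)
qed (simp add: monom_0 one_pCons)

lemma grade_poly_single:
  fixes c :: "'k::field"
  shows "grade_poly (single t c) = monom (single t c) (mdeg t)"
proof -
  have "(\<Prod>i\<in>A. [:0, Var i :: 'k mpoly:] ^ lookup t i)
     = monom (\<Prod>i\<in>A. Var i ^ lookup t i) (\<Sum>i\<in>A. lookup t i)" if "finite A" for A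
    using that by induction (auto simp: monom_0 one_pCons monom_linear_power mult_monom)
  from this[of "keys t"]
  have "grade_poly (eval_monom Var t :: 'k mpoly) = monom (eval_monom Var t) (mdeg t)"
    by (simp add: eval_monom_def grade_poly_simps grade_poly_Var mdeg_def)
  then show ?thesis
    by (simp add: single_as_product grade_poly_simps grade_poly_Const smult_monom)
qed

lemma coeff_grade_poly:
  "coeff (grade_poly p) e =
    (\<Sum>t\<in>{t\<in>keys p. mdeg t = e}. single t (lookup p t))"
proof -
  have "coeff (grade_poly p) e =
      (\<Sum>t\<in>keys p. if mdeg t = e then single t (lookup p t) else 0)"
    by (subst (1) mpoly_sum_singles)
       (simp add: grade_poly_simps grade_poly_single coeff_sum)
  also have "\<dots> = (\<Sum>t\<in>{t\<in>keys p. mdeg t = e}. single t (lookup p t))"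
    by (rule sum.mono_neutral_cong_right) auto
  finally show ?thesis .
qed

lemma forms_iff: "p \<in> forms N e \<longleftrightarrow> p \<in> poly_over {..<N} \<and> grade_poly p = monom p e"
proof -
  have "(\<forall>t\<in>keys p. mdeg t = e) \<longleftrightarrow> grade_poly p = monom p e"
  proof
    assume *: "\<forall>t\<in>keys p. mdeg t = e"
    show "grade_poly p = monom p e"
    proof (rule poly_eqI)
      fix i
      have "{t\<in>keys p. mdeg t = i} = (if i = e then keys p else {})"
        using * by auto
      then show "coeff (grade_poly p) i = coeff (monom p e) i"
        using mpoly_sum_singles[of p] by (auto simp: coeff_grade_poly)
    qed
  next
    assume *: "grade_poly p = monom p e"
    show "\<forall>t\<in>keys p. mdeg t = e"
    proof (rule ballI, rule ccontr)
      fix t assume t: "t \<in> keys p" "mdeg t \<noteq> e"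
      have "lookup (coeff (grade_poly p) (mdeg t)) t
         = (\<Sum>s\<in>{s\<in>keys p. mdeg s = mdeg t}. if s = t then lookup p s else 0)"
        unfolding coeff_grade_poly lookup_sum by (rule sum.cong) (auto simp: lookup_single when_def)
      also have "\<dots> = lookup p t" using t by (auto simp: sum.delta)
      finally show False using t * by (simp add: in_keys_iff)
    qed
  qed
  then show ?thesis by (auto simp: forms_def carrier_mpoly_ring)
qed

section \<open>Unique factorisation\<close>

text \<open>
  The argument of Gauss: if neither factor has all its coefficients in the prime \<open>P\<close> of
  the subring \<open>A\<close>, the first coefficients outside \<open>P\<close> contribute the only term outside \<open>P\<close> to
  a coefficient of the product. It is used for the multiples of a prime element and for
  extensions of prime ideals.
\<close>

lemma prime_coefficients_of_product:
  fixes F G :: "'a::comm_ring_1 poly"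
  assumes "F \<in> polys_with_coeffs A" "G \<in> polys_with_coeffs A" "F * G \<in> polys_with_coeffs P"
    and P0: "0 \<in> P" and Padd: "\<And>a b. a \<in> P \<Longrightarrow> b \<in> P \<Longrightarrow> a + b \<in> P"
    and Pneg: "\<And>a. a \<in> P \<Longrightarrow> - a \<in> P"
    and Pmult: "\<And>a b. a \<in> P \<Longrightarrow> b \<in> A \<Longrightarrow> a * b \<in> P"
    and Pprime: "\<And>a b. a \<in> A \<Longrightarrow> b \<in> A \<Longrightarrow> a * b \<in> P \<Longrightarrow> a \<in> P \<or> b \<in> P"
  shows "F \<in> polys_with_coeffs P \<or> G \<in> polys_with_coeffs P"
proof (rule ccontr)
  assume "\<not> ?thesis"
  then have ex: "\<exists>i. coeff F i \<notin> P" "\<exists>j. coeff G j \<notin> P"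
    by (auto simp: polys_with_coeffs_def)
  define i where "i = (LEAST i. coeff F i \<notin> P)"
  define j where "j = (LEAST j. coeff G j \<notin> P)"
  have i: "coeff F i \<notin> P" "\<And>k. k < i \<Longrightarrow> coeff F k \<in> P"
    unfolding i_def using LeastI_ex[OF ex(1)] not_less_Least by blast+
  have j: "coeff G j \<notin> P" "\<And>k. k < j \<Longrightarrow> coeff G k \<in> P"
    unfolding j_def using LeastI_ex[OF ex(2)] not_less_Least by blast+
  have A: "coeff F k \<in> A" "coeff G k \<in> A" for k
    using assms(1,2) by (auto simp: polys_with_coeffs_def)
  have Psum: "sum u S \<in> P" if "\<And>x. x \<in> S \<Longrightarrow> u x \<in> P" for u and S :: "nat set"
    using that by (induction S rule: infinite_finite_induct) (auto simp: P0 Padd)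
  let ?s = "\<Sum>k\<in>{..i + j} - {i}. coeff F k * coeff G (i + j - k)"
  have "?s \<in> P"
  proof (rule Psum)
    fix k assume k: "k \<in> {..i + j} - {i}"
    show "coeff F k * coeff G (i + j - k) \<in> P"
    proof (cases "k < i")
      case True
      then show ?thesis using i(2) A Pmult by blast
    next
      case False
      then have "i + j - k < j" using k by auto
      then show ?thesis using Pmult[OF j(2) A(1)] by (simp add: mult.commute)
    qed
  qed
  moreover have "coeff (F * G) (i + j) = coeff F i * coeff G j + ?s"
    unfolding coeff_mult by (subst sum.remove[of _ i]) auto
  moreover have "coeff (F * G) (i + j) \<in> P"
    using assms(3) by (auto simp: polys_with_coeffs_def)
  ultimately have "coeff F i * coeff G j \<in> P"
    using Padd[of "coeff (F * G) (i + j)" "- ?s"] Pneg by simp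
  then show False using Pprime A i(1) j(1) by blast
qed

lemma poly_over_le: "p \<in> poly_over {..<N} \<Longrightarrow> N \<le> M \<Longrightarrow> p \<in> poly_over {..<M}"
  by (rule poly_over_mono[of "{..<N}"]) auto

definition total_degree :: "'k::field mpoly \<Rightarrow> nat"
  where "total_degree p = degree (grade_poly p)"

lemma total_degree_mult: "p \<noteq> 0 \<Longrightarrow> q \<noteq> 0 \<Longrightarrow> total_degree (p * q) = total_degree p + total_degree q"
  by (simp add: total_degree_def grade_poly_simps degree_mult_eq)

lemma total_degree_0_Const:
  assumes "total_degree p = 0"
  obtains c where "p = Const c"
proof -
  obtain a where "grade_poly p = [:a:]"
    using assms by (auto simp: total_degree_def elim: degree_eq_zeroE)
  then have "p = coeff (grade_poly p) 0"
    using poly_grade_poly[of p] by simp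
  also have "\<dots> = (\<Sum>t\<in>{t\<in>keys p. mdeg t = 0}. single t (lookup p t))"
    by (simp add: coeff_grade_poly)
  also have "\<dots> = (\<Sum>t\<in>{t\<in>keys p. mdeg t = 0}. Const (lookup p t))"
  proof (rule sum.cong)
    fix t assume "t \<in> {t \<in> keys p. mdeg t = 0}"
    then have "t = 0" by (auto simp: mdeg_def in_keys_iff intro: poly_mapping_eqI)
    then show "single t (lookup p t) = Const (lookup p t)"
      by (simp add: Const_def)
  qed simp
  also have "\<dots> = Const (\<Sum>t\<in>{t\<in>keys p. mdeg t = 0}. lookup p t)"
    by (simp add: is_homD[OF is_hom_Const])
  finally show ?thesis using that by blast
qed

lemma Const_unit: "c \<noteq> 0 \<Longrightarrow> Const c dvd (1::'k::field mpoly)"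
  by (metis Const_1 is_homD(3)[OF is_hom_Const] dvdI right_inverse)

lemma unit_iff_total_degree: "p dvd 1 \<longleftrightarrow> p \<noteq> 0 \<and> total_degree (p::'k::field mpoly) = 0"
proof
  assume "p dvd 1"
  then obtain q where "p * q = 1" by (metis dvdE)
  moreover from this have "p \<noteq> 0" "q \<noteq> 0" by auto
  ultimately show "p \<noteq> 0 \<and> total_degree p = 0"
    using total_degree_mult[of p q] by (auto simp: total_degree_def grade_poly_simps)
next
  assume "p \<noteq> 0 \<and> total_degree p = 0"
  then show "p dvd 1" by (metis total_degree_0_Const Const_unit Const_eq_0_iff)
qed

lemma total_degree_less_mult:
  fixes p q :: "'k::field mpoly"
  assumes "p \<noteq> 0" "q \<noteq> 0" "\<not> q dvd 1" shows "total_degree p < total_degree (p * q)"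
  using assms by (auto simp: total_degree_mult unit_iff_total_degree)

text \<open>
  Degrees in each variable add up, so a factor cannot involve new variables. Hence
  divisibility in one of the rings \<open>k[x\<^sub>0,\<dots>,x\<^sub>N\<^sub>-\<^sub>1]\<close> agrees with divisibility among all
  polynomials, and the notions of the type class apply.
\<close>

lemma poly_over_if_factor:
  assumes "b * c \<in> poly_over V" "b * c \<noteq> (0::'k::field mpoly)"
  shows "c \<in> poly_over V"
proof -
  have "j \<in> V" if j: "j \<in> mvars c" for j
  proof (rule ccontr)
    assume "j \<notin> V"
    then have "split_var j (b * c) = [:b * c:]" by (rule split_var_free[OF assms(1)])
    then have "degree (split_var j b * split_var j c) = 0" by (simp add: split_var_simps)
    then have "degree (split_var j c) = 0" using assms(2) by (simp add: degree_mult_eq)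
    then obtain a where "split_var j c = [:a:]" by (rule degree_eq_zeroE)
    then have "c = coeff (split_var j c) 0" using poly_split_var[of j c] by simp
    also have "\<dots> \<in> poly_over (mvars c - {j})" by (rule split_var_coeff) (simp add: poly_over_def)
    finally show False using j by (auto simp: poly_over_def)
  qed
  then show ?thesis by (auto simp: poly_over_def)
qed

lemma poly_over_if_dvd:
  assumes "c dvd a" "a \<in> poly_over V" "a \<noteq> (0::'k::field mpoly)"
  shows "c \<in> poly_over V"
  using assms poly_over_if_factor by (metis dvdE mult.commute)

lemma dvd_iff_coeffs:
  assumes "p \<in> poly_over {..<N}"
  shows "p dvd a \<longleftrightarrow> (\<forall>e. p dvd coeff (split_var N a) e)"
proof -
  have "p dvd a \<longleftrightarrow> [:p:] dvd split_var N a"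
  proof
    assume "p dvd a"
    then show "[:p:] dvd split_var N a"
      by (metis assms dvd_def split_var_const split_var_simps(3))
  next
    assume "[:p:] dvd split_var N a"
    then obtain Q where "split_var N a = [:p:] * Q" by (elim dvdE)
    then have "poly (split_var N a) (Var N) = p * poly Q (Var N)" by simp
    then show "p dvd a" by simp
  qed
  then show ?thesis by (simp add: const_poly_dvd_iff)
qed

text \<open>
  A prime element stays prime when variables are adjoined, since divisibility by it can
  be tested on coefficients.
\<close>

lemma prime_in_larger_ring:
  fixes p :: "'k::field mpoly"
  assumes p: "p \<in> poly_over {..<N}"
    and pr: "\<And>a b. a \<in> poly_over {..<N} \<Longrightarrow> b \<in> poly_over {..<N} \<Longrightarrow> p dvd a * b \<Longrightarrow> p dvd a \<or> p dvd b"
    and a: "a \<in> poly_over {..<N + k}" and b: "b \<in> poly_over {..<N + k}" and "p dvd a * b"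
  shows "p dvd a \<or> p dvd b"
  using a b \<open>p dvd a * b\<close>
proof (induction k arbitrary: a b)
  case (Suc k)
  let ?M = "N + k"
  have pM: "p \<in> poly_over {..<?M}" using p by (rule poly_over_le) simp
  have "split_var ?M a \<in> polys_with_coeffs {c \<in> poly_over {..<?M}. p dvd c}
      \<or> split_var ?M b \<in> polys_with_coeffs {c \<in> poly_over {..<?M}. p dvd c}"
  proof (rule prime_coefficients_of_product[where A="poly_over {..<?M}"])
    show "split_var ?M a \<in> polys_with_coeffs (poly_over {..<?M})"
      "split_var ?M b \<in> polys_with_coeffs (poly_over {..<?M})"
      using Suc.prems split_var_coeff_Suc by (auto simp: polys_with_coeffs_def)
    have "a * b \<in> poly_over {..<Suc ?M}" using Suc.prems by (auto intro: poly_over_mult)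
    then show "split_var ?M a * split_var ?M b \<in> polys_with_coeffs {c \<in> poly_over {..<?M}. p dvd c}"
      using dvd_iff_coeffs[OF pM, THEN iffD1, OF Suc.prems(3)] split_var_coeff_Suc[of "a * b"]
      unfolding polys_with_coeffs_def split_var_simps(3)[symmetric] by blast
    show "a \<in> {c \<in> poly_over {..<?M}. p dvd c} \<or> b \<in> {c \<in> poly_over {..<?M}. p dvd c}"
      if "a \<in> poly_over {..<?M}" "b \<in> poly_over {..<?M}" "a * b \<in> {c \<in> poly_over {..<?M}. p dvd c}" for a b
      using Suc.IH[OF that(1,2)] that by blast
  qed (simp_all add: poly_over_0 poly_over_add poly_over_mult poly_over_uminus)
  then show ?case
    unfolding dvd_iff_coeffs[OF pM, of a] dvd_iff_coeffs[OF pM, of b] polys_with_coeffs_def by blast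
qed (use pr in auto)

lemma prime_elem_if_prime_in_subring:
  fixes p :: "'k::field mpoly"
  assumes p: "p \<in> poly_over {..<N}" "p \<noteq> 0" "\<not> p dvd 1"
    and pr: "\<And>a b. a \<in> poly_over {..<N} \<Longrightarrow> b \<in> poly_over {..<N} \<Longrightarrow> p dvd a * b \<Longrightarrow> p dvd a \<or> p dvd b"
  shows "prime_elem p"
proof (rule prime_elemI)
  fix a b assume "p dvd a * b"
  obtain A B where "a \<in> poly_over {..<A}" "b \<in> poly_over {..<B}" using in_some_poly_over by metis
  then have "a \<in> poly_over {..<N + (A + B)}" "b \<in> poly_over {..<N + (A + B)}"
    by (auto intro: poly_over_le)
  then show "p dvd a \<or> p dvd b" using prime_in_larger_ring[OF p(1) pr] \<open>p dvd a * b\<close> by blast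
qed (use p in auto)

inductive prime_product :: "'a::comm_semiring_1 \<Rightarrow> bool" where
  unit: "u dvd 1 \<Longrightarrow> prime_product u"
| prime: "prime_elem p \<Longrightarrow> prime_product a \<Longrightarrow> prime_product (p * a)"

lemma prime_product_mult_unit:
  assumes "prime_product b" "u dvd 1" shows "prime_product (u * b)"
  using assms
proof (induction rule: prime_product.induct)
  case (unit v)
  then show ?case using mult_dvd_mono[of u 1 v 1] by (intro prime_product.unit) simp
next
  case (prime p a)
  then show ?case using prime_product.prime[of p "u * a"] by (simp only: mult.left_commute)
qed

lemma prime_product_mult:
  assumes "prime_product a" "prime_product b" shows "prime_product (a * b)"
  using assms
proof (induction rule: prime_product.induct)
  case (prime p a)
  then show ?case using prime_product.prime[of p "a * b"] by (simp only: mult.assoc)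
qed (simp add: prime_product_mult_unit)

text \<open>
  The prime factors of \<open>c\<close> are cancelled one after the other. This is both the lemma of
  Gauss on primitive polynomials and, once factorisations exist, Euclid's lemma.
\<close>

lemma dvd_cancel_coprime:
  fixes w :: "'a::idom"
  assumes "prime_product c" "\<And>p. prime_elem p \<Longrightarrow> p dvd c \<Longrightarrow> \<not> p dvd w" "w dvd c * h"
  shows "w dvd h"
  using assms
proof (induction arbitrary: h rule: prime_product.induct)
  case (unit u)
  then obtain v where "1 = u * v" by (elim dvdE)
  then have "h = u * h * v" by (metis mult.commute mult.left_commute mult.right_neutral)
  then show ?case using unit(3) by (metis dvd_mult2)
next
  case (prime p a)
  obtain q where q: "p * (a * h) = w * q" using prime.prems(2) by (auto simp: mult.assoc elim: dvdE)
  then have "p dvd w * q" by (metis dvd_triv_left)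
  then have "p dvd q" using prime.hyps prime.prems(1) by (auto simp: prime_elem_dvd_mult_iff)
  then obtain q' where "q = p * q'" by (elim dvdE)
  then have "a * h = w * q'" using q prime.hyps(1) by (auto simp: prime_elem_def mult.left_commute)
  then have "w dvd a * h" by simp
  then show ?case using prime.IH prime.prems(1) by (meson dvd_mult)
qed

lemma primitive_part_exists:
  fixes w :: "'k::field mpoly"
  assumes "w \<noteq> 0" "w \<in> poly_over V"
  shows "\<exists>d w'. w = d * w' \<and> d \<in> poly_over U \<and> w' \<noteq> 0 \<and> d \<noteq> 0 \<and> w' \<in> poly_over V \<and>
     (\<forall>p\<in>poly_over U. prime_elem p \<longrightarrow> \<not> p dvd w')"
  using assms
proof (induction "total_degree w" arbitrary: w rule: less_induct)
  case less
  show ?case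
  proof (cases "\<exists>p\<in>poly_over U. prime_elem p \<and> p dvd w")
    case True
    then obtain p v where p: "p \<in> poly_over U" "prime_elem p" "w = p * v" by (elim bexE conjE dvdE)
    then have v: "v \<noteq> 0" "v \<in> poly_over V"
      using less.prems poly_over_if_factor[of p v V] by (metis mult_zero_right)+
    have "total_degree v < total_degree w"
      using total_degree_less_mult[of v p] p v by (auto simp: prime_elem_def mult.commute)
    from less.hyps[OF this v] obtain d w' where "v = d * w'" "d \<in> poly_over U" "w' \<noteq> 0" "d \<noteq> 0"
      "w' \<in> poly_over V" "\<forall>p\<in>poly_over U. prime_elem p \<longrightarrow> \<not> p dvd w'" by blast
    then show ?thesis using p
      by (intro exI[of _ "p * d"] exI[of _ w']) (auto simp: mult.assoc poly_over_mult prime_elem_def)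
  next
    case False
    then show ?thesis using less.prems by (intro exI[of _ 1] exI[of _ w]) (auto simp: poly_over_1)
  qed
qed

text \<open>
  Multiplying by the leading coefficient of \<open>w\<close> in \<open>x\<^sub>N\<close> makes each step of the Euclidean
  division possible without fractions.
\<close>

lemma pseudo_division_exists:
  fixes w :: "'k::field mpoly"
  assumes w: "w \<in> poly_over {..<Suc N}" "w \<noteq> 0" and f: "f \<in> poly_over {..<Suc N}"
  shows "\<exists>c q r. c \<in> poly_over {..<N} \<and> c \<noteq> 0 \<and> q \<in> poly_over {..<Suc N} \<and> c * f = q * w + r \<and>
    (r = 0 \<or> degree (split_var N r) < degree (split_var N w))"
  using f
proof (induction "degree (split_var N f)" arbitrary: f rule: less_induct)
  case less
  let ?deg = "\<lambda>p. degree (split_var N p)"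
  let ?lc = "\<lambda>p. coeff (split_var N p) (?deg p)"
  consider "?deg f < ?deg w" | "?deg w \<le> ?deg f" "f = 0" | "?deg w \<le> ?deg f" "f \<noteq> 0" by linarith
  then show ?case
  proof cases
    case 1
    then show ?thesis by (intro exI[of _ 1] exI[of _ 0] exI[of _ f]) (auto simp: poly_over_intros)
  next
    case 2
    then show ?thesis by (intro exI[of _ 1] exI[of _ 0] exI[of _ 0]) (auto simp: poly_over_intros)
  next
    case 3
    define s where "s = ?lc f * Var N ^ (?deg f - ?deg w)"
    define f1 where "f1 = ?lc w * f - s * w"
    have lc: "?lc w \<in> poly_over {..<N}" "?lc f \<in> poly_over {..<N}" "?lc w \<noteq> 0" "?lc f \<noteq> 0"
      using split_var_coeff_Suc w less.prems 3 by (auto simp: leading_coeff_0_iff)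
    have lc': "?lc w \<in> poly_over {..<Suc N}" "?lc f \<in> poly_over {..<Suc N}"
      using lc by (auto intro: poly_over_le)
    have s: "s \<in> poly_over {..<Suc N}"
      unfolding s_def using lc' by (intro poly_over_intros) auto
    have f1: "f1 \<in> poly_over {..<Suc N}"
      unfolding f1_def using s lc' less.prems w by (intro poly_over_intros) auto
    have split_f1: "split_var N f1 = smult (?lc w) (split_var N f)
        - monom (?lc f) (?deg f - ?deg w) * split_var N w"
      using lc by (simp add: f1_def s_def split_var_simps split_var_const split_var_Var Polynomial.monom_altdef)
    have "coeff (split_var N f1) e = 0" if "e \<ge> ?deg f" for e
    proof (cases "e = ?deg f")
      case True
      have "coeff (split_var N f1) (?deg f) = ?lc w * ?lc f - ?lc f * ?lc w"
        using 3 by (simp add: split_f1 coeff_monom_mult)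
      then show ?thesis using True by simp
    next
      case False
      then have "coeff (split_var N f) e = 0"
        "coeff (split_var N w) (e - (?deg f - ?deg w)) = 0"
        using that 3 by (auto intro!: coeff_eq_0)
      then show ?thesis by (simp add: split_f1 coeff_monom_mult)
    qed
    then have "f1 = 0 \<or> ?deg f1 < ?deg f"
      by (metis leading_coeff_0_iff linorder_not_less split_var_eq_0)
    then show ?thesis
    proof
      assume "f1 = 0"
      then show ?thesis using lc s
        by (intro exI[of _ "?lc w"] exI[of _ s] exI[of _ 0]) (auto simp: f1_def)
    next
      assume "?deg f1 < ?deg f"
      from less.hyps[OF this f1] obtain c q r where *: "c \<in> poly_over {..<N}" "c \<noteq> 0"
        "q \<in> poly_over {..<Suc N}" "c * f1 = q * w + r" "r = 0 \<or> ?deg r < ?deg w" by blast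
      have "c \<in> poly_over {..<Suc N}" using *(1) by (rule poly_over_le) simp
      then have "q + c * s \<in> poly_over {..<Suc N}" using * s by (intro poly_over_intros)
      moreover have "c * ?lc w * f = (q + c * s) * w + r"
        using *(4) by (simp add: f1_def algebra_simps)
      moreover have "c * ?lc w \<in> poly_over {..<N}" using * lc by (intro poly_over_intros)
      ultimately show ?thesis using * lc by (intro exI[of _ "c * ?lc w"] exI[of _ "q + c * s"] exI[of _ r]) auto
    qed
  qed
qed

text \<open>
  Let \<open>f\<close> be irreducible of positive degree in \<open>x\<^sub>N\<close>; it is primitive. If \<open>f\<close> divides \<open>g h\<close>, take
  a nonzero element \<open>w\<close> of least degree in \<open>x\<^sub>N\<close> in the ideal generated by \<open>f\<close> and \<open>h\<close>. By
  pseudo-division it divides multiples of \<open>f\<close> and of \<open>h\<close> by nonzero polynomials free of \<open>x\<^sub>N\<close>,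
  so its primitive part divides \<open>f\<close>. Either this part is associated to \<open>f\<close>, and then \<open>f\<close>
  divides \<open>h\<close>, or \<open>w\<close> is free of \<open>x\<^sub>N\<close>, and then \<open>f\<close> divides \<open>w g\<close> and hence \<open>g\<close>. This avoids the
  field of fractions.
\<close>

lemma irreducible_prime_elem_step:
  fixes f :: "'k::field mpoly"
  assumes IH: "\<And>c::'k mpoly. c \<in> poly_over {..<N} \<Longrightarrow> c \<noteq> 0 \<Longrightarrow> prime_product c"
    and f: "f \<in> poly_over {..<Suc N}" and irr: "Factorial_Ring.irreducible f"
  shows "prime_elem f"
proof (cases "f \<in> poly_over {..<N}")
  case True
  have f0: "f \<noteq> 0" "\<not> f dvd 1" using irr by (auto simp: Factorial_Ring.irreducible_def)
  with IH[OF True] obtain p a where pa: "f = p * a" "prime_elem p"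
    by (auto elim: prime_product.cases)
  then have "a dvd 1" using irr by (auto simp: Factorial_Ring.irreducible_def prime_elem_def)
  then obtain a' where a': "1 = a * a'" by (elim dvdE)
  have "f dvd x \<longleftrightarrow> p dvd x" for x
  proof
    assume "p dvd x"
    then obtain y where "x = p * y" by (elim dvdE)
    then have "x = p * (a * a') * y" using a' by simp
    then have "x = f * (a' * y)" using pa(1) by (simp only: mult.assoc)
    then show "f dvd x" by simp
  qed (metis pa(1) dvd_mult_left)
  then show ?thesis using pa(2) by (intro prime_elemI) (use f0 in \<open>auto simp: prime_elem_dvd_mult_iff\<close>)
next
  case fN: False
  have f0: "f \<noteq> 0" "\<not> f dvd 1" using irr by (auto simp: Factorial_Ring.irreducible_def)
  let ?deg = "\<lambda>p. degree (split_var N p)"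
  have f_prim: "\<not> p dvd f" if p: "p \<in> poly_over {..<N}" "prime_elem p" for p
  proof
    assume "p dvd f"
    then obtain q where q: "f = p * q" by (elim dvdE)
    then have "q dvd 1" using irr p by (auto simp: Factorial_Ring.irreducible_def prime_elem_def)
    then obtain q' where "1 = q * q'" by (elim dvdE)
    then have "p = f * q'" using q by (metis mult.assoc mult.right_neutral)
    then have "f dvd p" by simp
    then show False using fN poly_over_if_dvd[of f p] p by (auto simp: prime_elem_def)
  qed
  have cancel: "v dvd h" if "c \<in> poly_over {..<N}" "c \<noteq> 0" "v dvd c * h"
    "\<And>p. p \<in> poly_over {..<N} \<Longrightarrow> prime_elem p \<Longrightarrow> \<not> p dvd v" for c v h :: "'k mpoly"
    by (rule dvd_cancel_coprime[OF IH[OF that(1,2)] _ that(3)]) (use that poly_over_if_dvd in blast)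
  show ?thesis
  proof (rule prime_elem_if_prime_in_subring[OF f f0])
    fix g h assume g: "g \<in> poly_over {..<Suc N}" and h: "h \<in> poly_over {..<Suc N}" and gh: "f dvd g * h"
    show "f dvd g \<or> f dvd h"
    proof (rule disjCI)
      assume "\<not> f dvd h"
      define M where "M = {u * f + v * h |u v. u \<in> poly_over {..<Suc N} \<and> v \<in> poly_over {..<Suc N}}"
      have "1 * f + 0 * h \<in> M" unfolding M_def using poly_over_0 poly_over_1 by blast
      then have "\<exists>w. w \<in> M \<and> w \<noteq> 0" using f0 by auto
      then obtain w where w: "w \<in> M" "w \<noteq> 0" and min: "\<And>r. r \<in> M \<Longrightarrow> r \<noteq> 0 \<Longrightarrow> ?deg w \<le> ?deg r"
        using ex_has_least_nat[of "\<lambda>w. w \<in> M \<and> w \<noteq> 0" _ ?deg] by metis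
      obtain u v where uv: "w = u * f + v * h" "u \<in> poly_over {..<Suc N}" "v \<in> poly_over {..<Suc N}"
        using w by (auto simp: M_def)
      have wS: "w \<in> poly_over {..<Suc N}" unfolding uv(1) using uv f h by (intro poly_over_intros)
      have div: "\<exists>c. c \<in> poly_over {..<N} \<and> c \<noteq> 0 \<and> w dvd c * x" if x: "x = f \<or> x = h" for x
      proof -
        have xS: "x \<in> poly_over {..<Suc N}" using f h x by auto
        obtain c q r where *: "c \<in> poly_over {..<N}" "c \<noteq> 0"
          "q \<in> poly_over {..<Suc N}" "c * x = q * w + r" "r = 0 \<or> ?deg r < ?deg w"
          using pseudo_division_exists[OF wS w(2) xS] by blast
        have c: "c \<in> poly_over {..<Suc N}" using *(1) by (rule poly_over_le) simp
        have "r = (if x = f then (c - q * u) * f + (- q * v) * h else (- q * u) * f + (c - q * v) * h)"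
          using *(4) x by (auto simp: uv(1) algebra_simps)
        moreover have "c - q * u \<in> poly_over {..<Suc N}" "c - q * v \<in> poly_over {..<Suc N}"
          "- q * u \<in> poly_over {..<Suc N}" "- q * v \<in> poly_over {..<Suc N}"
          using c * uv by (auto intro!: poly_over_intros)
        ultimately have "\<exists>u' v'. r = u' * f + v' * h \<and> u' \<in> poly_over {..<Suc N} \<and> v' \<in> poly_over {..<Suc N}"
          by metis
        then have "r \<in> M" unfolding M_def by blast
        then have "r = 0" using * min by force
        then show ?thesis using * by auto
      qed
      obtain d w' where dw: "w = d * w'" "d \<in> poly_over {..<N}" "w' \<noteq> 0" "d \<noteq> 0"
        "w' \<in> poly_over {..<Suc N}" and prim: "\<And>p. p \<in> poly_over {..<N} \<Longrightarrow> prime_elem p \<Longrightarrow> \<not> p dvd w'"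
        using primitive_part_exists[OF w(2) wS, of "{..<N}"] by blast
      obtain c1 where "c1 \<in> poly_over {..<N}" "c1 \<noteq> 0" "w dvd c1 * f" using div by blast
      then have "w' dvd f" using cancel[of c1 w' f] prim dw(1) by (metis dvd_mult_right)
      then obtain t where t: "f = w' * t" by (elim dvdE)
      then have "w' dvd 1 \<or> t dvd 1" using irr by (auto simp: Factorial_Ring.irreducible_def)
      then show "f dvd g"
      proof
        assume "t dvd 1"
        then have "f dvd w'" unfolding t by (simp add: mult_unit_dvd_iff)
        obtain c2 where "c2 \<in> poly_over {..<N}" "c2 \<noteq> 0" "w dvd c2 * h" using div by blast
        then have "f dvd h" using cancel[of c2 f h] f_prim \<open>f dvd w'\<close> dw(1)
          by (metis dvd_mult_right dvd_trans)
        then show ?thesis using \<open>\<not> f dvd h\<close> by blast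
      next
        assume unit: "w' dvd 1"
        then have "w' \<in> poly_over {..<N}" using poly_over_if_dvd[of w' 1] poly_over_1 by auto
        then have "w \<in> poly_over {..<N}" using dw by (auto intro: poly_over_mult)
        moreover have "w * g = (u * g) * f + v * (g * h)" by (simp add: uv(1) algebra_simps)
        then have "f dvd w * g" using gh by simp
        ultimately show ?thesis using cancel[of w f g] w(2) f_prim by blast
      qed
    qed
  qed
qed

lemma prime_product_if_irreducibles_prime:
  fixes f :: "'k::field mpoly"
  assumes "\<And>h :: 'k mpoly. h \<in> poly_over V \<Longrightarrow> Factorial_Ring.irreducible h \<Longrightarrow> prime_elem h" "f \<in> poly_over V" "f \<noteq> 0"
  shows "prime_product f"
  using assms(2,3)
proof (induction "total_degree f" arbitrary: f rule: less_induct)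
  case less
  show ?case
  proof (cases "f dvd 1 \<or> Factorial_Ring.irreducible f")
    case True
    then show ?thesis using assms(1)[of f] less.prems prime_product.prime[of f 1] prime_product.unit by force
  next
    case False
    then obtain a b where ab: "f = a * b" "\<not> a dvd 1" "\<not> b dvd 1"
      using less.prems by (auto simp: Factorial_Ring.irreducible_def)
    then have *: "a \<noteq> 0" "b \<noteq> 0" "a \<in> poly_over V" "b \<in> poly_over V"
      using less.prems poly_over_if_factor[of a b] poly_over_if_factor[of b a] by (auto simp: mult.commute)
    then have "total_degree a < total_degree f" "total_degree b < total_degree f"
      using ab total_degree_less_mult[of a b] total_degree_less_mult[of b a] by (auto simp: mult.commute)
    then show ?thesis using less.hyps * ab(1) prime_product_mult by blast
  qed
qed

text \<open>
  Unique factorisation, by induction on the number of variables. Factorisations into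
  irreducible elements exist because the total degree drops, so only the primality of
  irreducible elements needs the induction.
\<close>

theorem mpoly_prime_product:
  fixes f :: "'k::field mpoly"
  assumes "f \<noteq> 0" shows "prime_product f"
proof -
  have "\<forall>f::'k mpoly. f \<in> poly_over {..<N} \<longrightarrow> f \<noteq> 0 \<longrightarrow> prime_product f" for N
  proof (induction N)
    case 0
    have "f dvd 1" if "f \<in> poly_over {..<0}" "f \<noteq> 0" for f :: "'k mpoly"
    proof -
      have "keys t = {}" if "t \<in> keys f" for t
        using \<open>f \<in> poly_over {..<0}\<close> that by (auto simp: poly_over_def mvars_def)
      then have "keys f \<subseteq> {0}" by auto
      then have "f \<in> forms 0 0" using \<open>f \<in> poly_over {..<0}\<close> by (auto simp: forms_def carrier_mpoly_ring mdeg_def)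
      then show ?thesis using \<open>f \<noteq> 0\<close> by (simp add: unit_iff_total_degree total_degree_def forms_iff Polynomial.degree_monom_eq)
    qed
    then show ?case by (auto intro: prime_product.unit)
  next
    case (Suc N)
    then show ?case
      using prime_product_if_irreducibles_prime[of "{..<Suc N}"] irreducible_prime_elem_step[of N] by blast
  qed
  then show ?thesis using in_some_poly_over assms by metis
qed


lemma dvd_in_mpoly_ring:
  fixes a h :: "'k::field mpoly"
  assumes "h dvd a" "a \<in> poly_over {..<N}"
  shows "h divides\<^bsub>mpoly_ring N\<^esub> a"
proof -
  obtain c where c: "a = h * c" using assms(1) by (elim dvdE)
  show ?thesis
  proof (cases "a = 0")
    case True
    then show ?thesis by (auto simp: factor_def mpoly_ring_def mvars_def intro!: exI[of _ 0])
  next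
    case False
    then have "c \<in> poly_over {..<N}" using poly_over_if_factor c assms(2) by metis
    then show ?thesis using c by (auto simp: factor_def mpoly_ring_def poly_over_def)
  qed
qed

lemma no_common_prime_if_gcd_is_one:
  fixes A :: "'k::field mpoly set"
  assumes "gcd_is_one (mpoly_ring N) A" "A \<subseteq> poly_over {..<N}" "a \<in> A" "a \<noteq> 0" "prime_elem p"
  shows "\<exists>b\<in>A. \<not> p dvd b"
proof (rule ccontr)
  assume "\<not> ?thesis"
  then have all: "\<And>b. b \<in> A \<Longrightarrow> p dvd b" by blast
  then have p: "p \<in> poly_over {..<N}" using assms(2-4) poly_over_if_dvd by blast
  have "p divides\<^bsub>mpoly_ring N\<^esub> \<one>\<^bsub>mpoly_ring N\<^esub>"
    using assms(1) p dvd_in_mpoly_ring[OF all] assms(2) unfolding gcd_is_one_def carrier_mpoly_ring by blast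
  then obtain c where "1 = p * c" by (auto simp: factor_def mpoly_ring_def)
  then have "p dvd 1" by (rule dvdI)
  then show False using assms(5) by (simp add: prime_elem_def)
qed

lemma coprime_dvd_cancel:
  fixes f g :: "'k::field mpoly"
  assumes "gcd_is_one (mpoly_ring N) {f, g}" "f \<in> poly_over {..<N}" "g \<in> poly_over {..<N}"
    "f \<noteq> 0" "g \<noteq> 0" "f dvd g * v"
  shows "f dvd v"
  by (rule dvd_cancel_coprime[OF mpoly_prime_product[OF assms(5)] _ assms(6)])
     (use no_common_prime_if_gcd_is_one[OF assms(1)] assms(2-5) in auto)

lemma prime_elem_dvd_symmetric:
  fixes p q :: "'a::idom"
  assumes "prime_elem p" "prime_elem q" "q dvd p" shows "p dvd q"
proof -
  obtain r where r: "p = q * r" using assms(3) by (elim dvdE)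
  then have "p dvd q \<or> p dvd r" using assms(1) by (metis dvd_refl prime_elem_dvd_multD)
  moreover have False if "p dvd r"
  proof -
    obtain t where "r = p * t" using \<open>p dvd r\<close> by (elim dvdE)
    then have "p * 1 = p * (q * t)" using r by (simp add: mult.left_commute)
    then have "1 = q * t" using assms(1) by (metis mult_left_cancel prime_elem_def)
    then show False using assms(2) by (metis dvd_triv_left prime_elem_def)
  qed
  ultimately show ?thesis by blast
qed

text \<open>
  Prime avoidance for principal primes, by induction on the factorisation of \<open>a\<close>: if the
  element \<open>b\<close> found for \<open>a\<close> is divisible by the next prime \<open>p\<close>, it is replaced by \<open>b + a c\<close> with
  some \<open>c\<close> in \<open>J\<close> outside \<open>(p)\<close>.
\<close>

lemma coprime_element_exists:
  fixes J :: "'k::field mpoly set"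
  assumes "0 \<in> J" "\<And>a b. a \<in> J \<Longrightarrow> b \<in> J \<Longrightarrow> a + b \<in> J"
    "\<And>a b. a \<in> poly_over V \<Longrightarrow> b \<in> J \<Longrightarrow> a * b \<in> J"
    and noprime: "\<And>p. prime_elem p \<Longrightarrow> \<exists>c\<in>J. \<not> p dvd c"
    and "a \<in> poly_over V" "a \<noteq> 0"
  shows "\<exists>b\<in>J. \<forall>p. prime_elem p \<longrightarrow> p dvd a \<longrightarrow> \<not> p dvd b"
  using mpoly_prime_product[OF assms(6)] assms(5,6)
proof (induction rule: prime_product.induct)
  case (unit u)
  then have "\<not> p dvd u" if "prime_elem p" for p :: "'k mpoly"
    using that by (meson dvd_trans prime_elem_def)
  then show ?case using assms(1) by blast
next
  case (prime p a)
  have a: "a \<in> poly_over V" "a \<noteq> 0"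
    using prime.prems poly_over_if_factor[of p a V] by auto
  then obtain b where b: "b \<in> J" "\<And>q. prime_elem q \<Longrightarrow> q dvd a \<Longrightarrow> \<not> q dvd b"
    using prime.IH by blast
  show ?case
  proof (cases "p dvd b")
    case False
    have "\<not> q dvd b" if q: "prime_elem q" "q dvd p * a" for q
    proof
      assume qb: "q dvd b"
      then have "q dvd p" using q b(2) prime_elem_dvd_multD by blast
      then have "p dvd q" by (rule prime_elem_dvd_symmetric[OF prime.hyps(1) q(1)])
      then show False using qb False dvd_trans by blast
    qed
    then show ?thesis using b(1) by blast
  next
    case True
    then have pa: "\<not> p dvd a" using b(2) prime.hyps by blast
    obtain c where c: "c \<in> J" "\<not> p dvd c" using noprime prime.hyps by blast
    have "\<not> q dvd b + a * c" if q: "prime_elem q" "q dvd p * a" for q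
    proof (cases "q dvd a")
      case True
      then show ?thesis using b(2)[OF q(1)] by (metis dvd_add_left_iff dvd_mult2)
    next
      case qa: False
      then have "q dvd p" using q prime_elem_dvd_multD by blast
      moreover have "\<not> p dvd b + a * c"
        using True pa c(2) prime.hyps by (metis dvd_add_right_iff prime_elem_dvd_multD)
      moreover have "p dvd q"
        using prime_elem_dvd_symmetric[OF prime.hyps(1) q(1)] \<open>q dvd p\<close> by blast
      ultimately show ?thesis by (meson dvd_trans)
    qed
    then show ?thesis using b(1) c(1) a assms(2,3) by blast
  qed
qed

lemma regular_pair_exists:
  fixes J :: "'k::field mpoly set"
  assumes "0 \<in> J" "\<And>a b. a \<in> J \<Longrightarrow> b \<in> J \<Longrightarrow> a + b \<in> J"
    "\<And>a b. a \<in> poly_over V \<Longrightarrow> b \<in> J \<Longrightarrow> a * b \<in> J"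
    and "\<And>p. prime_elem p \<Longrightarrow> \<exists>c\<in>J. \<not> p dvd c"
    and "a \<in> poly_over V" "a \<noteq> 0"
  shows "\<exists>b\<in>J. \<forall>v. a dvd b * v \<longrightarrow> a dvd v"
proof -
  obtain b where b: "b \<in> J" "\<And>p. prime_elem p \<Longrightarrow> p dvd a \<Longrightarrow> \<not> p dvd b"
    using coprime_element_exists[OF assms] by blast
  have "a dvd v" if "a dvd b * v" for v
  proof (cases "b = 0")
    case False
    show ?thesis
      by (rule dvd_cancel_coprime[OF mpoly_prime_product[OF False] _ that]) (use b in blast)
  next
    case True
    then have "\<not> p dvd a" if "prime_elem p" for p using b(2)[OF that] by auto
    then have "a dvd 1" using mpoly_prime_product[OF assms(6)] by (metis dvd_triv_left prime_product.cases)
    then show ?thesis by (meson dvd_trans one_dvd)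
  qed
  then show ?thesis using b(1) by blast
qed

section \<open>Heights of primes in polynomial rings\<close>

lemma mpoly_ring_simps [simp]:
  "x \<otimes>\<^bsub>mpoly_ring N\<^esub> y = x * y" "x \<oplus>\<^bsub>mpoly_ring N\<^esub> y = x + y"
  "\<one>\<^bsub>mpoly_ring N\<^esub> = 1" "\<zero>\<^bsub>mpoly_ring N\<^esub> = 0"
  by (simp_all add: mpoly_ring_def)

lemma ideal_mpoly_ring_iff:
  "ideal J (mpoly_ring N) \<longleftrightarrow> J \<subseteq> poly_over {..<N} \<and> 0 \<in> J \<and>
    (\<forall>a\<in>J. \<forall>b\<in>J. a + b \<in> J) \<and> (\<forall>a\<in>poly_over {..<N}. \<forall>b\<in>J. a * b \<in> J)"
proof
  assume "ideal J (mpoly_ring N)"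
  then interpret ideal J "mpoly_ring N" .
  show "J \<subseteq> poly_over {..<N} \<and> 0 \<in> J \<and>
    (\<forall>a\<in>J. \<forall>b\<in>J. a + b \<in> J) \<and> (\<forall>a\<in>poly_over {..<N}. \<forall>b\<in>J. a * b \<in> J)"
    using a_subset additive_subgroup.zero_closed[OF ideal.axioms(1)[OF is_ideal]]
      additive_subgroup.a_closed[OF ideal.axioms(1)[OF is_ideal]] I_l_closed
    by (auto simp: carrier_mpoly_ring)
next
  assume *: "J \<subseteq> poly_over {..<N} \<and> 0 \<in> J \<and>
    (\<forall>a\<in>J. \<forall>b\<in>J. a + b \<in> J) \<and> (\<forall>a\<in>poly_over {..<N}. \<forall>b\<in>J. a * b \<in> J)"
  interpret cring "mpoly_ring N" by (rule cring_mpoly_ring)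
  have neg: "\<ominus>\<^bsub>mpoly_ring N\<^esub> a = - a" if "a \<in> poly_over {..<N}" for a
    by (rule minus_equality) (use that in \<open>auto simp: carrier_mpoly_ring poly_over_uminus\<close>)
  have "- a \<in> J" if "a \<in> J" for a
  proof -
    have "- 1 * a \<in> J" using * that poly_over_uminus[OF poly_over_1] by blast
    then show ?thesis by simp
  qed
  then have "\<ominus>\<^bsub>mpoly_ring N\<^esub> a \<in> J" if "a \<in> J" for a
    using neg[of a] * that by auto
  then have "subgroup J (add_monoid (mpoly_ring N))"
    by (intro add.subgroupI) (use * in \<open>auto simp: carrier_mpoly_ring a_inv_def[symmetric]\<close>)
  then show "ideal J (mpoly_ring N)"
    by (intro idealI ring_axioms) (use * in \<open>auto simp: carrier_mpoly_ring \<close>, metis mult.commute)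
qed

lemma primeideal_mpoly_ring_iff:
  "primeideal P (mpoly_ring N) \<longleftrightarrow> ideal P (mpoly_ring N) \<and> 1 \<notin> P \<and>
    (\<forall>a\<in>poly_over {..<N}. \<forall>b\<in>poly_over {..<N}. a * b \<in> P \<longrightarrow> a \<in> P \<or> b \<in> P)"
proof
  assume "primeideal P (mpoly_ring N)"
  then interpret primeideal P "mpoly_ring N" .
  show "ideal P (mpoly_ring N) \<and> 1 \<notin> P \<and>
    (\<forall>a\<in>poly_over {..<N}. \<forall>b\<in>poly_over {..<N}. a * b \<in> P \<longrightarrow> a \<in> P \<or> b \<in> P)"
    using is_ideal I_prime I_notcarr one_imp_carrier by (auto simp: carrier_mpoly_ring)
next
  assume *: "ideal P (mpoly_ring N) \<and> 1 \<notin> P \<and>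
    (\<forall>a\<in>poly_over {..<N}. \<forall>b\<in>poly_over {..<N}. a * b \<in> P \<longrightarrow> a \<in> P \<or> b \<in> P)"
  have "carrier (mpoly_ring N) \<noteq> P" using * by (auto simp: carrier_mpoly_ring poly_over_1)
  then show "primeideal P (mpoly_ring N)"
    by (intro primeidealI cring_mpoly_ring) (use * in \<open>auto simp: carrier_mpoly_ring\<close>)
qed

lemmas ideal_mpolyD = ideal_mpoly_ring_iff[THEN iffD1]

lemma ideal_mpoly_sum:
  assumes "ideal J (mpoly_ring N)" "\<And>x. x \<in> A \<Longrightarrow> u x \<in> J"
  shows "sum u A \<in> J"
  using assms(2) by (induction A rule: infinite_finite_induct)
    (use ideal_mpolyD[OF assms(1)] in auto)

lemma ideal_mpoly_uminus:
  assumes "ideal J (mpoly_ring N)" "a \<in> J" shows "- a \<in> J"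
proof -
  have "- 1 * a \<in> J"
    using ideal_mpolyD[OF assms(1)] assms(2) poly_over_uminus[OF poly_over_1] by blast
  then show ?thesis by simp
qed

definition prime_chain :: "('a, 'b) ring_scheme \<Rightarrow> nat \<Rightarrow> (nat \<Rightarrow> 'a set) \<Rightarrow> bool"
  where "prime_chain R l Q \<longleftrightarrow> (\<forall>i\<le>l. primeideal (Q i) R) \<and> (\<forall>i<l. Q i \<subset> Q (Suc i))"

lemma prime_height_ge: "prime_chain R l Q \<Longrightarrow> enat l \<le> prime_height R (Q l)"
  unfolding prime_height_def prime_chain_def by (rule Sup_upper) blast

lemma prime_height_le:
  assumes "\<And>l Q. prime_chain R l Q \<Longrightarrow> Q l = P \<Longrightarrow> enat l \<le> h"
  shows "prime_height R P \<le> h"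
  unfolding prime_height_def by (rule Sup_least) (use assms in \<open>auto simp: prime_chain_def\<close>)

lemma prime_chain_snoc:
  assumes "prime_chain R l Q" "Q l \<subset> P" "primeideal P R"
  shows "prime_chain R (Suc l) (Q(Suc l := P))"
  using assms unfolding prime_chain_def by (auto simp: le_Suc_eq less_Suc_eq)

text \<open>
  The extension \<open>P[x\<^sub>N]\<close> of an ideal \<open>P\<close> of \<open>k[x\<^sub>0,\<dots>,x\<^sub>N\<^sub>-\<^sub>1]\<close>.
\<close>

definition extended_ideal :: "nat \<Rightarrow> 'k::field mpoly set \<Rightarrow> 'k mpoly set"
  where "extended_ideal N P =
    {p \<in> poly_over {..<Suc N}. \<forall>e. coeff (split_var N p) e \<in> P}"

lemma extended_ideal_mono: "P \<subseteq> P' \<Longrightarrow> extended_ideal N P \<subseteq> extended_ideal N P'"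
  by (auto simp: extended_ideal_def)

lemma extended_ideal_contract:
  assumes "0 \<in> P" "P \<subseteq> poly_over {..<N}"
  shows "extended_ideal N P \<inter> poly_over {..<N} = P"
proof -
  have "p \<in> extended_ideal N P \<longleftrightarrow> p \<in> P" if "p \<in> poly_over {..<N}" for p
    using that assms poly_over_mono[of "{..<N}" "{..<Suc N}" p]
    by (auto simp: extended_ideal_def split_var_const coeff_pCons split: nat.splits)
  then show ?thesis using assms by auto
qed

lemma ideal_extended_ideal:
  assumes "ideal P (mpoly_ring N)"
  shows "ideal (extended_ideal N P) (mpoly_ring (Suc N))"
proof -
  have "coeff (split_var N (a * b)) e \<in> P"
    if "a \<in> poly_over {..<Suc N}" "b \<in> extended_ideal N P" for a b e
    using that ideal_mpolyD[OF assms] split_var_coeff_Suc[of a]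
    by (auto simp: split_var_simps coeff_mult extended_ideal_def intro!: ideal_mpoly_sum[OF assms])
  then show ?thesis
    using ideal_mpolyD[OF assms] unfolding ideal_mpoly_ring_iff
    by (auto simp: extended_ideal_def split_var_simps poly_over_0 poly_over_add poly_over_mult)
qed

lemma extended_ideal_least:
  assumes "ideal J (mpoly_ring (Suc N))" "P \<subseteq> J"
  shows "extended_ideal N P \<subseteq> J"
proof
  fix p assume p: "p \<in> extended_ideal N P"
  have "p = (\<Sum>i\<le>degree (split_var N p). Var N ^ i * coeff (split_var N p) i)"
    using poly_altdef[of "split_var N p" "Var N"] by (simp add: mult.commute)
  also have "\<dots> \<in> J"
  proof (rule ideal_mpoly_sum[OF assms(1)])
    fix i
    have "coeff (split_var N p) i \<in> J" using p assms(2) by (auto simp: extended_ideal_def)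
    then show "Var N ^ i * coeff (split_var N p) i \<in> J"
      using ideal_mpolyD[OF assms(1)] poly_over_power[OF poly_over_Var, of N "{..<Suc N}"] by blast
  qed
  finally show "p \<in> J" .
qed

lemma primeideal_extended_ideal:
  assumes "primeideal P (mpoly_ring N)"
  shows "primeideal (extended_ideal N P) (mpoly_ring (Suc N))"
proof -
  note P = assms[unfolded primeideal_mpoly_ring_iff]
  note I = ideal_mpolyD[OF conjunct1[OF P]]
  have "a \<in> extended_ideal N P \<or> b \<in> extended_ideal N P"
    if ab: "a \<in> poly_over {..<Suc N}" "b \<in> poly_over {..<Suc N}" "a * b \<in> extended_ideal N P" for a b
  proof -
    have "split_var N a \<in> polys_with_coeffs P \<or> split_var N b \<in> polys_with_coeffs P"
    proof (rule prime_coefficients_of_product[where A="poly_over {..<N}"])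
      show "split_var N a \<in> polys_with_coeffs (poly_over {..<N})"
        "split_var N b \<in> polys_with_coeffs (poly_over {..<N})"
        using ab split_var_coeff_Suc by (auto simp: polys_with_coeffs_def)
      show "split_var N a * split_var N b \<in> polys_with_coeffs P"
        using ab(3) by (auto simp: polys_with_coeffs_def extended_ideal_def split_var_simps)
      show "x * y \<in> P" if "x \<in> P" "y \<in> poly_over {..<N}" for x y
        using I that by (metis mult.commute)
    qed (use I P ideal_mpoly_uminus[of P N] in auto)
    then show ?thesis using ab by (auto simp: extended_ideal_def polys_with_coeffs_def)
  qed
  moreover have "1 \<notin> extended_ideal N P"
    using P extended_ideal_contract[of P N] I poly_over_1 by blast
  ultimately show ?thesis
    unfolding primeideal_mpoly_ring_iff using ideal_extended_ideal P by blast
qed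

lemma primeideal_contract:
  assumes "primeideal P (mpoly_ring (Suc N))"
  shows "primeideal (P \<inter> poly_over {..<N}) (mpoly_ring N)"
proof -
  have "poly_over {..<N} \<subseteq> (poly_over {..<Suc N} :: 'a mpoly set)"
    using poly_over_mono[of "{..<N}" "{..<Suc N}"] by auto
  then show ?thesis
    using assms unfolding primeideal_mpoly_ring_iff ideal_mpoly_ring_iff
    by (auto simp: poly_over_0 poly_over_1 poly_over_add poly_over_mult subset_iff)
qed

lemma prime_chain_extended:
  assumes "prime_chain (mpoly_ring N) l Q"
  shows "prime_chain (mpoly_ring (Suc N)) l (\<lambda>i. extended_ideal N (Q i))"
proof -
  have "extended_ideal N (Q i) \<subset> extended_ideal N (Q (Suc i))" if "i < l" for i
  proof -
    have *: "0 \<in> Q j \<and> Q j \<subseteq> poly_over {..<N}" if "j \<le> l" for j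
      using assms that unfolding prime_chain_def primeideal_mpoly_ring_iff ideal_mpoly_ring_iff by blast
    have "Q i \<subset> Q (Suc i)" using assms that by (auto simp: prime_chain_def)
    moreover have "extended_ideal N (Q j) \<inter> poly_over {..<N} = Q j" if "j \<le> l" for j
      using extended_ideal_contract *[OF that] by blast
    ultimately show ?thesis using that extended_ideal_mono[of "Q i" "Q (Suc i)" N]
      by (metis Suc_leI less_imp_le psubset_eq)
  qed
  then show ?thesis using assms by (auto simp: prime_chain_def intro: primeideal_extended_ideal)
qed

text \<open>
  By induction on the number of variables. Extend a chain for the contraction \<open>P'\<close> of \<open>P\<close>.
  If \<open>P\<close> is the extension of \<open>P'\<close>, the new variable is independent of \<open>V\<close> modulo \<open>P\<close> and joins
  \<open>V\<close>; otherwise \<open>P\<close> itself can be appended to the chain.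
\<close>

lemma long_prime_chain_exists:
  fixes P :: "'k::field mpoly set"
  assumes "primeideal P (mpoly_ring N)"
  shows "\<exists>V Q. V \<subseteq> {..<N} \<and> P \<inter> poly_over V \<subseteq> {0} \<and> prime_chain (mpoly_ring N) (N - card V) Q \<and>
    Q (N - card V) = P"
  using assms
proof (induction N arbitrary: P)
  case 0
  have "P \<inter> poly_over {} \<subseteq> {0}"
  proof
    fix p assume p: "p \<in> P \<inter> poly_over {}"
    have "p = Const (lookup p 0)"
    proof (rule poly_mapping_eqI)
      fix t
      have "t = 0" if "lookup p t \<noteq> 0"
        using p that by (auto simp: poly_over_def mvars_def in_keys_iff intro: poly_mapping_eqI)
      then show "lookup p t = lookup (Const (lookup p 0)) t"
        by (auto simp: Const_def lookup_single when_def)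
    qed
    then obtain c where c: "p = Const c" by blast
    have "c = 0"
    proof (rule ccontr)
      assume "c \<noteq> 0"
      then have "Const (1 / c) * p = 1" unfolding c by (simp flip: is_homD(3)[OF is_hom_Const])
      moreover have "Const (1 / c) * p \<in> P"
        using p 0 poly_over_Const unfolding primeideal_mpoly_ring_iff ideal_mpoly_ring_iff by blast
      ultimately show False using 0 by (simp add: primeideal_mpoly_ring_iff)
    qed
    then show "p \<in> {0}" using c by simp
  qed
  then show ?case using 0 by (intro exI[of _ "{}"] exI[of _ "\<lambda>_. P"]) (auto simp: prime_chain_def)
next
  case (Suc N)
  let ?P = "P \<inter> poly_over {..<N}"
  obtain V Q where V: "V \<subseteq> {..<N}" "?P \<inter> poly_over V \<subseteq> {0}"
    and Q: "prime_chain (mpoly_ring N) (N - card V) Q" "Q (N - card V) = ?P"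
    using Suc.IH[OF primeideal_contract[OF Suc.prems]] by blast
  have card: "card V \<le> N" using V(1) card_mono[of "{..<N}" V] by simp
  let ?Q = "\<lambda>i. extended_ideal N (Q i)"
  note chain = prime_chain_extended[OF Q(1)]
  have sub: "extended_ideal N ?P \<subseteq> P"
    using Suc.prems by (intro extended_ideal_least) (auto simp: primeideal_mpoly_ring_iff)
  show ?case
  proof (cases "extended_ideal N ?P = P")
    case True
    have "p = 0" if p: "p \<in> P" "p \<in> poly_over (insert N V)" for p
    proof -
      have "coeff (split_var N p) e \<in> ?P \<inter> poly_over V" for e
      proof -
        have "coeff (split_var N p) e \<in> poly_over (insert N V - {N})"
          by (rule split_var_coeff[OF p(2)])
        then have "coeff (split_var N p) e \<in> poly_over V"
          by (rule poly_over_mono[rotated]) auto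
        moreover have "coeff (split_var N p) e \<in> ?P"
          using True p(1) unfolding extended_ideal_def by blast
        ultimately show ?thesis by blast
      qed
      then have "coeff (split_var N p) e = 0" for e using V(2) by blast
      then have "split_var N p = 0" by (intro poly_eqI) simp
      then show ?thesis by simp
    qed
    moreover have "card (insert N V) = Suc (card V)"
      using V(1) finite_subset by (subst card_insert_disjoint) auto
    ultimately show ?thesis using V(1) True Q(2) chain
      by (intro exI[of _ "insert N V"] exI[of _ ?Q]) auto
  next
    case False
    have "prime_chain (mpoly_ring (Suc N)) (Suc (N - card V)) (?Q(Suc (N - card V) := P))"
      by (rule prime_chain_snoc[OF chain _ Suc.prems]) (use Q(2) sub False in auto)
    moreover have "P \<inter> poly_over V \<subseteq> {0}"
      using V poly_over_mono[OF V(1)] by blast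
    ultimately show ?thesis using V(1) card
      by (intro exI[of _ V] exI[of _ "?Q(Suc (N - card V) := P)"])
        (auto simp: Suc_diff_le simp del: fun_upd_apply simp add: fun_upd_same)
  qed
qed

text \<open>
  Gaussian elimination: a vector with nonzero coordinate \<open>s\<close> clears this coordinate in the
  other vectors.
\<close>

lemma linear_dependence:
  fixes w :: "'a \<Rightarrow> 'b \<Rightarrow> 'k::field"
  assumes "finite S" "finite A" "card S < card A"
  shows "\<exists>c. (\<exists>t\<in>A. c t \<noteq> 0) \<and> (\<forall>s\<in>S. (\<Sum>t\<in>A. c t * w t s) = 0)"
  using assms
proof (induction S arbitrary: A w rule: finite_induct)
  case empty
  then have "A \<noteq> {}" by auto
  then show ?case by (intro exI[of _ "\<lambda>_. 1"]) auto
next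
  case (insert s S)
  show ?case
  proof (cases "\<forall>t\<in>A. w t s = 0")
    case True
    obtain c where "\<exists>t\<in>A. c t \<noteq> 0" "\<forall>s\<in>S. (\<Sum>t\<in>A. c t * w t s) = 0"
      using insert.IH[of A w] insert.prems insert.hyps by auto
    then show ?thesis using True by (intro exI[of _ c]) auto
  next
    case False
    then obtain t0 where t0: "t0 \<in> A" "w t0 s \<noteq> 0" by blast
    let ?A = "A - {t0}"
    let ?w = "\<lambda>t r. w t r - w t s / w t0 s * w t0 r"
    have "card S < card ?A" "finite ?A" using insert t0 by (auto simp: card_Diff_singleton)
    then obtain c where c: "\<exists>t\<in>?A. c t \<noteq> 0" "\<forall>r\<in>S. (\<Sum>t\<in>?A. c t * ?w t r) = 0"
      using insert.IH[of ?A ?w] by auto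
    define d where "d = (\<lambda>t. if t = t0 then - (\<Sum>t\<in>?A. c t * (w t s / w t0 s)) else c t)"
    have eq: "(\<Sum>t\<in>A. d t * w t r) = (\<Sum>t\<in>?A. c t * ?w t r)" for r
    proof -
      have "(\<Sum>t\<in>A. d t * w t r) = d t0 * w t0 r + (\<Sum>t\<in>?A. d t * w t r)"
        using t0 insert.prems by (simp add: sum.remove)
      also have "(\<Sum>t\<in>?A. d t * w t r) = (\<Sum>t\<in>?A. c t * w t r)"
        by (rule sum.cong) (auto simp: d_def)
      also have "d t0 * w t0 r = - (\<Sum>t\<in>?A. c t * (w t s / w t0 s * w t0 r))"
        by (simp add: d_def sum_distrib_right mult.assoc)
      finally show ?thesis by (simp add: right_diff_distrib sum_subtractf)
    qed
    have "(\<Sum>t\<in>A. d t * w t s) = 0" unfolding eq using t0 by simp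
    moreover have "\<forall>r\<in>S. (\<Sum>t\<in>A. d t * w t r) = 0" unfolding eq using c by simp
    moreover have "\<exists>t\<in>A. d t \<noteq> 0" using c(1) by (auto simp: d_def)
    ultimately show ?thesis by (intro exI[of _ d]) auto
  qed
qed

definition exponent_box :: "nat set \<Rightarrow> nat \<Rightarrow> (nat \<Rightarrow>\<^sub>0 nat) set"
  where "exponent_box V B = {t. keys t \<subseteq> V \<and> (\<forall>j. lookup t j \<le> B)}"

lemma card_exponent_box:
  assumes "finite V"
  shows "finite (exponent_box V B)" "card (exponent_box V B) = (B + 1) ^ card V"
proof -
  let ?f = "\<lambda>t. restrict (lookup t) V"
  let ?g = "\<lambda>u. Abs_poly_mapping (\<lambda>j. if j \<in> V then u j else (0::nat))"
  have g: "lookup (?g u) = (\<lambda>j. if j \<in> V then u j else 0)" for u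
    by (rule lookup_Abs_poly_mapping) (use assms in auto)
  have "bij_betw ?f (exponent_box V B) (V \<rightarrow>\<^sub>E {..B})"
  proof (rule bij_betw_byWitness[where f'="?g"])
    show "\<forall>t\<in>exponent_box V B. ?g (?f t) = t"
    proof
      fix t assume "t \<in> exponent_box V B"
      then show "?g (?f t) = t"
        by (intro poly_mapping_eqI) (auto simp: g exponent_box_def in_keys_iff)
    qed
    show "\<forall>u\<in>V \<rightarrow>\<^sub>E {..B}. ?f (?g u) = u"
      unfolding g by (auto simp: restrict_def fun_eq_iff PiE_def extensional_def)
    show "?f ` exponent_box V B \<subseteq> V \<rightarrow>\<^sub>E {..B}" by (auto simp: exponent_box_def)
    show "?g ` (V \<rightarrow>\<^sub>E {..B}) \<subseteq> exponent_box V B"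
      by (auto simp: exponent_box_def g in_keys_iff split: if_splits)
  qed
  moreover have "finite (V \<rightarrow>\<^sub>E {..B})" "card (V \<rightarrow>\<^sub>E {..B}) = (B + 1) ^ card V"
    using assms by (auto simp: card_PiE intro: finite_PiE)
  ultimately show "finite (exponent_box V B)" "card (exponent_box V B) = (B + 1) ^ card V"
    by (auto simp: bij_betw_finite bij_betw_same_card)
qed

definition exponents_bounded :: "nat set \<Rightarrow> nat \<Rightarrow> 'k::field mpoly \<Rightarrow> bool"
  where "exponents_bounded V B p \<longleftrightarrow> keys p \<subseteq> exponent_box V B"

lemma exponents_bounded_mult:
  assumes "exponents_bounded V A p" "exponents_bounded V B q"
  shows "exponents_bounded V (A + B) (p * q)"
proof -
  have "t \<in> exponent_box V (A + B)" if t: "t \<in> keys (p * q)" for t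
  proof -
    obtain a b where ab: "t = a + b" "a \<in> keys p" "b \<in> keys q"
      using keys_mult[of p q] t by blast
    then have "a \<in> exponent_box V A" "b \<in> exponent_box V B"
      using assms by (auto simp: exponents_bounded_def)
    then show ?thesis using Poly_Mapping.keys_add[of a b]
      by (auto simp: ab(1) exponent_box_def lookup_add intro!: add_mono)
  qed
  then show ?thesis by (auto simp: exponents_bounded_def)
qed

lemma exponents_bounded_le: "exponents_bounded V A p \<Longrightarrow> A \<le> B \<Longrightarrow> exponents_bounded V B p"
  unfolding exponents_bounded_def exponent_box_def using le_trans by blast

lemma exponents_bounded_power:
  "exponents_bounded V A p \<Longrightarrow> exponents_bounded V (n * A) (p ^ n)"
proof (induction n)
  case 0
  then show ?case by (auto simp: exponents_bounded_def exponent_box_def)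
next
  case (Suc n)
  then show ?case using exponents_bounded_mult[of V A p "n * A" "p ^ n"] by simp
qed

lemma exponents_bounded_prod:
  assumes "finite T" "\<And>i. i \<in> T \<Longrightarrow> exponents_bounded V A (u i)"
  shows "exponents_bounded V (card T * A) (\<Prod>i\<in>T. u i)"
  using assms
proof (induction T rule: finite_induct)
  case empty
  then show ?case by (auto simp: exponents_bounded_def exponent_box_def)
next
  case (insert i T)
  then show ?case using exponents_bounded_mult[of V A "u i" "card T * A" "prod u T"] by simp
qed

lemma exponents_bounded_exists:
  assumes "p \<in> poly_over V"
  shows "\<exists>B. exponents_bounded V B p"
proof -
  have "finite (\<Union>t\<in>keys p. Poly_Mapping.range t)" by auto
  then obtain B where B: "\<forall>x\<in>(\<Union>t\<in>keys p. Poly_Mapping.range t). x \<le> B"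
    using finite_nat_set_iff_bounded_le by blast
  have "lookup t j \<le> B" if "t \<in> keys p" for t j
    using B that by (cases "j \<in> keys t") (auto simp: in_keys_iff)
  then show ?thesis
    using assms by (intro exI[of _ B]) (auto simp: exponents_bounded_def exponent_box_def poly_over_def mvars_def)
qed

text \<open>
  Counting monomials. Of the elements \<open>v\<^sub>i\<close> there are \<open>(D + 1)\<^bsup>|T|\<^esup>\<close> monomials with exponents
  at most \<open>D\<close>, and they lie in a space whose dimension is polynomial in \<open>D\<close> of degree
  \<open>N < |T|\<close>.
\<close>

lemma algebraic_dependence:
  fixes v :: "nat \<Rightarrow> 'k::field mpoly"
  assumes T: "finite T" "N < card T" and v: "\<And>i. i \<in> T \<Longrightarrow> v i \<in> poly_over {..<N}"
  shows "\<exists>F. F \<noteq> 0 \<and> F \<in> poly_over T \<and> eval_mpoly v F = 0"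
proof -
  have "\<forall>i\<in>T. \<exists>B. exponents_bounded {..<N} B (v i)" using v exponents_bounded_exists by blast
  then obtain b where b: "\<And>i. i \<in> T \<Longrightarrow> exponents_bounded {..<N} (b i) (v i)" by metis
  define e where "e = sum b T"
  have e: "exponents_bounded {..<N} e (v i)" if "i \<in> T" for i
    using b[OF that] by (rule exponents_bounded_le) (use that T in \<open>auto simp: e_def intro!: member_le_sum\<close>)
  define C where "C = card T * e + 1"
  \<comment> \<open>With \<open>B + 1 \<le> C (D + 1)\<close> for the exponents of the products, this \<open>D\<close> makes \<open>(B + 1)\<^sup>N < (D + 1)\<^sup>N\<^sup>+\<^sup>1\<close>.\<close>
  define D where "D = C ^ N"
  define B where "B = card T * (D * e)"
  let ?A = "exponent_box T D" and ?S = "exponent_box {..<N} B"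
  have mono_in: "keys (eval_monom v t) \<subseteq> ?S" if t: "t \<in> ?A" for t
  proof -
    have "eval_monom v t = (\<Prod>i\<in>T. v i ^ lookup t i)"
      by (rule eval_monom_superset) (use t T in \<open>auto simp: exponent_box_def\<close>)
    moreover have "exponents_bounded {..<N} B (\<Prod>i\<in>T. v i ^ lookup t i)"
      unfolding B_def
    proof (rule exponents_bounded_prod[OF T(1)])
      fix i assume "i \<in> T"
      show "exponents_bounded {..<N} (D * e) (v i ^ lookup t i)"
        by (rule exponents_bounded_le[OF exponents_bounded_power[OF e[OF \<open>i \<in> T\<close>]]])
           (use t in \<open>auto simp: exponent_box_def\<close>)
    qed
    ultimately show ?thesis by (simp add: exponents_bounded_def)
  qed
  have "B + 1 \<le> C * (D + 1)" by (simp add: B_def C_def algebra_simps)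
  then have "(B + 1) ^ N \<le> (C * (D + 1)) ^ N" by (rule power_mono) simp
  also have "\<dots> = D * (D + 1) ^ N" by (simp only: power_mult_distrib D_def)
  also have "\<dots> < (D + 1) ^ Suc N" by simp
  also have "\<dots> \<le> (D + 1) ^ card T" using T(2) by (intro power_increasing) auto
  finally have "card ?S < card ?A"
    using card_exponent_box(2)[of "{..<N}" B] card_exponent_box(2)[OF T(1), of D] by simp
  then obtain c where c: "\<exists>t\<in>?A. c t \<noteq> 0"
    "\<forall>s\<in>?S. (\<Sum>t\<in>?A. c t * lookup (eval_monom v t) s) = 0"
    using linear_dependence[of ?S ?A "\<lambda>t s. lookup (eval_monom v t) s"]
      card_exponent_box(1)[of "{..<N}" B] card_exponent_box(1)[OF T(1), of D] by auto
  define F :: "'k mpoly" where "F = (\<Sum>t\<in>?A. single t (c t))"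
  have lookup_F: "lookup F t = (if t \<in> ?A then c t else 0)" for t
  proof -
    have "lookup F t = (\<Sum>s\<in>?A. if s = t then c s else 0)"
      unfolding F_def lookup_sum by (rule sum.cong) (auto simp: lookup_single when_def)
    then show ?thesis using card_exponent_box(1)[OF T(1), of D] by (simp add: sum.delta)
  qed
  have "F \<noteq> 0" using c(1) lookup_F by (metis lookup_zero)
  moreover have "F \<in> poly_over T"
    by (auto simp: poly_over_def mvars_def in_keys_iff[of _ F] lookup_F exponent_box_def split: if_splits)
  moreover have "eval_mpoly v F = 0"
  proof (rule poly_mapping_eqI)
    fix s
    have "eval_mpoly v F = (\<Sum>t\<in>?A. Const (c t) * eval_monom v t)"
      unfolding eval_mpoly_conv F_def is_homD(8)[OF is_hom_subst[OF is_hom_Const]]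
        mpoly_subst_single[OF is_hom_Const] ..
    then have "lookup (eval_mpoly v F) s = (\<Sum>t\<in>?A. c t * lookup (eval_monom v t) s)"
      by (simp add: lookup_sum Const_def flip: mult_map_scale_conv_mult)
         (auto simp: Poly_Mapping.map.rep_eq when_def intro: sum.cong)
    also have "\<dots> = 0"
    proof (cases "s \<in> ?S")
      case False
      then have "lookup (eval_monom v t) s = 0" if "t \<in> ?A" for t
        using mono_in[OF that] by (auto simp: in_keys_iff)
      then show ?thesis by simp
    qed (use c(2) in blast)
    finally show "lookup (eval_mpoly v F) s = lookup 0 s" by simp
  qed
  ultimately show ?thesis by blast
qed

lemma extract_variable_power:
  fixes F :: "'k::field mpoly"
  assumes "F \<noteq> 0" "F \<in> poly_over V"
  shows "\<exists>e F0 F1. F = Var j ^ e * (F0 + Var j * F1) \<and> F0 \<noteq> 0 \<and> F0 \<in> poly_over (V - {j})"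
proof -
  obtain Q where Q: "split_var j F = [:0, 1:] ^ order 0 (split_var j F) * Q" "\<not> [:0, 1:] dvd Q"
    using order_decomp[of "split_var j F" 0] assms(1) by auto
  define e where "e = order 0 (split_var j F)"
  obtain c Q' where cQ: "Q = pCons c Q'" by (rule pCons_cases)
  have "c \<noteq> 0"
  proof
    assume "c = 0"
    then have "Q = [:0, 1:] * Q'" by (simp add: cQ)
    then show False using Q(2) by (metis dvd_triv_left)
  qed
  have "split_var j F = monom 1 e * Q"
    using Q(1) by (simp add: e_def Polynomial.monom_altdef)
  then have "c = coeff (split_var j F) e" using coeff_monom_mult[of 1 e Q e] by (simp only:) (simp add: cQ)
  then have "c \<in> poly_over (V - {j})" using split_var_coeff[OF assms(2)] by simp
  moreover have "F = Var j ^ e * (c + Var j * poly Q' (Var j))"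
    using arg_cong[OF Q(1), of "\<lambda>p. poly p (Var j)"] by (simp add: e_def cQ algebra_simps)
  ultimately show ?thesis using \<open>c \<noteq> 0\<close> by blast
qed

text \<open>
  Choose \<open>b\<^sub>i\<close> in \<open>Q\<^sub>i\<^sub>+\<^sub>1\<close> outside \<open>Q\<^sub>i\<close>. If the chain is too long, there is a nonzero polynomial
  relation between the variables in \<open>V\<close> and \<open>b\<^sub>0,\<dots>,b\<^sub>l\<^sub>-\<^sub>1\<close>. A relation \<open>F(b\<^sub>i, \<dots>)\<close> modulo \<open>Q\<^sub>i\<close> that
  involves only \<open>b\<^sub>i, b\<^sub>i\<^sub>+\<^sub>1, \<dots>\<close> can be divided by a power of \<open>b\<^sub>i\<close>, which is not in the prime
  \<open>Q\<^sub>i\<close>, until its part free of \<open>b\<^sub>i\<close> is nonzero; that part is a relation modulo \<open>Q\<^sub>i\<^sub>+\<^sub>1\<close>, because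
  \<open>b\<^sub>i\<close> lies there. At the end a nonzero polynomial in \<open>V\<close> lies in \<open>Q\<^sub>l\<close>.
\<close>

lemma prime_chain_length_le:
  fixes Q :: "nat \<Rightarrow> 'k::field mpoly set"
  assumes chain: "prime_chain (mpoly_ring N) l Q" and V: "V \<subseteq> {..<N}" "Q l \<inter> poly_over V \<subseteq> {0}"
  shows "l \<le> N - card V"
proof (rule ccontr)
  assume "\<not> l \<le> N - card V"
  have finV: "finite V" using V(1) finite_subset by blast
  have prime: "primeideal (Q i) (mpoly_ring N)" if "i \<le> l" for i
    using chain that by (auto simp: prime_chain_def)
  have ideal: "ideal (Q i) (mpoly_ring N)" if "i \<le> l" for i
    using prime[OF that] by (simp add: primeideal_mpoly_ring_iff)
  have "\<forall>i. \<exists>b. i < l \<longrightarrow> b \<in> Q (Suc i) - Q i" using chain by (auto simp: prime_chain_def)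
  then obtain b where b: "\<And>i. i < l \<Longrightarrow> b i \<in> Q (Suc i) - Q i" by metis
  have b_in: "b i \<in> poly_over {..<N}" if "i < l" for i
    using b[OF that] ideal[of "Suc i"] that unfolding ideal_mpoly_ring_iff by auto
  \<comment> \<open>The independent variables keep their indices; \<open>b\<^sub>i\<close> takes the place of the variable with index \<open>N + i\<close>.\<close>
  define v :: "nat \<Rightarrow> 'k mpoly"
    where "v j = (if j \<in> V then Var j else if N \<le> j \<and> j < N + l then b (j - N) else 0)" for j
  have v_in: "v j \<in> poly_over {..<N}" for j
    using V(1) b_in by (auto simp: v_def poly_over_0 intro!: poly_over_Var)
  note hom = is_homD[OF is_hom_subst[OF is_hom_Const, of v], folded eval_mpoly_conv]
  have eval_in: "eval_mpoly v F \<in> poly_over {..<N}" for F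
    unfolding eval_mpoly_conv
    by (rule mpoly_subst_closed[where V=UNIV]) (auto simp: poly_over_def[of UNIV] v_in poly_over_0 poly_over_1 poly_over_Const poly_over_add poly_over_mult)
  let ?T = "\<lambda>i. V \<union> {N + i..<N + l}"
  have "card (?T 0) = card V + l"
    using V(1) finV by (subst card_Un_disjoint) auto
  then have "N < card (?T 0)" using \<open>\<not> l \<le> N - card V\<close> by linarith
  then obtain F where F: "F \<noteq> 0" "F \<in> poly_over (?T 0)" "eval_mpoly v F = 0"
    using algebraic_dependence[of "?T 0" N v] v_in finV by blast
  have "\<exists>F. F \<noteq> 0 \<and> F \<in> poly_over (?T i) \<and> eval_mpoly v F \<in> Q i" if "i \<le> l" for i
    using that
  proof (induction i)
    case 0
    then show ?case using F ideal[of 0] unfolding ideal_mpoly_ring_iff by metis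
  next
    case (Suc i)
    then obtain F where F: "F \<noteq> 0" "F \<in> poly_over (?T i)" "eval_mpoly v F \<in> Q i" by auto
    obtain e F0 F1 where e: "F = Var (N + i) ^ e * (F0 + Var (N + i) * F1)" "F0 \<noteq> 0"
      "F0 \<in> poly_over (?T i - {N + i})"
      using extract_variable_power[OF F(1,2)] by blast
    have "N + i \<notin> V" using V(1) by auto
    then have ev: "eval_mpoly v (Var (N + i)) = b i"
      unfolding eval_mpoly_conv mpoly_subst_Var[OF is_hom_Const] using Suc.prems by (simp add: v_def)
    have pow: "x \<in> Q i" if "b i ^ n * x \<in> Q i" "x \<in> poly_over {..<N}" for n x
      using that
    proof (induction n)
      case (Suc n)
      have "b i * (b i ^ n * x) \<in> Q i" using Suc.prems by (simp add: mult.assoc)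
      moreover have "b i ^ n * x \<in> poly_over {..<N}"
        using Suc.prems b_in \<open>Suc i \<le> l\<close> by (auto intro!: poly_over_mult poly_over_power)
      ultimately have "b i ^ n * x \<in> Q i"
        using prime[of i] b[of i] b_in[of i] \<open>Suc i \<le> l\<close> unfolding primeideal_mpoly_ring_iff by auto
      then show ?case using Suc by blast
    qed simp
    have "b i ^ e * (eval_mpoly v F0 + b i * eval_mpoly v F1) \<in> Q i"
      using F(3) by (simp add: e(1) hom ev)
    then have "eval_mpoly v F0 + b i * eval_mpoly v F1 \<in> Q i"
      by (rule pow) (use eval_in b_in Suc.prems in \<open>auto intro!: poly_over_intros\<close>)
    then have "eval_mpoly v F0 + b i * eval_mpoly v F1 \<in> Q (Suc i)"
      using chain Suc.prems unfolding prime_chain_def by (meson Suc_le_eq psubsetD)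
    moreover have "- eval_mpoly v F1 * b i \<in> Q (Suc i)"
      using b[of i] ideal[OF Suc.prems] Suc.prems poly_over_uminus[OF eval_in[of F1]] unfolding ideal_mpoly_ring_iff by auto
    ultimately have "(eval_mpoly v F0 + b i * eval_mpoly v F1) + (- eval_mpoly v F1 * b i) \<in> Q (Suc i)"
      using ideal[OF Suc.prems] unfolding ideal_mpoly_ring_iff by blast
    then have "eval_mpoly v F0 \<in> Q (Suc i)" by (simp add: mult.commute)
    moreover have "F0 \<in> poly_over (?T (Suc i))"
      using e(3) by (rule poly_over_mono[rotated]) auto
    ultimately show ?case using e(2) by blast
  qed
  from this[of l] obtain F where F: "F \<noteq> 0" "F \<in> poly_over V" "eval_mpoly v F \<in> Q l" by auto
  have "eval_mpoly v F = F"
    unfolding eval_mpoly_conv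
    by (rule hom_unique[OF is_hom_subst[OF is_hom_Const] is_hom_id _ _ F(2)])
       (auto simp: mpoly_subst_Const[OF is_hom_Const] mpoly_subst_Var[OF is_hom_Const] v_def)
  then show False using F V(2) by auto
qed

text \<open>
  If \<open>V\<close> is independent modulo \<open>P\<close>, then \<open>V\<close> with the new variable is independent modulo the
  extension, so the bound on the length of chains does not change.
\<close>

theorem prime_height_extended_ideal_le:
  fixes P :: "'k::field mpoly set"
  assumes "primeideal P (mpoly_ring N)"
  shows "prime_height (mpoly_ring (Suc N)) (extended_ideal N P) \<le> prime_height (mpoly_ring N) P"
proof -
  obtain V Q where V: "V \<subseteq> {..<N}" "P \<inter> poly_over V \<subseteq> {0}"
    and Q: "prime_chain (mpoly_ring N) (N - card V) Q" "Q (N - card V) = P"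
    using long_prime_chain_exists[OF assms] by blast
  have "extended_ideal N P \<inter> poly_over (insert N V) \<subseteq> {0}"
  proof
    fix p assume p: "p \<in> extended_ideal N P \<inter> poly_over (insert N V)"
    have "coeff (split_var N p) e = 0" for e
    proof -
      have "coeff (split_var N p) e \<in> poly_over (insert N V - {N})"
        by (rule split_var_coeff) (use p in auto)
      then have "coeff (split_var N p) e \<in> poly_over V"
        by (rule poly_over_mono[rotated]) auto
      then show ?thesis using p V(2) by (auto simp: extended_ideal_def)
    qed
    then have "split_var N p = 0" by (intro poly_eqI) simp
    then show "p \<in> {0}" by simp
  qed
  moreover have "card (insert N V) = Suc (card V)"
    using V(1) finite_subset by (subst card_insert_disjoint) auto
  moreover have "insert N V \<subseteq> {..<Suc N}" using V(1) by auto
  ultimately have "l \<le> N - card V"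
    if "prime_chain (mpoly_ring (Suc N)) l Q" "Q l = extended_ideal N P" for l Q
    using prime_chain_length_le[OF that(1), of "insert N V"] that(2) by simp
  then have "prime_height (mpoly_ring (Suc N)) (extended_ideal N P) \<le> enat (N - card V)"
    by (intro prime_height_le) simp
  also have "\<dots> \<le> prime_height (mpoly_ring N) P" using prime_height_ge[OF Q(1)] Q(2) by simp
  finally show ?thesis .
qed

section \<open>Grade and height\<close>

text \<open>
  An ideal that is maximal among those containing \<open>I\<close> and disjoint from \<open>T\<close> is prime.
\<close>

lemma (in cring) prime_avoiding_multiplicative_set:
  assumes I: "ideal I R" and T: "\<one> \<in> T" "T \<subseteq> carrier R" "\<And>s t. s \<in> T \<Longrightarrow> t \<in> T \<Longrightarrow> s \<otimes> t \<in> T"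
    and disj: "I \<inter> T = {}"
  shows "\<exists>Q. primeideal Q R \<and> I \<subseteq> Q \<and> Q \<inter> T = {}"
proof -
  define S where "S = {J. ideal J R \<and> I \<subseteq> J \<and> J \<inter> T = {}}"
  have "\<exists>M\<in>S. \<forall>J\<in>S. M \<subseteq> J \<longrightarrow> J = M"
  proof (rule subset_Zorn_nonempty)
    show "S \<noteq> {}" using I disj by (auto simp: S_def)
    show "\<Union> C \<in> S" if nonempty: "C \<noteq> {}" and C: "subset.chain S C" for C
    proof -
      have Cideal: "ideal J R" if "J \<in> C" for J
        using that C by (auto simp: subset.chain_def S_def)
      have "ideal (\<Union> C) R"
      proof (rule idealI[OF ring_axioms])
        show "subgroup (\<Union> C) (add_monoid R)"
        proof (rule add.subgroupI)
          show "\<Union> C \<subseteq> carrier R"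
            by (intro Union_least subsetI) (rule ideal.Icarr[OF Cideal])
          show "\<Union> C \<noteq> {}"
          proof -
            obtain J where "J \<in> C" using nonempty by blast
            then have "\<zero> \<in> J"
              using Cideal additive_subgroup.zero_closed[of J R] ideal.axioms(1)[of J R] by blast
            then show ?thesis using \<open>J \<in> C\<close> by blast
          qed
          show "\<ominus> a \<in> \<Union> C" if a: "a \<in> \<Union> C" for a
          proof -
            obtain J where J: "J \<in> C" "a \<in> J" using a by blast
            have "\<ominus> a \<in> J"
              by (rule additive_subgroup.a_inv_closed[OF ideal.axioms(1)[OF Cideal[OF J(1)]] J(2)])
            then show ?thesis using J(1) by blast
          qed
          show "a \<oplus> b \<in> \<Union> C" if ab: "a \<in> \<Union> C" "b \<in> \<Union> C" for a b
          proof -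
            obtain J K where "J \<in> C" "a \<in> J" "K \<in> C" "b \<in> K" using ab by blast
            then obtain L where L: "L \<in> C" "a \<in> L" "b \<in> L"
              using C unfolding subset.chain_def by blast
            have "a \<oplus> b \<in> L"
              by (rule additive_subgroup.a_closed[OF ideal.axioms(1)[OF Cideal[OF L(1)]] L(2,3)])
            then show ?thesis using L(1) by blast
          qed
        qed
        show "x \<otimes> a \<in> \<Union> C" "a \<otimes> x \<in> \<Union> C" if ax: "a \<in> \<Union> C" "x \<in> carrier R" for a x
        proof -
          obtain J where J: "J \<in> C" "a \<in> J" using ax by blast
          show "x \<otimes> a \<in> \<Union> C" "a \<otimes> x \<in> \<Union> C"
            using ideal.I_l_closed[OF Cideal[OF J(1)] J(2) ax(2)]
              ideal.I_r_closed[OF Cideal[OF J(1)] J(2) ax(2)] J(1) by auto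
        qed
      qed
      then show ?thesis using C nonempty unfolding subset.chain_def S_def by blast
    qed
  qed
  then obtain Q where Q: "Q \<in> S" and max: "\<And>J. J \<in> S \<Longrightarrow> Q \<subseteq> J \<Longrightarrow> J = Q" by blast
  interpret Q: ideal Q R using Q by (simp add: S_def)
  have meets: "\<exists>q\<in>Q. \<exists>r\<in>carrier R. q \<oplus> r \<otimes> a \<in> T" if a: "a \<in> carrier R" "a \<notin> Q" for a
  proof -
    let ?J = "Q <+>\<^bsub>R\<^esub> PIdl a"
    have "ideal ?J R" by (rule add_ideals[OF Q.is_ideal cgenideal_ideal[OF a(1)]])
    moreover have "Q \<subseteq> ?J"
    proof
      fix q assume "q \<in> Q"
      moreover have "\<zero> \<in> PIdl a"
        using additive_subgroup.zero_closed[OF ideal.axioms(1)[OF cgenideal_ideal[OF a(1)]]] .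
      ultimately have "q \<oplus> \<zero> \<in> ?J" unfolding set_add_def' by blast
      then show "q \<in> ?J" using Q.Icarr[OF \<open>q \<in> Q\<close>] by simp
    qed
    moreover have "a \<in> ?J"
    proof -
      have "\<zero> \<oplus> a \<in> ?J" unfolding set_add_def'
        using Q.zero_closed cgenideal_self[OF a(1)] by blast
      then show ?thesis using a(1) by simp
    qed
    ultimately have "?J \<inter> T \<noteq> {}" using max[of ?J] a(2) Q by (auto simp: S_def)
    then show ?thesis by (auto simp: set_add_def' cgenideal_def)
  qed
  have "primeideal Q R"
  proof (rule primeidealI)
    show "ideal Q R" by (rule Q.is_ideal)
    show "cring R" by (rule cring_axioms)
    show "carrier R \<noteq> Q" using T(1,2) Q by (auto simp: S_def)
    fix a b assume ab: "a \<in> carrier R" "b \<in> carrier R" "a \<otimes> b \<in> Q"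
    show "a \<in> Q \<or> b \<in> Q"
    proof (rule ccontr)
      assume "\<not> (a \<in> Q \<or> b \<in> Q)"
      then have nab: "a \<notin> Q" "b \<notin> Q" by auto
      obtain q r where qr: "q \<in> Q" "r \<in> carrier R" "q \<oplus> r \<otimes> a \<in> T"
        using meets[OF ab(1) nab(1)] by (elim bexE)
      obtain q' r' where qr': "q' \<in> Q" "r' \<in> carrier R" "q' \<oplus> r' \<otimes> b \<in> T"
        using meets[OF ab(2) nab(2)] by (elim bexE)
      note * = qr qr'
      have carr: "q \<in> carrier R" "q' \<in> carrier R" using * Q.Icarr by auto
      have "(q \<oplus> r \<otimes> a) \<otimes> (q' \<oplus> r' \<otimes> b)
          = (q' \<oplus> r' \<otimes> b) \<otimes> q \<oplus> (r \<otimes> a) \<otimes> q' \<oplus> (r \<otimes> r') \<otimes> (a \<otimes> b)"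
        using carr * ab by algebra
      also have "\<dots> \<in> Q"
        using Q.a_closed[OF Q.a_closed[OF Q.I_l_closed[OF *(1), of "q' \<oplus> r' \<otimes> b"]
          Q.I_l_closed[OF *(4), of "r \<otimes> a"]] Q.I_l_closed[OF ab(3), of "r \<otimes> r'"]] * ab carr by auto
      finally show False using T(3)[OF *(3,6)] Q by (auto simp: S_def)
    qed
  qed
  then show ?thesis using Q by (auto simp: S_def)
qed

text \<open>
  Let \<open>a\<close> be the last element of the sequence and \<open>I\<close> the ideal of the others. Since \<open>a\<close> is
  regular modulo \<open>I\<close>, no product of a power of \<open>a\<close> with an element outside \<open>P\<close> lies in \<open>I\<close>. A
  prime over \<open>I\<close> avoiding all these products is contained in \<open>P\<close> and misses \<open>a\<close>, so it can
  precede \<open>P\<close> in the chain.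
\<close>

lemma (in cring) prime_chain_below_regular_sequence:
  assumes "primeideal P R" "set as \<subseteq> P" "set as \<subseteq> carrier R"
    "\<And>i r. i < length as \<Longrightarrow> r \<in> carrier R \<Longrightarrow> r \<otimes> as ! i \<in> Idl (set (take i as)) \<Longrightarrow> r \<in> Idl (set (take i as))"
  shows "\<exists>Q. prime_chain R (length as) Q \<and> Q (length as) = P"
  using assms
proof (induction as arbitrary: P rule: rev_induct)
  case Nil
  then show ?case by (intro exI[of _ "\<lambda>_. P"]) (auto simp: prime_chain_def)
next
  case (snoc a as)
  interpret P: primeideal P R by (rule snoc.prems)
  let ?I = "Idl (set as)"
  have a: "a \<in> carrier R" "a \<in> P" using snoc.prems by auto
  \<comment> \<open>Disjoint from the ideal; the elements outside \<open>P\<close> force the prime into \<open>P\<close>, the powers keep \<open>a\<close> out of it.\<close>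
  define T where "T = {a [^] (k::nat) \<otimes> s |k s. s \<in> carrier R - P}"
  have nz: "r \<in> ?I" if "r \<in> carrier R" "a [^] (k::nat) \<otimes> r \<in> ?I" for k r
    using that
  proof (induction k)
    case 0
    then show ?case by simp
  next
    case (Suc k)
    have "(a [^] k \<otimes> r) \<otimes> a = a [^] Suc k \<otimes> r" using a Suc.prems by (simp add: m_ac)
    then show ?case using Suc a snoc.prems(4)[of "length as" "a [^] k \<otimes> r"] by simp
  qed
  have I: "ideal ?I R" using snoc.prems by (intro genideal_ideal) auto
  have IP: "?I \<subseteq> P" using snoc.prems by (intro genideal_minimal P.is_ideal) auto
  have "\<exists>Q. primeideal Q R \<and> ?I \<subseteq> Q \<and> Q \<inter> T = {}"
  proof (rule prime_avoiding_multiplicative_set[OF I])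
    have one: "\<one> \<in> carrier R - P" using P.I_notcarr P.one_imp_carrier by auto
    have "a [^] (0::nat) \<otimes> \<one> \<in> T" unfolding T_def using one by blast
    then show "\<one> \<in> T" by simp
    show "T \<subseteq> carrier R" using a by (auto simp: T_def)
    show "x \<otimes> y \<in> T" if xy: "x \<in> T" "y \<in> T" for x y
    proof -
      obtain k s l t where *: "x = a [^] (k::nat) \<otimes> s" "s \<in> carrier R - P"
        "y = a [^] (l::nat) \<otimes> t" "t \<in> carrier R - P" using xy by (auto simp: T_def)
      have "x \<otimes> y = a [^] (k + l) \<otimes> (s \<otimes> t)" using * a by (simp add: nat_pow_mult[symmetric] m_ac)
      moreover have "s \<otimes> t \<in> carrier R - P" using * P.I_prime by blast
      ultimately show ?thesis unfolding T_def by blast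
    qed
    show "?I \<inter> T = {}" using nz IP by (auto simp: T_def)
  qed
  then obtain Q where Q: "primeideal Q R" "?I \<subseteq> Q" "Q \<inter> T = {}" by blast
  interpret Q: primeideal Q R by (rule Q)
  have "x \<in> P" if "x \<in> Q" for x
  proof (rule ccontr)
    assume "x \<notin> P"
    then have "a [^] (0::nat) \<otimes> x \<in> T" using Q.Icarr[OF that] unfolding T_def by blast
    then show False using that Q(3) Q.Icarr[OF that] by auto
  qed
  moreover have "a \<notin> Q"
  proof
    assume "a \<in> Q"
    have "a [^] (1::nat) \<otimes> \<one> \<in> T" unfolding T_def using P.I_notcarr P.one_imp_carrier by blast
    then show False using \<open>a \<in> Q\<close> Q(3) a by auto
  qed
  ultimately have "Q \<subset> P" using a by blast
  have "set as \<subseteq> ?I" using snoc.prems by (intro genideal_self) auto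
  moreover have "r \<in> Idl (set (take i as))"
    if "i < length as" "r \<in> carrier R" "r \<otimes> as ! i \<in> Idl (set (take i as))" for i r
    using snoc.prems(4)[of i r] that by (simp add: nth_append)
  ultimately obtain C where C: "prime_chain R (length as) C" "C (length as) = Q"
    using snoc.IH[OF Q(1)] Q(2) snoc.prems(3) by (metis le_supE set_append subset_trans)
  show ?case
    using prime_chain_snoc[OF C(1) _ snoc.prems(1)] C(2) \<open>Q \<subset> P\<close>
    by (intro exI[of _ "C(Suc (length as) := P)"]) (auto simp del: fun_upd_apply simp add: fun_upd_same)
qed

theorem (in cring) grade_le_height: "grade R J \<le> height R J"
proof -
  have "enat (length as) \<le> prime_height R P"
    if as: "regular_sequence R as" "set as \<subseteq> J" "primeideal P R" "J \<subseteq> P" for as P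
  proof -
    have "\<exists>Q. prime_chain R (length as) Q \<and> Q (length as) = P"
      by (rule prime_chain_below_regular_sequence[OF as(3)])
         (use as in \<open>auto simp: regular_sequence_def\<close>)
    then show ?thesis using prime_height_ge by metis
  qed
  then show ?thesis
    unfolding grade_def height_def by (intro Sup_least Inf_greatest) auto
qed

lemma Idl_mpoly_singleton:
  assumes "a \<in> poly_over {..<N}"
  shows "Idl\<^bsub>mpoly_ring N\<^esub> {a} = {r * a |r. r \<in> poly_over {..<N}}"
proof -
  interpret cring "mpoly_ring N" by (rule cring_mpoly_ring)
  show ?thesis
    using cgenideal_eq_genideal[of a] assms by (auto simp: carrier_mpoly_ring cgenideal_def)
qed

lemma regular_sequence_pair:
  fixes a b :: "'k::field mpoly"
  assumes "a \<in> J" "b \<in> J" "a \<noteq> 0" "\<And>v. a dvd b * v \<Longrightarrow> a dvd v"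
    and J: "ideal J (mpoly_ring N)" "1 \<notin> J"
  shows "regular_sequence (mpoly_ring N) [a, b]"
proof -
  interpret cring "mpoly_ring N" by (rule cring_mpoly_ring)
  have ab: "a \<in> poly_over {..<N}" "b \<in> poly_over {..<N}"
    using assms ideal_mpolyD[OF J(1)] by auto
  have "Idl\<^bsub>mpoly_ring N\<^esub> {a, b} \<subseteq> J" using assms by (intro genideal_minimal) auto
  then have "Idl\<^bsub>mpoly_ring N\<^esub> {a, b} \<noteq> carrier (mpoly_ring N)"
    using J(2) poly_over_1 by (auto simp: carrier_mpoly_ring)
  moreover have "Idl\<^bsub>mpoly_ring N\<^esub> {} = {0 :: 'k mpoly}"
  proof -
    have "ideal {0 :: 'k mpoly} (mpoly_ring N)" by (auto simp: ideal_mpoly_ring_iff poly_over_0)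
    then have "Idl\<^bsub>mpoly_ring N\<^esub> {} \<subseteq> {0 :: 'k mpoly}" by (intro genideal_minimal) auto
    moreover have "(0 :: 'k mpoly) \<in> Idl\<^bsub>mpoly_ring N\<^esub> {}"
      using genideal_ideal[of "{}"] ideal_mpolyD by auto
    ultimately show ?thesis by auto
  qed
  moreover have "r \<in> {r * a |r. r \<in> poly_over {..<N}}"
    if "r \<in> poly_over {..<N}" "r * b \<in> {r * a |r. r \<in> poly_over {..<N}}" for r
  proof -
    have "a dvd b * r" using that(2) by (auto simp: mult.commute)
    then have "a dvd r" by (rule assms(4))
    then obtain c where c: "r = a * c" by (elim dvdE)
    have "\<exists>c\<in>poly_over {..<N}. r = c * a"
    proof (cases "r = 0")
      case True
      then show ?thesis using poly_over_0 by (intro bexI[of _ 0]) auto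
    next
      case False
      then show ?thesis using poly_over_if_factor[of a c] c that(1) by (metis mult.commute)
    qed
    then show ?thesis by blast
  qed
  ultimately show ?thesis
    using ab assms(3)
    by (auto simp: regular_sequence_def carrier_mpoly_ring less_Suc_eq Idl_mpoly_singleton[OF ab(1)])
qed

section \<open>Projective modules and dual bases\<close>

definition finitely_supported :: "('a, 'b) ring_scheme \<Rightarrow> ('i \<Rightarrow> 'a) \<Rightarrow> bool"
  where "finitely_supported R u \<longleftrightarrow> (\<forall>b. u b \<in> carrier R) \<and> finite {b. u b \<noteq> \<zero>\<^bsub>R\<^esub>}"

definition lincomb ::
    "('a, 'b) ring_scheme \<Rightarrow> ('a, 'p, 'c) module_scheme \<Rightarrow> ('i \<Rightarrow> 'p) \<Rightarrow> ('i \<Rightarrow> 'a) \<Rightarrow> 'p"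
  where "lincomb R P w u = finsum P (\<lambda>b. u b \<odot>\<^bsub>P\<^esub> w b) {b. u b \<noteq> \<zero>\<^bsub>R\<^esub>}"

text \<open>
  Elements \<open>w b\<close> and linear forms \<open>\<lambda>x. c x b\<close> with \<open>x = \<Sum> c x b \<cdot> w b\<close>: the coordinates
  exhibit the module as a direct summand of a free one. Unlike the lifting property in
  the definition of projective modules, this mentions no test modules, so it applies to
  modules over any types.
\<close>

definition dual_basis ::
    "('a, 'b) ring_scheme \<Rightarrow> ('a, 'p, 'c) module_scheme \<Rightarrow> ('i \<Rightarrow> 'p) \<Rightarrow> ('p \<Rightarrow> 'i \<Rightarrow> 'a) \<Rightarrow> bool"
  where "dual_basis R P w c \<longleftrightarrow>
    range w \<subseteq> carrier P \<and>
    (\<forall>x\<in>carrier P. finitely_supported R (c x) \<and> x = lincomb R P w (c x)) \<and>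
    (\<forall>x\<in>carrier P. \<forall>y\<in>carrier P. c (x \<oplus>\<^bsub>P\<^esub> y) = (\<lambda>b. c x b \<oplus>\<^bsub>R\<^esub> c y b)) \<and>
    (\<forall>a\<in>carrier R. \<forall>x\<in>carrier P. c (a \<odot>\<^bsub>P\<^esub> x) = (\<lambda>b. a \<otimes>\<^bsub>R\<^esub> c x b))"

lemma module_homD:
  assumes "h \<in> module_hom R M N"
  shows "x \<in> carrier M \<Longrightarrow> h x \<in> carrier N"
    "x \<in> carrier M \<Longrightarrow> y \<in> carrier M \<Longrightarrow> h (x \<oplus>\<^bsub>M\<^esub> y) = h x \<oplus>\<^bsub>N\<^esub> h y"
    "a \<in> carrier R \<Longrightarrow> x \<in> carrier M \<Longrightarrow> h (a \<odot>\<^bsub>M\<^esub> x) = a \<odot>\<^bsub>N\<^esub> h x"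
  using assms by (auto simp: module_hom_def)

lemma module_hom_zero:
  assumes "module R M" "module R N" "h \<in> module_hom R M N"
  shows "h \<zero>\<^bsub>M\<^esub> = \<zero>\<^bsub>N\<^esub>"
proof -
  interpret M: abelian_group M using assms(1) by (simp add: module_def)
  interpret N: abelian_group N using assms(2) by (simp add: module_def)
  have "h \<zero>\<^bsub>M\<^esub> \<oplus>\<^bsub>N\<^esub> h \<zero>\<^bsub>M\<^esub> = h \<zero>\<^bsub>M\<^esub>"
    using module_homD(2)[OF assms(3), of "\<zero>\<^bsub>M\<^esub>" "\<zero>\<^bsub>M\<^esub>"] by simp
  then show ?thesis using module_homD(1)[OF assms(3) M.zero_closed] by (metis N.add.r_cancel_one)
qed

context
  fixes R :: "('a, 'b) ring_scheme" and P :: "('a, 'p, 'c) module_scheme" (structure)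
  assumes mod: "module R P"
begin

interpretation R: cring R using mod by (simp add: module_def)
interpretation P: abelian_group P using mod by (simp add: module_def)

lemma smult_carrier: "a \<in> carrier R \<Longrightarrow> x \<in> carrier P \<Longrightarrow> a \<odot> x \<in> carrier P"
  using module.smult_closed[OF mod] .

lemma smult_ring_zero: "x \<in> carrier P \<Longrightarrow> \<zero>\<^bsub>R\<^esub> \<odot> x = \<zero>"
  using module.smult_l_null[OF mod] .

lemma lincomb_superset:
  assumes w: "range w \<subseteq> carrier P" and u: "finitely_supported R u" and A: "finite A" "{b. u b \<noteq> \<zero>\<^bsub>R\<^esub>} \<subseteq> A"
  shows "lincomb R P w u = finsum P (\<lambda>b. u b \<odot> w b) A"
proof -
  have smem: "u b \<odot> w b \<in> carrier P" for b
    using w u by (auto simp: finitely_supported_def intro!: smult_carrier)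
  have "finsum P (\<lambda>b. u b \<odot> w b) (A - {b. u b \<noteq> \<zero>\<^bsub>R\<^esub>}) = finsum P (\<lambda>b. \<zero>) (A - {b. u b \<noteq> \<zero>\<^bsub>R\<^esub>})"
    by (rule P.finsum_cong') (use w smult_ring_zero in auto)
  then have zero: "finsum P (\<lambda>b. u b \<odot> w b) (A - {b. u b \<noteq> \<zero>\<^bsub>R\<^esub>}) = \<zero>" by simp
  have "finsum P (\<lambda>b. u b \<odot> w b) ({b. u b \<noteq> \<zero>\<^bsub>R\<^esub>} \<union> (A - {b. u b \<noteq> \<zero>\<^bsub>R\<^esub>}))
      = finsum P (\<lambda>b. u b \<odot> w b) {b. u b \<noteq> \<zero>\<^bsub>R\<^esub>} \<oplus> finsum P (\<lambda>b. u b \<odot> w b) (A - {b. u b \<noteq> \<zero>\<^bsub>R\<^esub>})"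
    by (rule P.finsum_Un_disjoint) (use A u smem in \<open>auto simp: finitely_supported_def\<close>)
  moreover have "{b. u b \<noteq> \<zero>\<^bsub>R\<^esub>} \<union> (A - {b. u b \<noteq> \<zero>\<^bsub>R\<^esub>}) = A" using A by blast
  ultimately show ?thesis using zero smem by (simp add: lincomb_def)
qed

lemma lincomb_closed:
  assumes "range w \<subseteq> carrier P" "finitely_supported R u"
  shows "lincomb R P w u \<in> carrier P"
  unfolding lincomb_def
  using assms by (intro P.finsum_closed) (auto simp: finitely_supported_def intro!: smult_carrier)

lemma finitely_supported_add:
  assumes "finitely_supported R u" "finitely_supported R v"
  shows "finitely_supported R (\<lambda>b. u b \<oplus>\<^bsub>R\<^esub> v b)"
proof -
  have "{b. u b \<oplus>\<^bsub>R\<^esub> v b \<noteq> \<zero>\<^bsub>R\<^esub>} \<subseteq> {b. u b \<noteq> \<zero>\<^bsub>R\<^esub>} \<union> {b. v b \<noteq> \<zero>\<^bsub>R\<^esub>}" by auto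
  then show ?thesis using assms finite_subset by (auto simp: finitely_supported_def)
qed

lemma finitely_supported_smult:
  assumes "a \<in> carrier R" "finitely_supported R u"
  shows "finitely_supported R (\<lambda>b. a \<otimes>\<^bsub>R\<^esub> u b)"
proof -
  have "{b. a \<otimes>\<^bsub>R\<^esub> u b \<noteq> \<zero>\<^bsub>R\<^esub>} \<subseteq> {b. u b \<noteq> \<zero>\<^bsub>R\<^esub>}" using assms by auto
  then show ?thesis using assms finite_subset by (auto simp: finitely_supported_def)
qed

lemma lincomb_add:
  assumes w: "range w \<subseteq> carrier P" and u: "finitely_supported R u" and v: "finitely_supported R v"
  shows "lincomb R P w (\<lambda>b. u b \<oplus>\<^bsub>R\<^esub> v b) = lincomb R P w u \<oplus> lincomb R P w v"
proof -
  let ?A = "{b. u b \<noteq> \<zero>\<^bsub>R\<^esub>} \<union> {b. v b \<noteq> \<zero>\<^bsub>R\<^esub>}"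
  have fin: "finite ?A" using u v by (auto simp: finitely_supported_def)
  have wb: "w b \<in> carrier P" for b using w by auto
  have "lincomb R P w (\<lambda>b. u b \<oplus>\<^bsub>R\<^esub> v b) = finsum P (\<lambda>b. (u b \<oplus>\<^bsub>R\<^esub> v b) \<odot> w b) ?A"
    by (rule lincomb_superset[OF w finitely_supported_add[OF u v] fin]) auto
  also have "\<dots> = finsum P (\<lambda>b. u b \<odot> w b \<oplus> v b \<odot> w b) ?A"
    using u v wb by (intro P.finsum_cong')
      (auto simp: finitely_supported_def module.smult_l_distr[OF mod] intro!: smult_carrier)
  also have "\<dots> = finsum P (\<lambda>b. u b \<odot> w b) ?A \<oplus> finsum P (\<lambda>b. v b \<odot> w b) ?A"
    using u v wb by (intro P.finsum_addf) (auto simp: finitely_supported_def intro!: smult_carrier)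
  also have "\<dots> = lincomb R P w u \<oplus> lincomb R P w v"
    using lincomb_superset[OF w u fin] lincomb_superset[OF w v fin] by simp
  finally show ?thesis .
qed

lemma lincomb_smult:
  assumes w: "range w \<subseteq> carrier P" and u: "finitely_supported R u" and a: "a \<in> carrier R"
  shows "lincomb R P w (\<lambda>b. a \<otimes>\<^bsub>R\<^esub> u b) = a \<odot> lincomb R P w u"
proof -
  let ?A = "{b. u b \<noteq> \<zero>\<^bsub>R\<^esub>}"
  have fin: "finite ?A" using u by (auto simp: finitely_supported_def)
  have wb: "w b \<in> carrier P" and ub: "u b \<in> carrier R" for b
    using w u by (auto simp: finitely_supported_def)
  have "lincomb R P w (\<lambda>b. a \<otimes>\<^bsub>R\<^esub> u b) = finsum P (\<lambda>b. (a \<otimes>\<^bsub>R\<^esub> u b) \<odot> w b) ?A"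
    by (rule lincomb_superset[OF w finitely_supported_smult[OF a u] fin]) (use a in auto)
  also have "\<dots> = finsum P (\<lambda>b. a \<odot> (u b \<odot> w b)) ?A"
    using a ub wb by (intro P.finsum_cong') (auto simp: module.smult_assoc1[OF mod] intro!: smult_carrier)
  also have "\<dots> = a \<odot> finsum P (\<lambda>b. u b \<odot> w b) ?A"
    using a ub wb by (intro module.finsum_smult_ldistr[OF mod, symmetric] fin) (auto intro!: smult_carrier)
  finally show ?thesis by (simp add: lincomb_def)
qed

lemma lincomb_in_linear_relation:
  fixes L :: "('a, 'x, 'd) module_scheme"
  assumes mX: "module R L" and w: "range w \<subseteq> carrier P" and v: "range v \<subseteq> carrier L"
    and rel: "\<rho> \<zero> \<zero>\<^bsub>L\<^esub>"
      "\<And>x y x' y'. x \<in> carrier P \<Longrightarrow> x' \<in> carrier P \<Longrightarrow> y \<in> carrier L \<Longrightarrow> y' \<in> carrier L \<Longrightarrow>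
        \<rho> x y \<Longrightarrow> \<rho> x' y' \<Longrightarrow> \<rho> (x \<oplus> x') (y \<oplus>\<^bsub>L\<^esub> y')"
      "\<And>a x y. a \<in> carrier R \<Longrightarrow> x \<in> carrier P \<Longrightarrow> y \<in> carrier L \<Longrightarrow> \<rho> x y \<Longrightarrow> \<rho> (a \<odot> x) (a \<odot>\<^bsub>L\<^esub> y)"
    and wv: "\<And>b. \<rho> (w b) (v b)" and u: "finitely_supported R u"
  shows "\<rho> (lincomb R P w u) (lincomb R L v u)"
proof -
  interpret L: abelian_group L using mX by (simp add: module_def)
  have ub: "u b \<in> carrier R" for b using u by (auto simp: finitely_supported_def)
  have wb: "w b \<in> carrier P" "v b \<in> carrier L" for b using w v by auto
  have cl: "u b \<odot> w b \<in> carrier P" "u b \<odot>\<^bsub>L\<^esub> v b \<in> carrier L" for b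
    using ub wb module.smult_closed[OF mX] module.smult_closed[OF mod] by auto
  have "\<rho> (finsum P (\<lambda>b. u b \<odot> w b) A) (finsum L (\<lambda>b. u b \<odot>\<^bsub>L\<^esub> v b) A)" if "finite A" for A
    using that
  proof (induction A rule: finite_induct)
    case (insert b A)
    have "finsum P (\<lambda>b. u b \<odot> w b) (insert b A) = u b \<odot> w b \<oplus> finsum P (\<lambda>b. u b \<odot> w b) A"
      using insert cl by (intro P.finsum_insert) auto
    moreover have "finsum L (\<lambda>b. u b \<odot>\<^bsub>L\<^esub> v b) (insert b A)
        = u b \<odot>\<^bsub>L\<^esub> v b \<oplus>\<^bsub>L\<^esub> finsum L (\<lambda>b. u b \<odot>\<^bsub>L\<^esub> v b) A"
      using insert cl by (intro L.finsum_insert) auto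
    moreover have "finsum P (\<lambda>b. u b \<odot> w b) A \<in> carrier P" "finsum L (\<lambda>b. u b \<odot>\<^bsub>L\<^esub> v b) A \<in> carrier L"
      using cl by (auto intro!: P.finsum_closed L.finsum_closed)
    ultimately show ?case using insert.IH rel(2) rel(3)[OF ub wb wv] cl by simp
  qed (use rel(1) in simp)
  then show ?thesis using u by (simp add: lincomb_def finitely_supported_def)
qed

end

text \<open>
  A linear relation that is total on a projective module contains the graph of a linear
  map. All comparison maps between resolutions below are obtained in this way.
\<close>

lemma linear_selection:
  fixes P :: "('a, 'p, 'c) module_scheme" (structure) and L :: "('a, 'x, 'd) module_scheme"
  assumes mod: "module R P" and mX: "module R L" and db: "dual_basis R P (w :: 'i \<Rightarrow> 'p) c"
    and rel: "\<rho> \<zero> \<zero>\<^bsub>L\<^esub>"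
      "\<And>x y x' y'. x \<in> carrier P \<Longrightarrow> x' \<in> carrier P \<Longrightarrow> y \<in> carrier L \<Longrightarrow> y' \<in> carrier L \<Longrightarrow>
        \<rho> x y \<Longrightarrow> \<rho> x' y' \<Longrightarrow> \<rho> (x \<oplus> x') (y \<oplus>\<^bsub>L\<^esub> y')"
      "\<And>a x y. a \<in> carrier R \<Longrightarrow> x \<in> carrier P \<Longrightarrow> y \<in> carrier L \<Longrightarrow> \<rho> x y \<Longrightarrow> \<rho> (a \<odot> x) (a \<odot>\<^bsub>L\<^esub> y)"
    and total: "\<And>x. x \<in> carrier P \<Longrightarrow> \<exists>y\<in>carrier L. \<rho> x y"
  shows "\<exists>l\<in>module_hom R P L. \<forall>x\<in>carrier P. \<rho> x (l x)"
proof -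
  have w: "range w \<subseteq> carrier P" using db by (simp add: dual_basis_def)
  then have "\<forall>b. \<exists>y\<in>carrier L. \<rho> (w b) y" using total by blast
  then obtain v where v: "\<And>b. v b \<in> carrier L" "\<And>b. \<rho> (w b) (v b)" by metis
  have rv: "range v \<subseteq> carrier L" using v by auto
  let ?l = "\<lambda>x. lincomb R L v (c x)"
  have c: "finitely_supported R (c x)" "x = lincomb R P w (c x)" if "x \<in> carrier P" for x
    using db that by (auto simp: dual_basis_def)
  have "?l (x \<oplus> y) = ?l x \<oplus>\<^bsub>L\<^esub> ?l y" if "x \<in> carrier P" "y \<in> carrier P" for x y
  proof -
    have "c (x \<oplus> y) = (\<lambda>b. c x b \<oplus>\<^bsub>R\<^esub> c y b)" using db that by (auto simp: dual_basis_def)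
    then show ?thesis using lincomb_add[OF mX rv c(1)[OF that(1)] c(1)[OF that(2)]] by simp
  qed
  moreover have "?l (a \<odot> x) = a \<odot>\<^bsub>L\<^esub> ?l x" if "a \<in> carrier R" "x \<in> carrier P" for a x
  proof -
    have "c (a \<odot> x) = (\<lambda>b. a \<otimes>\<^bsub>R\<^esub> c x b)" using db that by (auto simp: dual_basis_def)
    then show ?thesis using lincomb_smult[OF mX rv c(1)[OF that(2)] that(1)] by simp
  qed
  ultimately have "?l \<in> module_hom R P L"
    using lincomb_closed[OF mX rv] c(1) by (auto simp: module_hom_def)
  moreover have "\<rho> x (?l x)" if "x \<in> carrier P" for x
  proof -
    have "\<rho> (lincomb R P w (c x)) (lincomb R L v (c x))"
      by (rule lincomb_in_linear_relation[OF mod mX w rv rel v(2) c(1)[OF that]])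
    then show ?thesis by (simp only: c(2)[OF that, symmetric])
  qed
  ultimately show ?thesis by (intro bexI[of _ ?l] ballI)
qed

lemma hom_lincomb:
  assumes mP: "module R P" and mN: "module R N" and h: "h \<in> module_hom R P N"
    and w: "range w \<subseteq> carrier P" and u: "finitely_supported R u"
  shows "h (lincomb R P w u) = lincomb R N (h \<circ> w) u"
proof -
  have "(\<lambda>x y. h x = y) (lincomb R P w u) (lincomb R N (h \<circ> w) u)"
    by (rule lincomb_in_linear_relation[OF mP mN w])
       (use w in \<open>auto simp: module_homD[OF h] module_hom_zero[OF mP mN h] u\<close>)
  then show ?thesis .
qed

lemma projective_if_dual_basis:
  fixes P :: "('a, 'p) module"
  assumes mP: "module R P" and db: "dual_basis R P (w :: 'i \<Rightarrow> 'p) c"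
  shows "projective_module R P"
  unfolding projective_module_def
proof (intro conjI allI impI mP, elim conjE)
  fix M :: "('a, 'p \<Rightarrow> 'a) module" and N :: "('a, 'p) module" and \<pi> h
  assume *: "module R M" "module R N" "\<pi> \<in> module_hom R M N" "\<pi> ` carrier M = carrier N" "h \<in> module_hom R P N"
  have "\<exists>l\<in>module_hom R P M. \<forall>x\<in>carrier P. h x = \<pi> (l x)"
  proof (rule linear_selection[OF mP *(1) db])
    show "\<exists>y\<in>carrier M. h x = \<pi> y" if "x \<in> carrier P" for x
      using module_homD(1)[OF *(5) that] *(4) by (metis image_iff)
  qed (use *(1,2,3,5) in \<open>auto simp: module_homD[OF *(3)] module_homD[OF *(5)] module_hom_zero[OF mP *(2,5)] module_hom_zero[OF *(1-3)]\<close>)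
  then show "\<exists>l\<in>module_hom R P M. \<forall>x\<in>carrier P. \<pi> (l x) = h x" by metis
qed

text \<open>
  Lift the identity along the canonical surjection from the free module on the set
  \<open>carrier P\<close>.
\<close>

lemma dual_basis_if_projective:
  fixes P :: "('a, 'p) module"
  assumes "projective_module R P"
  shows "\<exists>(w :: 'p \<Rightarrow> 'p) c. dual_basis R P w c"
proof -
  have mP: "module R P" using assms by (simp add: projective_module_def)
  interpret R: cring R using mP by (simp add: module_def)
  interpret P: abelian_group P using mP by (simp add: module_def)
  define F :: "('a, 'p \<Rightarrow> 'a) module"
    where "F = \<lparr>carrier = {u. finitely_supported R u}, monoid.mult = undefined,
      one = undefined, ring.zero = (\<lambda>_. \<zero>\<^bsub>R\<^esub>), add = (\<lambda>u v b. u b \<oplus>\<^bsub>R\<^esub> v b), module.smult = (\<lambda>a u b. a \<otimes>\<^bsub>R\<^esub> u b)\<rparr>"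
  have F_simps: "carrier F = {u. finitely_supported R u}" "\<zero>\<^bsub>F\<^esub> = (\<lambda>_. \<zero>\<^bsub>R\<^esub>)"
    "u \<oplus>\<^bsub>F\<^esub> v = (\<lambda>b. u b \<oplus>\<^bsub>R\<^esub> v b)" "a \<odot>\<^bsub>F\<^esub> u = (\<lambda>b. a \<otimes>\<^bsub>R\<^esub> u b)" for u v a
    by (simp_all add: F_def)
  have supp: "u b \<in> carrier R" if "finitely_supported R u" for u :: "'p \<Rightarrow> 'a" and b
    using that by (simp add: finitely_supported_def)
  have mF: "module R F"
  proof (rule moduleI)
    show "abelian_group F"
    proof (rule abelian_groupI)
      fix u assume "u \<in> carrier F"
      then have "(\<lambda>b. \<ominus>\<^bsub>R\<^esub> u b) \<in> carrier F" "(\<lambda>b. \<ominus>\<^bsub>R\<^esub> u b) \<oplus>\<^bsub>F\<^esub> u = \<zero>\<^bsub>F\<^esub>"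
        by (auto simp: F_simps finitely_supported_def R.l_neg)
      then show "\<exists>v\<in>carrier F. v \<oplus>\<^bsub>F\<^esub> u = \<zero>\<^bsub>F\<^esub>" by blast
    next
      show "\<zero>\<^bsub>F\<^esub> \<in> carrier F" by (simp add: F_simps finitely_supported_def)
    qed (auto simp: F_simps supp R.a_ac fun_eq_iff intro: finitely_supported_add[OF mP])
  qed (auto simp: F_simps supp R.cring_axioms R.l_distr R.r_distr R.m_assoc
        intro: finitely_supported_smult[OF mP])
  define w where "w = (\<lambda>b. if b \<in> carrier P then b else \<zero>\<^bsub>P\<^esub>)"
  have w: "range w \<subseteq> carrier P" by (auto simp: w_def)
  have \<pi>: "lincomb R P w \<in> module_hom R F P"
    using lincomb_closed[OF mP w] lincomb_add[OF mP w] lincomb_smult[OF mP w]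
    by (auto simp: module_hom_def F_simps)
  have "lincomb R P w ` carrier F = carrier P"
  proof
    show "lincomb R P w ` carrier F \<subseteq> carrier P" using module_homD(1)[OF \<pi>] by auto
    show "carrier P \<subseteq> lincomb R P w ` carrier F"
    proof
      fix x assume x: "x \<in> carrier P"
      let ?u = "\<lambda>b. if b = x then \<one>\<^bsub>R\<^esub> else \<zero>\<^bsub>R\<^esub>"
      have u: "finitely_supported R ?u" by (auto simp: finitely_supported_def)
      have "lincomb R P w ?u = finsum P (\<lambda>b. ?u b \<odot>\<^bsub>P\<^esub> w b) {x}"
        by (rule lincomb_superset[OF mP w u]) auto
      also have "\<dots> = x" using x module.smult_one[OF mP] by (simp add: w_def)
      finally show "x \<in> lincomb R P w ` carrier F" using u by (metis F_simps(1) image_eqI mem_Collect_eq)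
    qed
  qed
  moreover have "(\<lambda>x. x) \<in> module_hom R P P" by (simp add: module_hom_def)
  ultimately obtain c where c: "c \<in> module_hom R P F" "\<forall>x\<in>carrier P. lincomb R P w (c x) = x"
    using assms mF mP \<pi> unfolding projective_module_def by blast
  have "dual_basis R P w c"
    using w c module_homD[OF c(1)] by (auto simp: dual_basis_def F_simps)
  then show ?thesis by blast
qed

text \<open>
  \<open>Z\<close> is a direct summand of \<open>P \<oplus> Q\<close>; the two modules are kept apart because they may live
  over different types.
\<close>

lemma dual_basis_retract_of_two:
  fixes Z :: "('a, 'z, 'c) module_scheme"
  assumes mZ: "module R Z" and mP: "module R P" and mQ: "module R Q"
    and dbP: "dual_basis R P (w :: 'i \<Rightarrow> 'p) c" and dbQ: "dual_basis R Q (w' :: 'j \<Rightarrow> 'q) c'"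
    and \<phi>: "\<phi> \<in> module_hom R Z P" and \<phi>': "\<phi>' \<in> module_hom R Z Q"
    and \<psi>: "\<psi> \<in> module_hom R P Z" and \<psi>': "\<psi>' \<in> module_hom R Q Z"
    and id: "\<And>z. z \<in> carrier Z \<Longrightarrow> z = \<psi> (\<phi> z) \<oplus>\<^bsub>Z\<^esub> \<psi>' (\<phi>' z)"
  shows "dual_basis R Z (case_sum (\<psi> \<circ> w) (\<psi>' \<circ> w')) (\<lambda>z. case_sum (c (\<phi> z)) (c' (\<phi>' z)))"
proof -
  interpret R: cring R using mP by (simp add: module_def)
  interpret Z: abelian_group Z using mZ by (simp add: module_def)
  have w: "range w \<subseteq> carrier P" "range w' \<subseteq> carrier Q" using dbP dbQ by (auto simp: dual_basis_def)
  have \<psi>w: "range (\<psi> \<circ> w) \<subseteq> carrier Z" "range (\<psi>' \<circ> w') \<subseteq> carrier Z"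
    using w module_homD(1)[OF \<psi>] module_homD(1)[OF \<psi>'] by auto
  let ?W = "case_sum (\<psi> \<circ> w) (\<psi>' \<circ> w')"
  let ?C = "\<lambda>z. case_sum (c (\<phi> z)) (c' (\<phi>' z))"
  have W: "range ?W \<subseteq> carrier Z" using \<psi>w by (force split: sum.splits)
  have fin: "finitely_supported R (?C z) \<and> z = lincomb R Z ?W (?C z)" if z: "z \<in> carrier Z" for z
  proof -
    have z1: "\<phi> z \<in> carrier P" "\<phi>' z \<in> carrier Q" using z module_homD(1)[OF \<phi>] module_homD(1)[OF \<phi>'] by auto
    have f: "finitely_supported R (c (\<phi> z))" "finitely_supported R (c' (\<phi>' z))"
      and eq: "\<phi> z = lincomb R P w (c (\<phi> z))" "\<phi>' z = lincomb R Q w' (c' (\<phi>' z))"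
      using dbP dbQ z1 by (auto simp: dual_basis_def)
    let ?A = "{b. c (\<phi> z) b \<noteq> \<zero>\<^bsub>R\<^esub>}" and ?B = "{b. c' (\<phi>' z) b \<noteq> \<zero>\<^bsub>R\<^esub>}"
    have fAB: "finite ?A" "finite ?B" using f by (auto simp: finitely_supported_def)
    have supp: "{b. ?C z b \<noteq> \<zero>\<^bsub>R\<^esub>} = Inl ` ?A \<union> Inr ` ?B"
      by (auto simp: image_iff split: sum.splits) (metis sum.exhaust_sel sum.case)+
    have fs: "finitely_supported R (?C z)"
      using f fAB by (auto simp: finitely_supported_def supp[unfolded finitely_supported_def] split: sum.splits)
    have smem: "?C z b \<odot>\<^bsub>Z\<^esub> ?W b \<in> carrier Z" for b
      using fs W by (intro smult_carrier[OF mZ]) (auto simp: finitely_supported_def)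
    have "lincomb R Z ?W (?C z) = finsum Z (\<lambda>b. ?C z b \<odot>\<^bsub>Z\<^esub> ?W b) (Inl ` ?A \<union> Inr ` ?B)"
      by (simp add: lincomb_def supp)
    also have "\<dots> = finsum Z (\<lambda>b. ?C z b \<odot>\<^bsub>Z\<^esub> ?W b) (Inl ` ?A) \<oplus>\<^bsub>Z\<^esub> finsum Z (\<lambda>b. ?C z b \<odot>\<^bsub>Z\<^esub> ?W b) (Inr ` ?B)"
      by (rule Z.finsum_Un_disjoint) (use fAB smem in auto)
    also have "finsum Z (\<lambda>b. ?C z b \<odot>\<^bsub>Z\<^esub> ?W b) (Inl ` ?A) = finsum Z (\<lambda>b. ?C z (Inl b) \<odot>\<^bsub>Z\<^esub> ?W (Inl b)) ?A"
      by (rule Z.finsum_reindex) (use smem in auto)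
    also have "finsum Z (\<lambda>b. ?C z b \<odot>\<^bsub>Z\<^esub> ?W b) (Inr ` ?B) = finsum Z (\<lambda>b. ?C z (Inr b) \<odot>\<^bsub>Z\<^esub> ?W (Inr b)) ?B"
      by (rule Z.finsum_reindex) (use smem in auto)
    finally have "lincomb R Z ?W (?C z) = lincomb R Z (\<psi> \<circ> w) (c (\<phi> z)) \<oplus>\<^bsub>Z\<^esub> lincomb R Z (\<psi>' \<circ> w') (c' (\<phi>' z))"
      by (simp add: lincomb_def)
    also have "\<dots> = \<psi> (lincomb R P w (c (\<phi> z))) \<oplus>\<^bsub>Z\<^esub> \<psi>' (lincomb R Q w' (c' (\<phi>' z)))"
      using hom_lincomb[OF mP mZ \<psi> w(1) f(1)] hom_lincomb[OF mQ mZ \<psi>' w(2) f(2)] by simp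
    also have "\<dots> = z" using eq id[OF z] by simp
    finally show ?thesis using fs by simp
  qed
  have add: "?C (x \<oplus>\<^bsub>Z\<^esub> y) = (\<lambda>b. ?C x b \<oplus>\<^bsub>R\<^esub> ?C y b)" if "x \<in> carrier Z" "y \<in> carrier Z" for x y
    using that dbP dbQ module_homD[OF \<phi>] module_homD[OF \<phi>']
    by (auto simp: dual_basis_def fun_eq_iff split: sum.splits)
  have smult: "?C (a \<odot>\<^bsub>Z\<^esub> x) = (\<lambda>b. a \<otimes>\<^bsub>R\<^esub> ?C x b)" if "a \<in> carrier R" "x \<in> carrier Z" for a x
    using that dbP dbQ module_homD[OF \<phi>] module_homD[OF \<phi>']
    by (auto simp: dual_basis_def fun_eq_iff split: sum.splits)
  show ?thesis unfolding dual_basis_def using W fin add smult by blast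
qed

section \<open>Syzygies and projective dimension\<close>

lemma dual_basisD:
  assumes "dual_basis R P w c"
  shows "range w \<subseteq> carrier P"
    and "x \<in> carrier P \<Longrightarrow> finitely_supported R (c x)"
    and "x \<in> carrier P \<Longrightarrow> lincomb R P w (c x) = x"
    and "x \<in> carrier P \<Longrightarrow> y \<in> carrier P \<Longrightarrow> c (x \<oplus>\<^bsub>P\<^esub> y) = (\<lambda>b. c x b \<oplus>\<^bsub>R\<^esub> c y b)"
    and "a \<in> carrier R \<Longrightarrow> x \<in> carrier P \<Longrightarrow> c (a \<odot>\<^bsub>P\<^esub> x) = (\<lambda>b. a \<otimes>\<^bsub>R\<^esub> c x b)"
  using assms by (simp_all add: dual_basis_def)

text \<open>
  Submodules of \<open>\<Prod>\<^sub>i R\<close> with the pointwise operations. Module records extend ring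
  records, which accounts for the two undefined fields.
\<close>

definition fun_module :: "(nat \<Rightarrow> 'k::field mpoly) set \<Rightarrow> ('k mpoly, nat \<Rightarrow> 'k mpoly) module"
  where "fun_module C = \<lparr>carrier = C, monoid.mult = undefined, one = undefined,
    ring.zero = (\<lambda>_. 0), add = (\<lambda>u v i. u i + v i), module.smult = (\<lambda>a u i. a * u i)\<rparr>"

lemma fun_module_simps [simp]:
  "carrier (fun_module C) = C" "\<zero>\<^bsub>fun_module C\<^esub> = (\<lambda>_. 0)"
  "u \<oplus>\<^bsub>fun_module C\<^esub> v = (\<lambda>i. u i + v i)" "a \<odot>\<^bsub>fun_module C\<^esub> u = (\<lambda>i. a * u i)"
  by (simp_all add: fun_module_def)

definition submod :: "nat \<Rightarrow> (nat \<Rightarrow> 'k::field mpoly) set \<Rightarrow> bool"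
  where "submod N C \<longleftrightarrow> (\<forall>u\<in>C. \<forall>i. u i \<in> poly_over {..<N}) \<and> (\<lambda>_. 0) \<in> C \<and>
    (\<forall>u\<in>C. \<forall>v\<in>C. (\<lambda>i. u i + v i) \<in> C) \<and> (\<forall>a\<in>poly_over {..<N}. \<forall>u\<in>C. (\<lambda>i. a * u i) \<in> C)"

lemma submodD:
  assumes "submod N C"
  shows "u \<in> C \<Longrightarrow> u i \<in> poly_over {..<N}" "(\<lambda>_. 0) \<in> C"
    "u \<in> C \<Longrightarrow> v \<in> C \<Longrightarrow> (\<lambda>i. u i + v i) \<in> C"
    "a \<in> poly_over {..<N} \<Longrightarrow> u \<in> C \<Longrightarrow> (\<lambda>i. a * u i) \<in> C"
  using assms by (auto simp: submod_def)

lemma module_fun_module: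
  assumes "submod N C"
  shows "module (mpoly_ring N) (fun_module C)"
proof (rule moduleI)
  show "cring (mpoly_ring N :: 'a mpoly ring)" by (rule cring_mpoly_ring)
  show "abelian_group (fun_module C)"
  proof (rule abelian_groupI)
    fix u assume u: "u \<in> carrier (fun_module C)"
    have "(\<lambda>i. - 1 * u i) \<in> C"
      using u by (intro submodD(4)[OF assms] poly_over_uminus poly_over_1) simp
    then show "\<exists>v\<in>carrier (fun_module C). v \<oplus>\<^bsub>fun_module C\<^esub> u = \<zero>\<^bsub>fun_module C\<^esub>"
      by (intro bexI[of _ "\<lambda>i. - 1 * u i"]) auto
  qed (use submodD[OF assms] in \<open>auto simp: algebra_simps\<close>)
qed (use submodD[OF assms] in \<open>auto simp: algebra_simps carrier_mpoly_ring\<close>)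

lemma finitely_supported_mpoly:
  "finitely_supported (mpoly_ring N) u \<longleftrightarrow> (\<forall>b. u b \<in> poly_over {..<N}) \<and> finite {b. u b \<noteq> 0}"
  by (simp add: finitely_supported_def carrier_mpoly_ring)

lemma lincomb_fun_module:
  assumes C: "submod N C" and w: "range w \<subseteq> C" and u: "finitely_supported (mpoly_ring N) u"
  shows "lincomb (mpoly_ring N) (fun_module C) w u = (\<lambda>i. \<Sum>b\<in>{b. u b \<noteq> 0}. u b * w b i)"
proof -
  interpret M: abelian_group "fun_module C" using module_fun_module[OF C] by (simp add: module_def)
  have smem: "(\<lambda>i. u b * w b i) \<in> C" for b
    using u w by (intro submodD(4)[OF C]) (auto simp: finitely_supported_mpoly)
  have "finsum (fun_module C) (\<lambda>b. u b \<odot>\<^bsub>fun_module C\<^esub> w b) A = (\<lambda>i. \<Sum>b\<in>A. u b * w b i)" if "finite A" for A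
    using that
  proof (induction A rule: finite_induct)
    case (insert b A)
    have "finsum (fun_module C) (\<lambda>b. u b \<odot>\<^bsub>fun_module C\<^esub> w b) (insert b A)
      = (u b \<odot>\<^bsub>fun_module C\<^esub> w b) \<oplus>\<^bsub>fun_module C\<^esub> finsum (fun_module C) (\<lambda>b. u b \<odot>\<^bsub>fun_module C\<^esub> w b) A"
      by (rule M.finsum_insert) (use insert smem in auto)
    then show ?case using insert by simp
  qed simp
  then show ?thesis using u by (simp add: lincomb_def finitely_supported_mpoly)
qed

lemma dual_basis_fun_module_iff:
  assumes C: "submod N C"
  shows "dual_basis (mpoly_ring N) (fun_module C) w c \<longleftrightarrow> range w \<subseteq> C \<and>
    (\<forall>x\<in>C. (\<forall>b. c x b \<in> poly_over {..<N}) \<and> finite {b. c x b \<noteq> 0} \<and>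
      (\<forall>i. x i = (\<Sum>b\<in>{b. c x b \<noteq> 0}. c x b * w b i))) \<and>
    (\<forall>x\<in>C. \<forall>y\<in>C. \<forall>b. c (\<lambda>i. x i + y i) b = c x b + c y b) \<and>
    (\<forall>a\<in>poly_over {..<N}. \<forall>x\<in>C. \<forall>b. c (\<lambda>i. a * x i) b = a * c x b)"
proof (cases "range w \<subseteq> C")
  case True
  have "finitely_supported (mpoly_ring N) (c x) \<and> x = lincomb (mpoly_ring N) (fun_module C) w (c x) \<longleftrightarrow>
      (\<forall>b. c x b \<in> poly_over {..<N}) \<and> finite {b. c x b \<noteq> 0} \<and>
      (\<forall>i. x i = (\<Sum>b\<in>{b. c x b \<noteq> 0}. c x b * w b i))" for x
  proof (cases "finitely_supported (mpoly_ring N) (c x)")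
    case fs: True
    show ?thesis
      unfolding lincomb_fun_module[OF C True fs] fun_eq_iff using fs by (simp add: finitely_supported_mpoly)
  qed (simp only: finitely_supported_mpoly, blast)
  then show ?thesis
    unfolding dual_basis_def fun_module_simps mpoly_ring_simps carrier_mpoly_ring by (simp only: fun_eq_iff)
next
  case False
  then show ?thesis by (simp only: dual_basis_def fun_module_simps simp_thms)
qed

definition vecs :: "nat \<Rightarrow> nat \<Rightarrow> (nat \<Rightarrow> 'k::field mpoly) set"
  where "vecs N m = {u. (\<forall>i. u i \<in> poly_over {..<N}) \<and> (\<forall>i\<ge>m. u i = 0)}"

definition dotp :: "'k::field mpoly list \<Rightarrow> (nat \<Rightarrow> 'k mpoly) \<Rightarrow> 'k mpoly"
  where "dotp fs u = (\<Sum>i<length fs. u i * fs ! i)"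

definition syz :: "nat \<Rightarrow> 'k::field mpoly list \<Rightarrow> (nat \<Rightarrow> 'k mpoly) set"
  where "syz N fs = {u \<in> vecs N (length fs). dotp fs u = 0}"

lemma dotp_add: "dotp fs (\<lambda>i. u i + v i) = dotp fs u + dotp fs v"
  and dotp_diff: "dotp fs (\<lambda>i. u i - v i) = dotp fs u - dotp fs v"
  and dotp_smult: "dotp fs (\<lambda>i. a * u i) = a * dotp fs u"
  and dotp_zero: "dotp fs (\<lambda>_. 0) = 0"
  by (simp_all add: dotp_def sum.distrib sum_subtractf sum_distrib_left algebra_simps)

lemma submod_vecs: "submod N (vecs N m)"
  by (auto simp: submod_def vecs_def poly_over_0 poly_over_add poly_over_mult)

lemma submod_syz: "submod N (syz N fs)"
  using submodD[OF submod_vecs]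
  by (auto simp: submod_def syz_def dotp_add dotp_smult dotp_zero)

lemma vecs_memD: "u \<in> vecs N m \<Longrightarrow> u i \<in> poly_over {..<N}"
  by (simp add: vecs_def)

definition unit_vec :: "nat \<Rightarrow> nat \<Rightarrow> nat \<Rightarrow> 'k::field mpoly"
  where "unit_vec m i = (\<lambda>j. if j = i \<and> i < m then 1 else 0)"

lemma unit_vec_in_vecs: "unit_vec m i \<in> vecs N m"
  by (auto simp: unit_vec_def vecs_def poly_over_0 poly_over_1)

lemma dual_basis_vecs: "dual_basis (mpoly_ring N) (fun_module (vecs N m)) (unit_vec m) (\<lambda>u. u)"
proof -
  have "finite {b. x b \<noteq> 0} \<and> (\<forall>i. x i = (\<Sum>b\<in>{b. x b \<noteq> 0}. x b * unit_vec m b i))"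
    if x: "x \<in> vecs N m" for x :: "nat \<Rightarrow> 'a mpoly"
  proof
    have sub: "{b. x b \<noteq> 0} \<subseteq> {..<m}" using x by (auto simp: vecs_def not_less[symmetric])
    then show fin: "finite {b. x b \<noteq> 0}" using finite_subset by blast
    show "\<forall>i. x i = (\<Sum>b\<in>{b. x b \<noteq> 0}. x b * unit_vec m b i)"
    proof
      fix i
      have "(\<Sum>b\<in>{b. x b \<noteq> 0}. x b * unit_vec m b i) = (\<Sum>b\<in>{b. x b \<noteq> 0}. if b = i then x b else 0)"
        by (rule sum.cong) (use sub in \<open>auto simp: unit_vec_def\<close>)
      then show "x i = (\<Sum>b\<in>{b. x b \<noteq> 0}. x b * unit_vec m b i)" using fin by (simp add: sum.delta)
    qed
  qed
  then show ?thesis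
    unfolding dual_basis_fun_module_iff[OF submod_vecs]
    using unit_vec_in_vecs vecs_memD by (intro conjI ballI allI) (blast | simp)+
qed

lemma Idl_eq_dotp:
  fixes fs :: "'k::field mpoly list"
  assumes fs: "set fs \<subseteq> poly_over {..<N}"
  shows "Idl\<^bsub>mpoly_ring N\<^esub> (set fs) = dotp fs ` vecs N (length fs)"
proof
  interpret cring "mpoly_ring N" by (rule cring_mpoly_ring)
  have dotp_in: "dotp fs u \<in> poly_over {..<N}" if "u \<in> vecs N (length fs)" for u
    unfolding dotp_def using fs vecs_memD[OF that] by (auto intro!: poly_over_sum poly_over_mult)
  have ideal: "ideal (dotp fs ` vecs N (length fs)) (mpoly_ring N)"
    unfolding ideal_mpoly_ring_iff
  proof (intro conjI ballI)
    show "dotp fs ` vecs N (length fs) \<subseteq> poly_over {..<N}" using dotp_in by auto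
    show "0 \<in> dotp fs ` vecs N (length fs)"
      using submodD(2)[OF submod_vecs] dotp_zero by (metis imageI)
    show "a + b \<in> dotp fs ` vecs N (length fs)"
      if ab: "a \<in> dotp fs ` vecs N (length fs)" "b \<in> dotp fs ` vecs N (length fs)" for a b
    proof -
      obtain u v where "u \<in> vecs N (length fs)" "v \<in> vecs N (length fs)" "a = dotp fs u" "b = dotp fs v"
        using ab by blast
      then show ?thesis
        using submodD(3)[OF submod_vecs] dotp_add[of fs u v] by (intro image_eqI[of _ _ "\<lambda>i. u i + v i"]) auto
    qed
    show "a * b \<in> dotp fs ` vecs N (length fs)"
      if ab: "a \<in> poly_over {..<N}" "b \<in> dotp fs ` vecs N (length fs)" for a b
    proof -
      obtain u where "u \<in> vecs N (length fs)" "b = dotp fs u" using ab by blast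
      then show ?thesis
        using submodD(4)[OF submod_vecs ab(1)] dotp_smult[of fs a u] by (intro image_eqI[of _ _ "\<lambda>i. a * u i"]) auto
    qed
  qed
  have "set fs \<subseteq> dotp fs ` vecs N (length fs)"
  proof
    fix f assume "f \<in> set fs"
    then obtain i where i: "i < length fs" "fs ! i = f" by (metis in_set_conv_nth)
    have "dotp fs (unit_vec (length fs) i) = (\<Sum>j<length fs. if j = i then fs ! j else 0)"
      unfolding dotp_def by (rule sum.cong) (use i in \<open>auto simp: unit_vec_def\<close>)
    then have "dotp fs (unit_vec (length fs) i) = f" using i by (simp add: sum.delta)
    then show "f \<in> dotp fs ` vecs N (length fs)" using unit_vec_in_vecs by (metis imageI)
  qed
  then show "Idl\<^bsub>mpoly_ring N\<^esub> (set fs) \<subseteq> dotp fs ` vecs N (length fs)"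
    by (rule genideal_minimal[OF ideal])
  have I: "ideal (Idl\<^bsub>mpoly_ring N\<^esub> (set fs)) (mpoly_ring N)" "set fs \<subseteq> Idl\<^bsub>mpoly_ring N\<^esub> (set fs)"
    using fs by (auto intro!: genideal_ideal genideal_self simp: carrier_mpoly_ring)
  show "dotp fs ` vecs N (length fs) \<subseteq> Idl\<^bsub>mpoly_ring N\<^esub> (set fs)"
  proof
    fix a assume "a \<in> dotp fs ` vecs N (length fs)"
    then obtain u where u: "u \<in> vecs N (length fs)" "a = dotp fs u" by auto
    have "u i * fs ! i \<in> Idl\<^bsub>mpoly_ring N\<^esub> (set fs)" if "i < length fs" for i
      using ideal_mpolyD[OF I(1)] I(2) vecs_memD[OF u(1)] nth_mem[OF that] by blast
    then show "a \<in> Idl\<^bsub>mpoly_ring N\<^esub> (set fs)"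
      unfolding u(2) dotp_def by (intro ideal_mpoly_sum[OF I(1)]) auto
  qed
qed

context
  fixes N :: nat and J :: "'k::field mpoly set"
  assumes J: "ideal J (mpoly_ring N)"
begin

interpretation J: ideal J "mpoly_ring N" by (rule J)

abbreviation "coset a \<equiv> J +>\<^bsub>mpoly_ring N\<^esub> a"
abbreviation "QM \<equiv> quotient_module (mpoly_ring N) J"

lemma coset_eq_iff:
  assumes "a \<in> poly_over {..<N}" "b \<in> poly_over {..<N}"
  shows "coset a = coset b \<longleftrightarrow> a - b \<in> J"
proof -
  have "\<ominus>\<^bsub>mpoly_ring N\<^esub> b = - b"
    by (rule J.minus_equality) (use assms in \<open>auto simp: carrier_mpoly_ring poly_over_uminus\<close>)
  then have "a \<ominus>\<^bsub>mpoly_ring N\<^esub> b = a - b" by (simp add: a_minus_def)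
  then show ?thesis
    using J.quotient_eq_iff_same_a_r_cos[OF J, of a b] assms by (simp add: carrier_mpoly_ring)
qed

lemma quotient_carrier: "carrier QM = coset ` poly_over {..<N}"
  by (auto simp: quotient_module_def FactRing_def A_RCOSETS_def' carrier_mpoly_ring a_r_coset_def' r_coset_def)

lemma quotient_add:
  "a \<in> poly_over {..<N} \<Longrightarrow> b \<in> poly_over {..<N} \<Longrightarrow> coset a \<oplus>\<^bsub>QM\<^esub> coset b = coset (a + b)"
  using J.a_rcos_sum[of a b] by (simp add: quotient_module_def FactRing_def carrier_mpoly_ring)

lemma quotient_smult:
  "a \<in> poly_over {..<N} \<Longrightarrow> b \<in> poly_over {..<N} \<Longrightarrow> a \<odot>\<^bsub>QM\<^esub> coset b = coset (a * b)"
  using J.rcoset_mult_add[of a b] by (simp add: quotient_module_def FactRing_def carrier_mpoly_ring)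

lemma quotient_zero: "\<zero>\<^bsub>QM\<^esub> = coset 0"
  using J.a_rcos_zero[OF J, of 0] ideal_mpolyD[OF J] by (simp add: quotient_module_def FactRing_def)

lemma coset_zero_iff: "a \<in> poly_over {..<N} \<Longrightarrow> coset a = \<zero>\<^bsub>QM\<^esub> \<longleftrightarrow> a \<in> J"
  by (simp add: quotient_zero coset_eq_iff poly_over_0)

lemma module_quotient: "module (mpoly_ring N) QM"
proof (rule moduleI)
  show "cring (mpoly_ring N :: 'k mpoly ring)" by (rule cring_mpoly_ring)
  show "abelian_group QM"
  proof (rule abelian_groupI)
    fix x assume "x \<in> carrier QM"
    then obtain a where "x = coset a" "a \<in> poly_over {..<N}" by (auto simp: quotient_carrier)
    then show "\<exists>y\<in>carrier QM. y \<oplus>\<^bsub>QM\<^esub> x = \<zero>\<^bsub>QM\<^esub>"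
      by (intro bexI[of _ "coset (- a)"]) (auto simp: quotient_add quotient_carrier quotient_zero poly_over_uminus)
  qed (auto simp: quotient_carrier quotient_add quotient_zero poly_over_0 poly_over_add add_ac)
qed (auto simp: quotient_carrier quotient_add quotient_smult poly_over_1 poly_over_add poly_over_mult
      carrier_mpoly_ring algebra_simps)

end

lemma proj_dim_leD:
  assumes "proj_dim R M \<le> enat n"
  shows "\<exists>(P :: nat \<Rightarrow> ('a, nat \<Rightarrow> 'a) module) \<delta> \<epsilon>. projective_resolution R M P \<delta> \<epsilon> \<and>
    (\<forall>i>n. carrier (P i) = {\<zero>\<^bsub>P i\<^esub>})"
proof -
  let ?A = "{enat l |l. \<exists>(P :: nat \<Rightarrow> ('a, nat \<Rightarrow> 'a) module) \<delta> \<epsilon>.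
      projective_resolution R M P \<delta> \<epsilon> \<and> (\<forall>i>l. carrier (P i) = {\<zero>\<^bsub>P i\<^esub>})}"
  have "?A \<noteq> {}"
  proof
    assume "?A = {}"
    then have "proj_dim R M = \<infinity>" unfolding proj_dim_def by (simp only: Inf_enat_def) simp
    then show False using assms by simp
  qed
  then have "Inf ?A \<in> ?A" unfolding Inf_enat_def by (metis (no_types, lifting) LeastI ex_in_conv)
  then obtain l and P :: "nat \<Rightarrow> ('a, nat \<Rightarrow> 'a) module" and \<delta> \<epsilon>
    where l: "proj_dim R M = enat l" "projective_resolution R M P \<delta> \<epsilon>" "\<forall>i>l. carrier (P i) = {\<zero>\<^bsub>P i\<^esub>}"
    unfolding proj_dim_def by blast
  then show ?thesis using assms by (metis enat_ord_simps(1) le_less_trans)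
qed

lemma hom_injective_if_kernel_trivial:
  assumes "module R M" "module R N" "h \<in> module_hom R M N"
    and ker: "\<And>x. x \<in> carrier M \<Longrightarrow> h x = \<zero>\<^bsub>N\<^esub> \<Longrightarrow> x = \<zero>\<^bsub>M\<^esub>"
    and x: "x \<in> carrier M" "y \<in> carrier M" "h x = h y"
  shows "x = y"
proof -
  interpret M: abelian_group M using assms(1) by (simp add: module_def)
  interpret N: abelian_group N using assms(2) by (simp add: module_def)
  let ?z = "x \<ominus>\<^bsub>M\<^esub> y"
  have z: "?z \<in> carrier M" "?z \<oplus>\<^bsub>M\<^esub> y = x"
    using x by (auto simp: a_minus_def M.a_assoc M.l_neg)
  then have "h ?z \<oplus>\<^bsub>N\<^esub> h y = h y" using module_homD(2)[OF assms(3) z(1) x(2)] x(3) by simp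
  then have "h ?z = \<zero>\<^bsub>N\<^esub>" using z x module_homD(1)[OF assms(3)] by (metis N.add.r_cancel_one')
  then show ?thesis using ker z x by (metis M.l_zero)
qed

text \<open>
  A projective resolution \<open>P\<close> of \<open>R/J\<close> is compared with the beginning \<open>R\<^sup>m \<rightarrow> R \<rightarrow> R/J\<close> of a free
  one.
\<close>

locale quotient_resolution =
  fixes N :: nat and J :: "'k::field mpoly set" and P :: "nat \<Rightarrow> ('k mpoly, nat \<Rightarrow> 'k mpoly) module"
    and \<delta> \<epsilon>
  assumes J: "ideal J (mpoly_ring N)"
    and res: "projective_resolution (mpoly_ring N) (quotient_module (mpoly_ring N) J) P \<delta> \<epsilon>"
begin

abbreviation "R \<equiv> mpoly_ring N :: 'k mpoly ring"

lemma projective: "projective_module R (P i)"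
  and \<delta>_hom: "\<delta> i \<in> module_hom R (P (Suc i)) (P i)"
  and \<epsilon>_hom: "\<epsilon> \<in> module_hom R (P 0) (quotient_module R J)"
  and \<epsilon>_surj: "\<epsilon> ` carrier (P 0) = carrier (quotient_module R J)"
  using res by (auto simp: projective_resolution_def)

lemma mod: "module R (P i)"
  using projective[of i] by (simp add: projective_module_def)

lemma image_\<delta>_0: "\<delta> 0 ` carrier (P 1) = {x \<in> carrier (P 0). \<epsilon> x = \<zero>\<^bsub>quotient_module R J\<^esub>}"
  and image_\<delta>_Suc: "\<delta> (Suc i) ` carrier (P (Suc (Suc i))) = {x \<in> carrier (P (Suc i)). \<delta> i x = \<zero>\<^bsub>P i\<^esub>}"
  using res by (simp_all add: projective_resolution_def)

lemma exact0:
  assumes "x \<in> carrier (P 0)" "\<epsilon> x = \<zero>\<^bsub>quotient_module R J\<^esub>"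
  shows "\<exists>y\<in>carrier (P 1). \<delta> 0 y = x"
proof -
  have "x \<in> \<delta> 0 ` carrier (P 1)" unfolding image_\<delta>_0 using assms by simp
  then show ?thesis by (elim imageE) (rule bexI, simp_all)
qed

lemma complex0:
  assumes "y \<in> carrier (P 1)" shows "\<epsilon> (\<delta> 0 y) = \<zero>\<^bsub>quotient_module R J\<^esub>"
proof -
  have "\<delta> 0 y \<in> \<delta> 0 ` carrier (P 1)" using assms by (rule imageI)
  then show ?thesis unfolding image_\<delta>_0 by simp
qed

lemma exact:
  assumes "x \<in> carrier (P (Suc i))" "\<delta> i x = \<zero>\<^bsub>P i\<^esub>"
  shows "\<exists>y\<in>carrier (P (Suc (Suc i))). \<delta> (Suc i) y = x"
proof -
  have "x \<in> \<delta> (Suc i) ` carrier (P (Suc (Suc i)))" unfolding image_\<delta>_Suc using assms by simp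
  then show ?thesis by (elim imageE) (rule bexI, simp_all)
qed

lemma complex:
  assumes "y \<in> carrier (P (Suc (Suc i)))" shows "\<delta> i (\<delta> (Suc i) y) = \<zero>\<^bsub>P i\<^esub>"
proof -
  have "\<delta> (Suc i) y \<in> \<delta> (Suc i) ` carrier (P (Suc (Suc i)))" using assms by (rule imageI)
  then show ?thesis unfolding image_\<delta>_Suc by simp
qed

lemma \<delta>_injective:
  assumes "carrier (P (Suc (Suc i))) = {\<zero>\<^bsub>P (Suc (Suc i))\<^esub>}"
    "x \<in> carrier (P (Suc i))" "y \<in> carrier (P (Suc i))" "\<delta> i x = \<delta> i y"
  shows "x = y"
proof (rule hom_injective_if_kernel_trivial[OF mod[of "Suc i"] mod[of i] \<delta>_hom[of i]])
  show "x \<in> carrier (P (Suc i))" "y \<in> carrier (P (Suc i))" "\<delta> i x = \<delta> i y" by fact+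
next
  fix z assume "z \<in> carrier (P (Suc i))" "\<delta> i z = \<zero>\<^bsub>P i\<^esub>"
  then obtain t where "t \<in> carrier (P (Suc (Suc i)))" "\<delta> (Suc i) t = z" using exact by blast
  then show "z = \<zero>\<^bsub>P (Suc i)\<^esub>" using assms(1) module_hom_zero[OF mod[of "Suc (Suc i)"] mod[of "Suc i"] \<delta>_hom[of "Suc i"]] by auto
qed

text \<open>
  The comparison in degree \<open>0\<close>. The element \<open>p0\<close> is a preimage of \<open>1 + J\<close>, so \<open>r \<mapsto> r p0\<close> is a
  map from \<open>R\<close> to \<open>P 0\<close> over \<open>R/J\<close>, and \<open>\<psi>\<close> is a map back; the composite differs from the
  identity by an element of \<open>J\<close>.
\<close>

lemma augmentation_lift:
  obtains p0 \<psi> where "p0 \<in> carrier (P 0)" "\<psi> \<in> module_hom R (P 0) (fun_module (vecs N 1))"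
    "1 - \<psi> p0 0 \<in> J" "\<And>y. y \<in> carrier (P 1) \<Longrightarrow> \<psi> (\<delta> 0 y) 0 \<in> J"
    "\<And>r. r \<in> J \<Longrightarrow> \<exists>x\<in>carrier (P 1). \<delta> 0 x = r \<odot>\<^bsub>P 0\<^esub> p0"
proof -
  have "J +>\<^bsub>R\<^esub> 1 \<in> \<epsilon> ` carrier (P 0)"
    unfolding \<epsilon>_surj quotient_carrier[OF J] using poly_over_1 by (rule imageI)
  then obtain p0 where p0: "p0 \<in> carrier (P 0)" "\<epsilon> p0 = J +>\<^bsub>R\<^esub> 1" by (elim imageE) simp
  obtain w :: "(nat \<Rightarrow> 'k mpoly) \<Rightarrow> nat \<Rightarrow> 'k mpoly" and c where db: "dual_basis R (P 0) w c"
    using dual_basis_if_projective[OF projective] by blast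
  have "\<exists>\<psi>\<in>module_hom R (P 0) (fun_module (vecs N 1)). \<forall>x\<in>carrier (P 0). \<epsilon> x = J +>\<^bsub>R\<^esub> \<psi> x 0"
  proof (rule linear_selection[OF mod module_fun_module[OF submod_vecs] db])
    show "\<epsilon> \<zero>\<^bsub>P 0\<^esub> = J +>\<^bsub>R\<^esub> \<zero>\<^bsub>fun_module (vecs N 1)\<^esub> 0"
      using module_hom_zero[OF mod module_quotient[OF J] \<epsilon>_hom] by (simp add: quotient_zero[OF J])
    show "\<exists>y\<in>carrier (fun_module (vecs N 1)). \<epsilon> x = J +>\<^bsub>R\<^esub> y 0" if x: "x \<in> carrier (P 0)" for x
    proof -
      obtain a where a: "a \<in> poly_over {..<N}" "\<epsilon> x = J +>\<^bsub>R\<^esub> a"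
        using module_homD(1)[OF \<epsilon>_hom x] by (auto simp: quotient_carrier[OF J])
      then show ?thesis
        by (intro bexI[of _ "\<lambda>i. if i = 0 then a else 0"]) (auto simp: vecs_def poly_over_0)
    qed
  qed (auto simp: module_homD[OF \<epsilon>_hom] quotient_add[OF J] quotient_smult[OF J] vecs_memD carrier_mpoly_ring)
  then obtain \<psi> where \<psi>: "\<psi> \<in> module_hom R (P 0) (fun_module (vecs N 1))"
    and \<epsilon>\<psi>: "\<And>x. x \<in> carrier (P 0) \<Longrightarrow> \<epsilon> x = J +>\<^bsub>R\<^esub> \<psi> x 0" by blast
  have \<psi>R: "\<psi> x 0 \<in> poly_over {..<N}" if "x \<in> carrier (P 0)" for x
    using module_homD(1)[OF \<psi> that] by (simp add: vecs_memD)
  show thesis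
  proof (rule that[OF p0(1) \<psi>])
    show "1 - \<psi> p0 0 \<in> J"
      using p0 \<epsilon>\<psi>[OF p0(1)] coset_eq_iff[OF J poly_over_1 \<psi>R[OF p0(1)]] by simp
    show "\<psi> (\<delta> 0 y) 0 \<in> J" if y: "y \<in> carrier (P 1)" for y
    proof -
      have "\<delta> 0 y \<in> carrier (P 0)" using module_homD(1)[OF \<delta>_hom[of 0]] y by simp
      then show ?thesis using complex0[OF y] \<epsilon>\<psi> coset_zero_iff[OF J \<psi>R] by metis
    qed
    show "\<exists>x\<in>carrier (P 1). \<delta> 0 x = r \<odot>\<^bsub>P 0\<^esub> p0" if r: "r \<in> J" for r
    proof (rule exact0)
      have rR: "r \<in> poly_over {..<N}" using r ideal_mpolyD[OF J] by blast
      then show "r \<odot>\<^bsub>P 0\<^esub> p0 \<in> carrier (P 0)"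
        using p0 by (intro smult_carrier[OF mod]) (simp_all add: carrier_mpoly_ring)
      have "\<epsilon> (r \<odot>\<^bsub>P 0\<^esub> p0) = J +>\<^bsub>R\<^esub> r"
        using module_homD(3)[OF \<epsilon>_hom, of r p0] rR p0 quotient_smult[OF J, of r 1]
        by (simp add: carrier_mpoly_ring poly_over_1)
      then show "\<epsilon> (r \<odot>\<^bsub>P 0\<^esub> p0) = \<zero>\<^bsub>quotient_module R J\<^esub>" using coset_zero_iff[OF J rR] r by simp
    qed
  qed
qed

text \<open>
  Here \<open>\<delta> 0\<close> is injective on the projective module \<open>P 1\<close>. Let \<open>x\<^sub>a\<close> and \<open>x\<^sub>b\<close> be the preimages of
  \<open>a p0\<close> and \<open>b p0\<close>. Then \<open>b x\<^sub>a = a x\<^sub>b\<close>, and comparing coordinates, regularity of \<open>(a, b)\<close> gives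
  \<open>x\<^sub>a = a y\<close>. Applying \<open>\<psi>\<close> and cancelling \<open>a\<close> shows \<open>\<psi> p0 = \<psi> (\<delta> 0 y) \<in> J\<close>, while \<open>1 - \<psi> p0 \<in> J\<close>.
\<close>

lemma one_in_ideal_if_short_resolution:
  assumes zero: "carrier (P 2) = {\<zero>\<^bsub>P 2\<^esub>}"
    and ab: "a \<in> J" "b \<in> J" "a \<noteq> 0" "\<And>v. a dvd b * v \<Longrightarrow> a dvd v"
  shows "1 \<in> J"
proof -
  obtain p0 \<psi> where p0: "p0 \<in> carrier (P 0)"
    and \<psi>: "\<psi> \<in> module_hom R (P 0) (fun_module (vecs N 1))" and one: "1 - \<psi> p0 0 \<in> J"
    and \<psi>\<delta>: "\<And>y. y \<in> carrier (P 1) \<Longrightarrow> \<psi> (\<delta> 0 y) 0 \<in> J"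
    and lift: "\<And>r. r \<in> J \<Longrightarrow> \<exists>x\<in>carrier (P 1). \<delta> 0 x = r \<odot>\<^bsub>P 0\<^esub> p0"
    using augmentation_lift by blast
  obtain xa where xa: "xa \<in> carrier (P 1)" "\<delta> 0 xa = a \<odot>\<^bsub>P 0\<^esub> p0" using lift[OF ab(1)] by blast
  obtain xb where xb: "xb \<in> carrier (P 1)" "\<delta> 0 xb = b \<odot>\<^bsub>P 0\<^esub> p0" using lift[OF ab(2)] by blast
  note hom0 = \<delta>_hom[of 0, unfolded One_nat_def[symmetric]]
  have aR: "a \<in> carrier R" "b \<in> carrier R" using ideal_mpolyD[OF J] ab by (auto simp: carrier_mpoly_ring)
  have "b \<odot>\<^bsub>P 1\<^esub> xa = a \<odot>\<^bsub>P 1\<^esub> xb"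
  proof (rule \<delta>_injective[of 0, unfolded One_nat_def[symmetric] Suc_1])
    show "carrier (P 2) = {\<zero>\<^bsub>P 2\<^esub>}" by (rule zero)
    show "b \<odot>\<^bsub>P 1\<^esub> xa \<in> carrier (P 1)" "a \<odot>\<^bsub>P 1\<^esub> xb \<in> carrier (P 1)"
      using aR xa xb by (auto intro!: smult_carrier[OF mod])
    have "\<delta> 0 (b \<odot>\<^bsub>P 1\<^esub> xa) = (b * a) \<odot>\<^bsub>P 0\<^esub> p0"
      using module_homD(3)[OF hom0 aR(2) xa(1)] xa(2) module.smult_assoc1[OF mod aR(2,1) p0] by simp
    moreover have "\<delta> 0 (a \<odot>\<^bsub>P 1\<^esub> xb) = (a * b) \<odot>\<^bsub>P 0\<^esub> p0"
      using module_homD(3)[OF hom0 aR(1) xb(1)] xb(2) module.smult_assoc1[OF mod aR(1,2) p0] by simp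
    ultimately show "\<delta> 0 (b \<odot>\<^bsub>P 1\<^esub> xa) = \<delta> 0 (a \<odot>\<^bsub>P 1\<^esub> xb)" by (simp add: mult.commute)
  qed
  moreover obtain w :: "(nat \<Rightarrow> 'k mpoly) \<Rightarrow> nat \<Rightarrow> 'k mpoly" and c where db: "dual_basis R (P 1) w c"
    using dual_basis_if_projective[OF projective] by blast
  ultimately have "(\<lambda>\<beta>. b * c xa \<beta>) = (\<lambda>\<beta>. a * c xb \<beta>)"
    using dual_basisD(5)[OF db aR(2) xa(1)] dual_basisD(5)[OF db aR(1) xb(1)] by simp
  then have "b * c xa \<beta> = a * c xb \<beta>" for \<beta> by (rule fun_cong)
  then have "a dvd b * c xa \<beta>" for \<beta> by (metis dvd_triv_left)
  then have "a dvd c xa \<beta>" for \<beta> using ab(4) by blast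
  then have "\<forall>\<beta>. \<exists>d. c xa \<beta> = a * d" by (auto simp: dvd_def)
  then obtain d where d: "\<And>\<beta>. c xa \<beta> = a * d \<beta>" by metis
  note cxa = dual_basisD(2,3)[OF db xa(1)] and w = dual_basisD(1)[OF db]
  have "{\<beta>. d \<beta> \<noteq> 0} = {\<beta>. c xa \<beta> \<noteq> 0}" using d ab(3) by auto
  moreover have "d \<beta> \<in> poly_over {..<N}" for \<beta>
  proof (cases "d \<beta> = 0")
    case False
    then show ?thesis
      using poly_over_if_factor[of a "d \<beta>"] d[of \<beta>] ab(3) cxa(1) by (simp add: finitely_supported_mpoly)
         (metis mult_eq_0_iff)
  qed (simp add: poly_over_0)
  ultimately have fd: "finitely_supported R d" using cxa(1) by (simp add: finitely_supported_mpoly)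
  let ?y = "lincomb R (P 1) w d"
  have y: "?y \<in> carrier (P 1)" by (rule lincomb_closed[OF mod w fd])
  have "c xa = (\<lambda>\<beta>. a * d \<beta>)" using d by auto
  then have "xa = a \<odot>\<^bsub>P 1\<^esub> ?y"
    using cxa(2) lincomb_smult[OF mod w fd aR(1)] by simp
  then have "a \<odot>\<^bsub>P 0\<^esub> p0 = a \<odot>\<^bsub>P 0\<^esub> \<delta> 0 ?y"
    using module_homD(3)[OF hom0 aR(1) y] xa(2) by simp
  then have "(\<lambda>i. a * \<psi> p0 i) = (\<lambda>i. a * \<psi> (\<delta> 0 ?y) i)"
    using module_homD(3)[OF \<psi> aR(1) p0] module_homD(3)[OF \<psi> aR(1) module_homD(1)[OF hom0 y]] by simp
  then have eq: "\<psi> p0 0 = \<psi> (\<delta> 0 ?y) 0" using ab(3) by (metis mult_left_cancel)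
  have "(1 - \<psi> p0 0) + \<psi> p0 0 \<in> J" using ideal_mpolyD[OF J] one \<psi>\<delta>[OF y] eq by metis
  then show ?thesis by simp
qed

end

theorem proj_dim_ge_2:
  fixes J :: "'k::field mpoly set"
  assumes J: "ideal J (mpoly_ring N)" "1 \<notin> J"
    and ab: "a \<in> J" "b \<in> J" "a \<noteq> 0" "\<And>v. a dvd b * v \<Longrightarrow> a dvd v"
  shows "2 \<le> proj_dim (mpoly_ring N) (quotient_module (mpoly_ring N) J)"
proof (rule ccontr)
  assume "\<not> ?thesis"
  then have "proj_dim (mpoly_ring N) (quotient_module (mpoly_ring N) J) \<le> enat 1"
    by (cases "proj_dim (mpoly_ring N) (quotient_module (mpoly_ring N) J)") (auto simp: numeral_eq_enat)
  then obtain P :: "nat \<Rightarrow> ('k mpoly, nat \<Rightarrow> 'k mpoly) module" and \<delta> \<epsilon>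
    where *: "projective_resolution (mpoly_ring N) (quotient_module (mpoly_ring N) J) P \<delta> \<epsilon>"
      "\<forall>i>1. carrier (P i) = {\<zero>\<^bsub>P i\<^esub>}"
    using proj_dim_leD by blast
  interpret quotient_resolution N J P \<delta> \<epsilon> by (rule quotient_resolution.intro[OF J(1) *(1)])
  show False using one_in_ideal_if_short_resolution[OF _ ab] assms(2) *(2) by simp
qed

text \<open>
  Let \<open>\<phi>\<close> and \<open>\<psi>\<close> be comparison maps between the free resolution and \<open>P\<close> in both directions.
  Since \<open>\<delta> 1\<close> is injective, \<open>\<phi>\<close> restricts to a map \<open>\<phi>2\<close> from the syzygies \<open>Z\<close> to \<open>P 2\<close>, and \<open>\<psi>\<close>
  induces a map \<open>\<psi>2\<close> back. The composite of comparison maps is homotopic to the identity;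
  as \<open>Z\<close> consists of cycles, only one part of the homotopy is visible on it, namely
  \<open>z = \<psi>2 (\<phi>2 z) + s1 z\<close> with \<open>s1\<close> mapping \<open>R\<^sup>m\<close> to \<open>Z\<close>. So \<open>Z\<close> is a direct summand of \<open>P 2 \<oplus> R\<^sup>m\<close>.
\<close>

lemma (in quotient_resolution) syz_dual_basis_if_short_resolution:
  assumes zero: "carrier (P 3) = {\<zero>\<^bsub>P 3\<^esub>}"
    and Jfs: "J = dotp fs ` vecs N (length fs)"
  shows "\<exists>(w :: (nat \<Rightarrow> 'k mpoly) + nat \<Rightarrow> _) c. dual_basis R (fun_module (syz N fs)) w c"
proof -
  let ?F = "fun_module (vecs N (length fs)) :: ('k mpoly, nat \<Rightarrow> 'k mpoly) module"
  let ?Z = "fun_module (syz N fs)"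
  note mF = module_fun_module[OF submod_vecs, of N "length fs"] and mZ = module_fun_module[OF submod_syz, of N fs]
  obtain p0 \<psi>0 where p0: "p0 \<in> carrier (P 0)"
    and \<psi>0: "\<psi>0 \<in> module_hom R (P 0) (fun_module (vecs N 1))" and one: "1 - \<psi>0 p0 0 \<in> J"
    and \<psi>0\<delta>: "\<And>y. y \<in> carrier (P 1) \<Longrightarrow> \<psi>0 (\<delta> 0 y) 0 \<in> J"
    and lift: "\<And>r. r \<in> J \<Longrightarrow> \<exists>x\<in>carrier (P 1). \<delta> 0 x = r \<odot>\<^bsub>P 0\<^esub> p0"
    using augmentation_lift by blast
  have dotpJ: "dotp fs u \<in> J" if "u \<in> vecs N (length fs)" for u using that Jfs by blast
  have dotpR: "dotp fs u \<in> poly_over {..<N}" if "u \<in> vecs N (length fs)" for u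
    using dotpJ[OF that] ideal_mpolyD[OF J] by blast
  note hom0 = \<delta>_hom[of 0, unfolded One_nat_def[symmetric]]
    and hom1 = \<delta>_hom[of 1, unfolded Suc_1]
  note inj1 = \<delta>_injective[of 1, unfolded Suc_1 eval_nat_numeral(3)[symmetric], OF zero]
  obtain \<sigma> where \<sigma>: "\<sigma> \<in> vecs N (length fs)" "dotp fs \<sigma> = 1 - \<psi>0 p0 0"
    using one unfolding Jfs by (elim imageE) simp

  have "\<exists>\<phi>\<in>module_hom R ?F (P 1). \<forall>u\<in>carrier ?F. \<delta> 0 (\<phi> u) = dotp fs u \<odot>\<^bsub>P 0\<^esub> p0"
  proof (rule linear_selection[OF mF mod dual_basis_vecs])
    show "\<delta> 0 \<zero>\<^bsub>P 1\<^esub> = dotp fs \<zero>\<^bsub>?F\<^esub> \<odot>\<^bsub>P 0\<^esub> p0"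
      using module_hom_zero[OF mod mod hom0] smult_ring_zero[OF mod p0] by (simp add: dotp_zero)
    fix x y x' y' assume *: "x \<in> carrier ?F" "x' \<in> carrier ?F" "y \<in> carrier (P 1)" "y' \<in> carrier (P 1)"
      "\<delta> 0 y = dotp fs x \<odot>\<^bsub>P 0\<^esub> p0" "\<delta> 0 y' = dotp fs x' \<odot>\<^bsub>P 0\<^esub> p0"
    then show "\<delta> 0 (y \<oplus>\<^bsub>P 1\<^esub> y') = dotp fs (x \<oplus>\<^bsub>?F\<^esub> x') \<odot>\<^bsub>P 0\<^esub> p0"
      using module_homD(2)[OF hom0 *(3,4)] module.smult_l_distr[OF mod, of "dotp fs x" "dotp fs x'" p0 0] p0 dotpR
      by (simp add: dotp_add carrier_mpoly_ring)
  next
    fix a x y assume *: "a \<in> carrier R" "x \<in> carrier ?F" "y \<in> carrier (P 1)" "\<delta> 0 y = dotp fs x \<odot>\<^bsub>P 0\<^esub> p0"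
    then show "\<delta> 0 (a \<odot>\<^bsub>P 1\<^esub> y) = dotp fs (a \<odot>\<^bsub>?F\<^esub> x) \<odot>\<^bsub>P 0\<^esub> p0"
      using module_homD(3)[OF hom0 *(1,3)] module.smult_assoc1[OF mod *(1), of "dotp fs x" p0 0] p0 dotpR
      by (simp add: dotp_smult carrier_mpoly_ring)
  next
    show "\<exists>y\<in>carrier (P 1). \<delta> 0 y = dotp fs u \<odot>\<^bsub>P 0\<^esub> p0" if "u \<in> carrier ?F" for u
      using lift[OF dotpJ] that by simp
  qed
  then obtain \<phi>1 where \<phi>1: "\<phi>1 \<in> module_hom R ?F (P 1)"
    "\<And>u. u \<in> vecs N (length fs) \<Longrightarrow> \<delta> 0 (\<phi>1 u) = dotp fs u \<odot>\<^bsub>P 0\<^esub> p0" by auto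

  obtain w1 :: "(nat \<Rightarrow> 'k mpoly) \<Rightarrow> nat \<Rightarrow> 'k mpoly" and c1 where db1: "dual_basis R (P 1) w1 c1"
    using dual_basis_if_projective[OF projective] by blast
  have "\<exists>\<psi>\<in>module_hom R (P 1) ?F. \<forall>x\<in>carrier (P 1). \<psi>0 (\<delta> 0 x) 0 = dotp fs (\<psi> x)"
  proof (rule linear_selection[OF mod mF db1])
    show "\<psi>0 (\<delta> 0 \<zero>\<^bsub>P 1\<^esub>) 0 = dotp fs \<zero>\<^bsub>?F\<^esub>"
      using module_hom_zero[OF mod mod hom0] module_hom_zero[OF mod module_fun_module[OF submod_vecs] \<psi>0]
      by (simp add: dotp_zero)
    fix x y x' y' assume *: "x \<in> carrier (P 1)" "x' \<in> carrier (P 1)" "y \<in> carrier ?F" "y' \<in> carrier ?F"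
      "\<psi>0 (\<delta> 0 x) 0 = dotp fs y" "\<psi>0 (\<delta> 0 x') 0 = dotp fs y'"
    then show "\<psi>0 (\<delta> 0 (x \<oplus>\<^bsub>P 1\<^esub> x')) 0 = dotp fs (y \<oplus>\<^bsub>?F\<^esub> y')"
      using module_homD(2)[OF hom0 *(1,2)] module_homD(2)[OF \<psi>0 module_homD(1)[OF hom0 *(1)] module_homD(1)[OF hom0 *(2)]]
      by (simp add: dotp_add)
  next
    fix a x y assume *: "a \<in> carrier R" "x \<in> carrier (P 1)" "y \<in> carrier ?F" "\<psi>0 (\<delta> 0 x) 0 = dotp fs y"
    then show "\<psi>0 (\<delta> 0 (a \<odot>\<^bsub>P 1\<^esub> x)) 0 = dotp fs (a \<odot>\<^bsub>?F\<^esub> y)"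
      using module_homD(3)[OF hom0 *(1,2)] module_homD(3)[OF \<psi>0 *(1) module_homD(1)[OF hom0 *(2)]]
      by (simp add: dotp_smult)
  next
    show "\<exists>y\<in>carrier ?F. \<psi>0 (\<delta> 0 x) 0 = dotp fs y" if "x \<in> carrier (P 1)" for x
      using \<psi>0\<delta>[OF that] unfolding Jfs by auto
  qed
  then obtain \<psi>1 where \<psi>1: "\<psi>1 \<in> module_hom R (P 1) ?F"
    "\<And>x. x \<in> carrier (P 1) \<Longrightarrow> dotp fs (\<psi>1 x) = \<psi>0 (\<delta> 0 x) 0" by auto

  have syz_vecs: "z \<in> vecs N (length fs)" "dotp fs z = 0" if "z \<in> syz N fs" for z
    using that by (auto simp: syz_def)
  have "\<forall>z. \<exists>y. z \<in> syz N fs \<longrightarrow> y \<in> carrier (P 2) \<and> \<delta> 1 y = \<phi>1 z"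
  proof (intro allI)
    fix z
    show "\<exists>y. z \<in> syz N fs \<longrightarrow> y \<in> carrier (P 2) \<and> \<delta> 1 y = \<phi>1 z"
    proof (cases "z \<in> syz N fs")
      case True
      have "\<phi>1 z \<in> carrier (P 1)" using module_homD(1)[OF \<phi>1(1)] syz_vecs(1)[OF True] by simp
      moreover have "\<delta> 0 (\<phi>1 z) = \<zero>\<^bsub>P 0\<^esub>"
        using \<phi>1(2)[OF syz_vecs(1)[OF True]] syz_vecs(2)[OF True] smult_ring_zero[OF mod p0] by simp
      ultimately obtain y where "y \<in> carrier (P 2)" "\<delta> 1 y = \<phi>1 z"
        using exact[of "\<phi>1 z" 0, unfolded One_nat_def[symmetric] Suc_1] by blast
      then show ?thesis by blast
    qed simp
  qed
  then obtain \<phi>2 where \<phi>2: "\<And>z. z \<in> syz N fs \<Longrightarrow> \<phi>2 z \<in> carrier (P 2)" "\<And>z. z \<in> syz N fs \<Longrightarrow> \<delta> 1 (\<phi>2 z) = \<phi>1 z"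
    by metis
  have \<phi>2_hom: "\<phi>2 \<in> module_hom R ?Z (P 2)"
  proof -
    interpret P2: abelian_group "P 2" using mod[of 2] by (simp add: module_def)
    have "\<phi>2 (\<lambda>i. u i + v i) = \<phi>2 u \<oplus>\<^bsub>P 2\<^esub> \<phi>2 v" if uv: "u \<in> syz N fs" "v \<in> syz N fs" for u v
    proof (rule inj1)
      have s: "(\<lambda>i. u i + v i) \<in> syz N fs" by (rule submodD(3)[OF submod_syz uv])
      show "\<phi>2 (\<lambda>i. u i + v i) \<in> carrier (P 2)" "\<phi>2 u \<oplus>\<^bsub>P 2\<^esub> \<phi>2 v \<in> carrier (P 2)"
        using \<phi>2(1) s uv by auto
      show "\<delta> 1 (\<phi>2 (\<lambda>i. u i + v i)) = \<delta> 1 (\<phi>2 u \<oplus>\<^bsub>P 2\<^esub> \<phi>2 v)"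
        using \<phi>2(2)[OF s] module_homD(2)[OF hom1 \<phi>2(1)[OF uv(1)] \<phi>2(1)[OF uv(2)]] \<phi>2(2)[OF uv(1)] \<phi>2(2)[OF uv(2)]
          module_homD(2)[OF \<phi>1(1), of u v] syz_vecs(1)[OF uv(1)] syz_vecs(1)[OF uv(2)] by simp
    qed
    moreover have "\<phi>2 (\<lambda>i. a * u i) = a \<odot>\<^bsub>P 2\<^esub> \<phi>2 u" if a: "a \<in> carrier R" and u: "u \<in> syz N fs" for a u
    proof (rule inj1)
      have s: "(\<lambda>i. a * u i) \<in> syz N fs" using submodD(4)[OF submod_syz _ u] a by (simp add: carrier_mpoly_ring)
      show "\<phi>2 (\<lambda>i. a * u i) \<in> carrier (P 2)" by (rule \<phi>2(1)[OF s])
      show "a \<odot>\<^bsub>P 2\<^esub> \<phi>2 u \<in> carrier (P 2)" by (rule smult_carrier[OF mod a \<phi>2(1)[OF u]])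
      show "\<delta> 1 (\<phi>2 (\<lambda>i. a * u i)) = \<delta> 1 (a \<odot>\<^bsub>P 2\<^esub> \<phi>2 u)"
        using \<phi>2(2)[OF s] module_homD(3)[OF hom1 a \<phi>2(1)[OF u]] \<phi>2(2)[OF u]
          module_homD(3)[OF \<phi>1(1) a, of u] syz_vecs(1)[OF u] by simp
    qed
    ultimately show ?thesis using \<phi>2(1) by (auto simp: module_hom_def)
  qed
  define \<psi>2 where "\<psi>2 x = \<psi>1 (\<delta> 1 x)" for x
  have \<psi>2_hom: "\<psi>2 \<in> module_hom R (P 2) ?Z"
  proof -
    have "\<psi>2 x \<in> syz N fs" if x: "x \<in> carrier (P 2)" for x
    proof -
      note dx = module_homD(1)[OF hom1 x]
      have "\<delta> 0 (\<delta> 1 x) = \<zero>\<^bsub>P 0\<^esub>" using complex[of x 0] x by (simp add: numeral_2_eq_2)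
      then have "dotp fs (\<psi>1 (\<delta> 1 x)) = 0"
        using \<psi>1(2)[OF dx] module_hom_zero[OF mod module_fun_module[OF submod_vecs] \<psi>0] by simp
      then show ?thesis using module_homD(1)[OF \<psi>1(1) dx] by (simp add: syz_def \<psi>2_def)
    qed
    then show ?thesis
      using module_homD[OF hom1] module_homD[OF \<psi>1(1)] by (auto simp: module_hom_def \<psi>2_def)
  qed
  \<comment> \<open>The part of the homotopy from \<open>R\<^sup>m\<close>; the part from \<open>R\<close> is multiplication by \<open>\<sigma>\<close>.\<close>
  define s1 where "s1 u = (\<lambda>i. (u i - \<psi>1 (\<phi>1 u) i) - dotp fs u * \<sigma> i)" for u
  have \<phi>1F: "\<phi>1 u \<in> carrier (P 1)" if "u \<in> vecs N (length fs)" for u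
    using module_homD(1)[OF \<phi>1(1)] that by simp
  have s1_hom: "s1 \<in> module_hom R ?F ?Z"
  proof -
    have "s1 u \<in> syz N fs" if u: "u \<in> vecs N (length fs)" for u
    proof -
      have "dotp fs (\<psi>1 (\<phi>1 u)) = \<psi>0 (dotp fs u \<odot>\<^bsub>P 0\<^esub> p0) 0"
        using \<psi>1(2)[OF \<phi>1F[OF u]] \<phi>1(2)[OF u] by simp
      also have "\<dots> = dotp fs u * \<psi>0 p0 0"
        using module_homD(3)[OF \<psi>0 _ p0, of "dotp fs u"] dotpR[OF u] by (simp add: carrier_mpoly_ring)
      finally have "dotp fs (s1 u) = 0"
        unfolding s1_def dotp_diff dotp_smult \<sigma>(2) by (simp add: algebra_simps)
      moreover have "s1 u \<in> vecs N (length fs)"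
        using u module_homD(1)[OF \<psi>1(1) \<phi>1F[OF u]] \<sigma>(1) dotpR[OF u]
        by (auto simp: vecs_def s1_def intro!: poly_over_diff poly_over_mult)
      ultimately show ?thesis by (simp add: syz_def)
    qed
    moreover have "s1 (\<lambda>i. u i + v i) = (\<lambda>i. s1 u i + s1 v i)" if "u \<in> vecs N (length fs)" "v \<in> vecs N (length fs)" for u v
      using that module_homD(2)[OF \<phi>1(1), of u v] module_homD(2)[OF \<psi>1(1) \<phi>1F \<phi>1F, of u v]
      by (auto simp: s1_def dotp_add algebra_simps)
    moreover have "s1 (\<lambda>i. a * u i) = (\<lambda>i. a * s1 u i)" if "a \<in> carrier R" "u \<in> vecs N (length fs)" for a u
      using that module_homD(3)[OF \<phi>1(1) that(1), of u] module_homD(3)[OF \<psi>1(1) that(1) \<phi>1F[OF that(2)]]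
      by (auto simp: s1_def dotp_smult algebra_simps)
    ultimately show ?thesis by (auto simp: module_hom_def)
  qed
  obtain w2 :: "(nat \<Rightarrow> 'k mpoly) \<Rightarrow> nat \<Rightarrow> 'k mpoly" and c2 where db2: "dual_basis R (P 2) w2 c2"
    using dual_basis_if_projective[OF projective] by blast
  have incl: "(\<lambda>z. z) \<in> module_hom R ?Z ?F" using syz_vecs by (auto simp: module_hom_def)
  have "dual_basis R ?Z (case_sum (\<psi>2 \<circ> w2) (s1 \<circ> unit_vec (length fs))) (\<lambda>z. case_sum (c2 (\<phi>2 z)) z)"
  proof (rule dual_basis_retract_of_two[OF mZ mod[of 2] mF db2 dual_basis_vecs[of N "length fs"] \<phi>2_hom incl \<psi>2_hom s1_hom])
    fix z assume "z \<in> carrier ?Z"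
    then show "z = \<psi>2 (\<phi>2 z) \<oplus>\<^bsub>?Z\<^esub> s1 z"
      using \<phi>2(2)[of z] syz_vecs(2)[of z] by (simp add: \<psi>2_def s1_def)
  qed
  then show ?thesis by blast
qed

theorem syz_dual_basis_if_proj_dim_le_2:
  fixes fs :: "'k::field mpoly list"
  assumes fs: "set fs \<subseteq> poly_over {..<N}"
    and pd: "proj_dim (mpoly_ring N) (quotient_module (mpoly_ring N) (Idl\<^bsub>mpoly_ring N\<^esub> (set fs))) \<le> 2"
  shows "\<exists>(w :: (nat \<Rightarrow> 'k mpoly) + nat \<Rightarrow> _) c. dual_basis (mpoly_ring N) (fun_module (syz N fs)) w c"
proof -
  let ?J = "Idl\<^bsub>mpoly_ring N\<^esub> (set fs)"
  interpret cring "mpoly_ring N :: 'k mpoly ring" by (rule cring_mpoly_ring)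
  have J: "ideal ?J (mpoly_ring N)" using fs by (intro genideal_ideal) (simp add: carrier_mpoly_ring)
  obtain P :: "nat \<Rightarrow> ('k mpoly, nat \<Rightarrow> 'k mpoly) module" and \<delta> \<epsilon>
    where *: "projective_resolution (mpoly_ring N) (quotient_module (mpoly_ring N) ?J) P \<delta> \<epsilon>"
      "\<forall>i>2. carrier (P i) = {\<zero>\<^bsub>P i\<^esub>}"
    using proj_dim_leD[OF pd[unfolded numeral_eq_enat]] by blast
  interpret quotient_resolution N ?J P \<delta> \<epsilon> by (rule quotient_resolution.intro[OF J *(1)])
  show ?thesis by (rule syz_dual_basis_if_short_resolution[OF _ Idl_eq_dotp[OF fs]]) (use *(2) in simp)
qed

text \<open>
  The resolution is \<open>0 \<rightarrow> Z \<rightarrow> R\<^sup>m \<rightarrow> R \<rightarrow> R/J \<rightarrow> 0\<close> with \<open>Z\<close> the module of syzygies.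
\<close>

theorem proj_dim_le_2_if_syz_dual_basis:
  fixes fs :: "'k::field mpoly list"
  assumes fs: "set fs \<subseteq> poly_over {..<N}"
    and db: "dual_basis (mpoly_ring N) (fun_module (syz N fs)) (w :: 'i \<Rightarrow> _) c"
  shows "proj_dim (mpoly_ring N) (quotient_module (mpoly_ring N) (Idl\<^bsub>mpoly_ring N\<^esub> (set fs))) \<le> 2"
proof -
  let ?R = "mpoly_ring N :: 'k mpoly ring"
  let ?J = "Idl\<^bsub>mpoly_ring N\<^esub> (set fs)"
  interpret cring "mpoly_ring N :: 'k mpoly ring" by (rule cring_mpoly_ring)
  have J: "ideal ?J (mpoly_ring N)" using fs by (intro genideal_ideal) (simp add: carrier_mpoly_ring)
  have JR: "?J \<subseteq> poly_over {..<N}" using ideal_mpolyD[OF J] by blast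
  note Jfs = Idl_eq_dotp[OF fs]
  define C where "C i = (if i = 0 then vecs N 1 else if i = 1 then vecs N (length fs)
    else if i = 2 then syz N fs else vecs N 0)" for i :: nat
  define \<delta> where "\<delta> i = (if i = 0 then (\<lambda>u j. if j = 0 then dotp fs u else 0)
    else if i = 1 then (\<lambda>u. u) else (\<lambda>u j. 0))" for i :: nat
  define \<epsilon> where "\<epsilon> u = ?J +>\<^bsub>mpoly_ring N\<^esub> u 0" for u :: "nat \<Rightarrow> 'k mpoly"
  have C: "submod N (C i)" for i by (simp add: C_def submod_vecs submod_syz)
  have vecs0: "vecs N 0 = {\<lambda>_. 0 :: 'k mpoly}" by (auto simp: vecs_def poly_over_0)
  have proj: "projective_module ?R (fun_module (C i))" for i
  proof -
    have "projective_module ?R (fun_module (vecs N m))" for m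
      by (rule projective_if_dual_basis[OF module_fun_module[OF submod_vecs] dual_basis_vecs])
    moreover have "projective_module ?R (fun_module (syz N fs))"
      by (rule projective_if_dual_basis[OF module_fun_module[OF submod_syz] db])
    ultimately show ?thesis by (simp add: C_def)
  qed
  have dotpJ: "dotp fs u \<in> ?J" if "u \<in> vecs N (length fs)" for u unfolding Jfs using that by simp
  have vec1: "(\<lambda>j. if j = 0 then a else 0) \<in> vecs N 1" if "a \<in> poly_over {..<N}" for a :: "'k mpoly"
    using that by (auto simp: vecs_def poly_over_0)
  have \<delta>_hom: "\<delta> i \<in> module_hom ?R (fun_module (C (Suc i))) (fun_module (C i))" for i
  proof -
    consider "i = 0" | "i = 1" | "i \<ge> 2" by linarith
    then show ?thesis
    proof cases
      case 1
      then show ?thesis using dotpJ JR vec1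
        by (auto simp: module_hom_def C_def \<delta>_def dotp_add dotp_smult fun_eq_iff)
    next
      case 2
      then show ?thesis by (auto simp: module_hom_def C_def \<delta>_def syz_def)
    next
      case 3
      then show ?thesis using submodD(2)[OF C] by (auto simp: module_hom_def \<delta>_def)
    qed
  qed
  have \<epsilon>_hom: "\<epsilon> \<in> module_hom ?R (fun_module (C 0)) (quotient_module ?R ?J)"
    by (auto simp: module_hom_def C_def \<epsilon>_def quotient_carrier[OF J] quotient_add[OF J] quotient_smult[OF J]
        vecs_memD carrier_mpoly_ring)
  have \<epsilon>_surj: "\<epsilon> ` C 0 = carrier (quotient_module ?R ?J)"
  proof
    show "\<epsilon> ` C 0 \<subseteq> carrier (quotient_module ?R ?J)" using module_homD(1)[OF \<epsilon>_hom] by auto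
    show "carrier (quotient_module ?R ?J) \<subseteq> \<epsilon> ` C 0"
    proof
      fix x assume "x \<in> carrier (quotient_module ?R ?J)"
      then obtain a where "a \<in> poly_over {..<N}" "x = ?J +>\<^bsub>mpoly_ring N\<^esub> a"
        by (auto simp: quotient_carrier[OF J])
      then show "x \<in> \<epsilon> ` C 0"
        using vec1 by (intro image_eqI[of _ _ "\<lambda>j. if j = 0 then a else 0"]) (auto simp: \<epsilon>_def C_def)
    qed
  qed
  have ex0: "\<delta> 0 ` C 1 = {x \<in> C 0. \<epsilon> x = \<zero>\<^bsub>quotient_module ?R ?J\<^esub>}"
  proof
    show "\<delta> 0 ` C 1 \<subseteq> {x \<in> C 0. \<epsilon> x = \<zero>\<^bsub>quotient_module ?R ?J\<^esub>}"
    proof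
      fix x assume "x \<in> \<delta> 0 ` C 1"
      then obtain u where u: "u \<in> vecs N (length fs)" "x = (\<lambda>j. if j = 0 then dotp fs u else 0)"
        by (auto simp: \<delta>_def C_def)
      then have "dotp fs u \<in> ?J" "dotp fs u \<in> poly_over {..<N}" using dotpJ JR by auto
      then show "x \<in> {x \<in> C 0. \<epsilon> x = \<zero>\<^bsub>quotient_module ?R ?J\<^esub>}"
        using vec1 coset_zero_iff[OF J] u by (simp add: \<epsilon>_def C_def)
    qed
    show "{x \<in> C 0. \<epsilon> x = \<zero>\<^bsub>quotient_module ?R ?J\<^esub>} \<subseteq> \<delta> 0 ` C 1"
    proof
      fix x assume "x \<in> {x \<in> C 0. \<epsilon> x = \<zero>\<^bsub>quotient_module ?R ?J\<^esub>}"
      then have x: "x \<in> vecs N 1" "x 0 \<in> ?J"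
        using coset_zero_iff[OF J] by (auto simp: \<epsilon>_def C_def vecs_memD)
      then obtain u where u: "u \<in> vecs N (length fs)" "x 0 = dotp fs u" unfolding Jfs by auto
      have "x = \<delta> 0 u" using x(1) u(2) by (auto simp: \<delta>_def vecs_def fun_eq_iff)
      then show "x \<in> \<delta> 0 ` C 1" using u(1) by (simp add: C_def)
    qed
  qed
  have exS: "\<delta> (Suc i) ` C (Suc (Suc i)) = {x \<in> C (Suc i). \<delta> i x = (\<lambda>_. 0)}" for i
  proof -
    consider "i = 0" | "i = 1" | "i \<ge> 2" by linarith
    then show ?thesis
    proof cases
      case 1
      have "{x \<in> vecs N (length fs). \<delta> 0 x = (\<lambda>_. 0)} = syz N fs"
        by (auto simp: syz_def \<delta>_def fun_eq_iff)
      then show ?thesis using 1 by (simp add: C_def \<delta>_def)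
    next
      case 2
      then show ?thesis using submodD(2)[OF submod_syz] by (auto simp: C_def \<delta>_def vecs0)
    next
      case 3
      then show ?thesis by (auto simp: C_def \<delta>_def vecs0)
    qed
  qed
  have "projective_resolution ?R (quotient_module ?R ?J) (\<lambda>i. fun_module (C i)) \<delta> \<epsilon>"
    unfolding projective_resolution_def using proj \<delta>_hom \<epsilon>_hom \<epsilon>_surj ex0 exS by simp
  moreover have "\<forall>i>2. carrier (fun_module (C i)) = {\<zero>\<^bsub>fun_module (C i)\<^esub>}"
    using vecs0 by (simp add: C_def)
  ultimately have "proj_dim ?R (quotient_module ?R ?J) \<le> enat 2"
    unfolding proj_dim_def by (intro Inf_lower) blast
  then show ?thesis by (simp add: numeral_eq_enat)
qed

section \<open>Syzygies under base change and the perfect base ideal\<close>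

lemma dual_basis_coordinate_sum:
  assumes C: "submod N C" and db: "dual_basis (mpoly_ring N) (fun_module C) w c"
    and A: "finite A" "\<And>k. k \<in> A \<Longrightarrow> a k \<in> poly_over {..<N}" "\<And>k. k \<in> A \<Longrightarrow> z k \<in> C"
  shows "(\<lambda>i. \<Sum>k\<in>A. a k * z k i) \<in> C \<and> c (\<lambda>i. \<Sum>k\<in>A. a k * z k i) b = (\<Sum>k\<in>A. a k * c (z k) b)"
proof -
  have add: "c (\<lambda>i. x i + y i) b = c x b + c y b" if "x \<in> C" "y \<in> C" for x y
    using dual_basisD(4)[OF db, of x y] that by simp
  have smult: "c (\<lambda>i. r * x i) b = r * c x b" if "r \<in> poly_over {..<N}" "x \<in> C" for r x
    using dual_basisD(5)[OF db, of r x] that by (simp add: carrier_mpoly_ring)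
  show ?thesis
    using A
  proof (induction A rule: finite_induct)
    case empty
    show ?case using submodD(2)[OF C] smult[OF poly_over_0 submodD(2)[OF C]] by simp
  next
    case (insert k A)
    have z: "(\<lambda>i. a k * z k i) \<in> C" using insert by (intro submodD(4)[OF C]) auto
    have IH: "(\<lambda>i. \<Sum>k\<in>A. a k * z k i) \<in> C" "c (\<lambda>i. \<Sum>k\<in>A. a k * z k i) b = (\<Sum>k\<in>A. a k * c (z k) b)"
      using insert by auto
    have "c (\<lambda>i. a k * z k i + (\<Sum>k\<in>A. a k * z k i)) b = c (\<lambda>i. a k * z k i) b + c (\<lambda>i. \<Sum>k\<in>A. a k * z k i) b"
      by (rule add[OF z IH(1)])
    moreover have "c (\<lambda>i. a k * z k i) b = a k * c (z k) b"
      using insert.prems by (intro smult) auto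
    ultimately show ?case using insert submodD(3)[OF C z IH(1)] IH(2) by simp
  qed
qed

definition slice :: "nat \<Rightarrow> nat \<Rightarrow> (nat \<Rightarrow> 'k::field mpoly) \<Rightarrow> nat \<Rightarrow> 'k mpoly"
  where "slice N e u = (\<lambda>i. coeff (split_var N (u i)) e)"

lemma slice_add: "slice N e (\<lambda>i. u i + v i) = (\<lambda>i. slice N e u i + slice N e v i)"
  by (simp add: slice_def split_var_simps)

lemma slice_smult:
  "slice N e (\<lambda>i. a * u i) = (\<lambda>i. \<Sum>k\<le>e. coeff (split_var N a) k * slice N (e - k) u i)"
  by (simp add: slice_def split_var_simps coeff_mult)

lemma slice_syz:
  assumes fs: "set fs \<subseteq> poly_over {..<N}" and u: "u \<in> syz (Suc N) fs"
  shows "slice N e u \<in> syz N fs"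
proof -
  have "slice N e u \<in> vecs N (length fs)"
    using u split_var_coeff_Suc by (auto simp: slice_def syz_def vecs_def split_var_simps)
  moreover have "dotp fs (slice N e u) = coeff (split_var N (dotp fs u)) e"
  proof -
    have "split_var N (fs ! i) = [:fs ! i:]" if "i < length fs" for i
      using fs that by (intro split_var_const) auto
    then have "coeff (split_var N (u i * fs ! i)) e = slice N e u i * fs ! i" if "i < length fs" for i
      using that by (simp add: split_var_simps slice_def mult.commute)
    then show ?thesis by (simp add: dotp_def split_var_simps(8) coeff_sum)
  qed
  ultimately show ?thesis using u by (simp add: syz_def split_var_simps)
qed

lemma slice_eventually_zero:
  assumes u: "u \<in> vecs M m"
  obtains D where "\<And>e. e > D \<Longrightarrow> slice N e u = (\<lambda>_. 0)"
proof -
  let ?D = "\<Sum>i<m. degree (split_var N (u i))"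
  have "slice N e u i = 0" if e: "e > ?D" for e i
  proof (cases "i < m")
    case True
    then have "degree (split_var N (u i)) \<le> ?D" by (intro member_le_sum) auto
    then show ?thesis using e by (auto simp: slice_def intro: coeff_eq_0)
  next
    case False
    then show ?thesis using u by (simp add: slice_def vecs_def split_var_simps)
  qed
  then show thesis using that by blast
qed

text \<open>
  A vector over \<open>R[x\<^sub>N]\<close> is a syzygy of the \<open>f\<^sub>i\<close> iff all its slices are, so the syzygies over
  \<open>R[x\<^sub>N]\<close> are the polynomials in \<open>x\<^sub>N\<close> with coefficients in \<open>Z\<close>, and the coordinates on \<open>Z\<close>
  extend coefficientwise.
\<close>

theorem syz_dual_basis_base_change:
  fixes fs :: "'k::field mpoly list"
  assumes fs: "set fs \<subseteq> poly_over {..<N}"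
    and db: "dual_basis (mpoly_ring N) (fun_module (syz N fs)) (w :: 'i \<Rightarrow> _) c"
  shows "\<exists>c'. dual_basis (mpoly_ring (Suc N)) (fun_module (syz (Suc N) fs)) w c'"
proof -
  note C = submod_syz[of N fs]
  have db': "range w \<subseteq> syz N fs"
    "\<And>x b. x \<in> syz N fs \<Longrightarrow> c x b \<in> poly_over {..<N}"
    "\<And>x. x \<in> syz N fs \<Longrightarrow> finite {b. c x b \<noteq> 0}"
    "\<And>x i. x \<in> syz N fs \<Longrightarrow> x i = (\<Sum>b\<in>{b. c x b \<noteq> 0}. c x b * w b i)"
    "\<And>x y b. x \<in> syz N fs \<Longrightarrow> y \<in> syz N fs \<Longrightarrow> c (\<lambda>i. x i + y i) b = c x b + c y b"
    using db unfolding dual_basis_fun_module_iff[OF C] by auto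
  have c0: "c (\<lambda>_. 0) b = 0" for b
    using dual_basis_coordinate_sum[OF C db, of "{}" _ _ b] by simp
  define Q where "Q u b = Abs_poly (\<lambda>e. c (slice N e u) b)" for u b
  have coeff_Q: "coeff (Q u b) e = c (slice N e u) b" if u: "u \<in> syz (Suc N) fs" for u b e
  proof -
    obtain D where "\<And>e. e > D \<Longrightarrow> slice N e u = (\<lambda>_. 0)"
      using slice_eventually_zero[of u "Suc N" "length fs"] u by (auto simp: syz_def)
    then have "\<And>e. e > D \<Longrightarrow> c (slice N e u) b = 0" using c0 by simp
    from coeff_Abs_poly[OF this] show ?thesis by (simp add: Q_def)
  qed
  define c' where "c' u b = poly (Q u b) (Var N)" for u b
  have Q_in: "coeff (Q u b) e \<in> poly_over {..<N}" if "u \<in> syz (Suc N) fs" for u b e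
    using coeff_Q[OF that] db'(2)[OF slice_syz[OF fs that]] by simp
  have split_c': "split_var N (c' u b) = Q u b" if "u \<in> syz (Suc N) fs" for u b
    unfolding c'_def by (rule split_var_poly_Suc) (rule Q_in[OF that])
  have w_in: "w b \<in> syz (Suc N) fs" and w_const: "split_var N (w b i) = [:w b i:]" for b i
  proof -
    have wb: "w b \<in> syz N fs" using db'(1) by auto
    then show "w b \<in> syz (Suc N) fs" by (auto simp: syz_def vecs_def intro: poly_over_le)
    show "split_var N (w b i) = [:w b i:]" using wb by (intro split_var_const) (auto simp: syz_def vecs_def)
  qed
  have fin: "finite {b. c' u b \<noteq> 0}" if u: "u \<in> syz (Suc N) fs" for u
  proof -
    obtain D where D: "\<And>e. e > D \<Longrightarrow> slice N e u = (\<lambda>_. 0)"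
      using slice_eventually_zero[of u "Suc N" "length fs"] u by (auto simp: syz_def)
    have "{b. c' u b \<noteq> 0} \<subseteq> (\<Union>e\<le>D. {b. c (slice N e u) b \<noteq> 0})"
    proof
      fix b assume "b \<in> {b. c' u b \<noteq> 0}"
      then have "Q u b \<noteq> 0" by (auto simp: c'_def)
      then obtain e where e: "c (slice N e u) b \<noteq> 0" using coeff_Q[OF u] by (metis leading_coeff_0_iff)
      then have "e \<le> D" using D[of e] c0 by (metis linorder_not_less)
      then show "b \<in> (\<Union>e\<le>D. {b. c (slice N e u) b \<noteq> 0})" using e by blast
    qed
    moreover have "finite (\<Union>e\<le>D. {b. c (slice N e u) b \<noteq> 0})"
      using db'(3)[OF slice_syz[OF fs u]] by auto
    ultimately show ?thesis using finite_subset by blast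
  qed
  have "u i = (\<Sum>b\<in>{b. c' u b \<noteq> 0}. c' u b * w b i)" if u: "u \<in> syz (Suc N) fs" for u i
  proof -
    have "coeff (split_var N (\<Sum>b\<in>{b. c' u b \<noteq> 0}. c' u b * w b i)) e
        = coeff (split_var N (u i)) e" for e
    proof -
      have "coeff (split_var N (\<Sum>b\<in>{b. c' u b \<noteq> 0}. c' u b * w b i)) e
          = (\<Sum>b\<in>{b. c' u b \<noteq> 0}. c (slice N e u) b * w b i)"
        using coeff_Q[OF u] split_c'[OF u] w_const
        by (simp add: split_var_simps(3,8) coeff_sum mult.commute)
      also have "\<dots> = (\<Sum>b\<in>{b. c (slice N e u) b \<noteq> 0}. c (slice N e u) b * w b i)"
      proof (rule sum.mono_neutral_right)
        show "{b. c (slice N e u) b \<noteq> 0} \<subseteq> {b. c' u b \<noteq> 0}"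
          using coeff_Q[OF u] split_c'[OF u] by (auto simp: split_var_simps(4)) (metis coeff_0 split_var_simps(4))
      qed (use fin[OF u] in auto)
      also have "\<dots> = slice N e u i" using db'(4)[OF slice_syz[OF fs u]] by metis
      finally show ?thesis by (simp add: slice_def)
    qed
    then have "split_var N (\<Sum>b\<in>{b. c' u b \<noteq> 0}. c' u b * w b i) = split_var N (u i)" by (rule poly_eqI)
    then show ?thesis by (simp add: split_var_inject)
  qed
  moreover have "c' (\<lambda>i. u i + v i) b = c' u b + c' v b"
    if uv: "u \<in> syz (Suc N) fs" "v \<in> syz (Suc N) fs" for u v b
  proof -
    have "Q (\<lambda>i. u i + v i) b = Q u b + Q v b"
      using coeff_Q[OF submodD(3)[OF submod_syz uv]] coeff_Q[OF uv(1)] coeff_Q[OF uv(2)]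
        db'(5)[OF slice_syz[OF fs uv(1)] slice_syz[OF fs uv(2)]]
      by (intro poly_eqI) (simp add: slice_add)
    then show ?thesis by (simp add: c'_def)
  qed
  moreover have "c' (\<lambda>i. a * u i) b = a * c' u b"
    if a: "a \<in> poly_over {..<Suc N}" and u: "u \<in> syz (Suc N) fs" for a u b
  proof -
    have "Q (\<lambda>i. a * u i) b = split_var N a * Q u b"
    proof (rule poly_eqI)
      fix e
      have "coeff (Q (\<lambda>i. a * u i) b) e
          = c (\<lambda>i. \<Sum>k\<le>e. coeff (split_var N a) k * slice N (e - k) u i) b"
        by (simp only: coeff_Q[OF submodD(4)[OF submod_syz a u]] slice_smult)
      also have "\<dots> = (\<Sum>k\<le>e. coeff (split_var N a) k * c (slice N (e - k) u) b)"
        by (rule conjunct2[OF dual_basis_coordinate_sum[OF C db]])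
           (use split_var_coeff_Suc[OF a] slice_syz[OF fs u] in auto)
      finally show "coeff (Q (\<lambda>i. a * u i) b) e = coeff (split_var N a * Q u b) e"
        by (simp add: coeff_mult coeff_Q[OF u])
    qed
    then show ?thesis by (simp add: c'_def)
  qed
  moreover have "c' u b \<in> poly_over {..<Suc N}" if "u \<in> syz (Suc N) fs" for u b
    unfolding c'_def by (rule poly_in_poly_over_Suc) (rule Q_in[OF that])
  ultimately have "dual_basis (mpoly_ring (Suc N)) (fun_module (syz (Suc N) fs)) w c'"
    unfolding dual_basis_fun_module_iff[OF submod_syz] using fin w_in
    by (intro conjI ballI allI subsetI) auto
  then show ?thesis by blast
qed

definition monoid_forms :: "'k::field mpoly list \<Rightarrow> 'k mpoly \<Rightarrow> 'k mpoly \<Rightarrow> 'k mpoly list"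
  where "monoid_forms fs f g = map (\<lambda>h. h * f) fs @ [g]"

lemma dotp_monoid_forms:
  "dotp (monoid_forms fs f g) u = f * dotp fs u + u (length fs) * g"
  by (simp add: dotp_def monoid_forms_def nth_append sum_distrib_left algebra_simps)

lemma dotp_cong: "(\<And>i. i < length fs \<Longrightarrow> u i = v i) \<Longrightarrow> dotp fs u = dotp fs v"
  by (simp add: dotp_def)

text \<open>
  If \<open>v\<close> is a syzygy of \<open>f\<^sub>0 f, \<dots>, f\<^sub>m\<^sub>-\<^sub>1 f, g\<close>, its last entry is \<open>q f\<close> for some \<open>q\<close>, and
  subtracting \<open>q (-\<gamma>\<^sub>0, \<dots>, -\<gamma>\<^sub>m\<^sub>-\<^sub>1, f)\<close> leaves a syzygy of the \<open>f\<^sub>i\<close>, extended by \<open>0\<close>.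
\<close>

theorem syz_dual_basis_monoid_forms:
  fixes fs :: "'k::field mpoly list"
  assumes f: "f \<in> poly_over {..<N}" "f \<noteq> 0" and \<gamma>: "\<gamma> \<in> vecs N (length fs)" "g = dotp fs \<gamma>"
    and coprime: "\<And>v. f dvd g * v \<Longrightarrow> f dvd v"
    and db: "dual_basis (mpoly_ring N) (fun_module (syz N fs)) (w :: 'i \<Rightarrow> _) c"
  shows "\<exists>(w' :: 'i + nat \<Rightarrow> _) c'. dual_basis (mpoly_ring N) (fun_module (syz N (monoid_forms fs f g))) w' c'"
proof -
  let ?m = "length fs" and ?gs = "monoid_forms fs f g"
  let ?Z = "fun_module (syz N ?gs)" and ?P = "fun_module (syz N fs)" and ?Q = "fun_module (vecs N 1)"
  have len: "length ?gs = Suc ?m" by (simp add: monoid_forms_def)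
  have ex: "\<exists>q. v ?m = f * q" if v: "v \<in> syz N ?gs" for v
  proof -
    have "f * dotp fs v + v ?m * g = 0" using v by (simp add: syz_def dotp_monoid_forms)
    then have "g * v ?m = f * (- dotp fs v)" by (simp add: eq_neg_iff_add_eq_0 mult.commute add.commute)
    then have "f dvd v ?m" by (metis coprime dvd_triv_left)
    then show ?thesis by (elim dvdE) blast
  qed
  define q where "q v = (SOME q. v ?m = f * q)" for v
  have q: "v ?m = f * q v" if "v \<in> syz N ?gs" for v
    unfolding q_def by (rule someI_ex[OF ex[OF that]])
  have q_unique: "q v = r" if "v \<in> syz N ?gs" "v ?m = f * r" for v r
    using q[OF that(1)] that(2) f(2) by simp
  have vR: "v i \<in> poly_over {..<N}" if "v \<in> syz N ?gs" for v i using that by (simp add: syz_def vecs_def)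
  have qR: "q v \<in> poly_over {..<N}" if v: "v \<in> syz N ?gs" for v
  proof (cases "q v = 0")
    case False
    then show ?thesis using poly_over_if_factor[of f "q v"] q[OF v] vR[OF v, of ?m] f(2) by simp
  qed (simp add: poly_over_0)
  define \<phi> where "\<phi> v = (\<lambda>i. if i < ?m then v i + q v * \<gamma> i else 0)" for v
  define \<phi>' where "\<phi>' v = (\<lambda>i::nat. if i = 0 then q v else 0)" for v
  define \<psi>' where "\<psi>' s = (\<lambda>i. if i < ?m then - s 0 * \<gamma> i else if i = ?m then f * s 0 else 0)"
    for s :: "nat \<Rightarrow> 'k mpoly"
  have q_add: "q (\<lambda>i. u i + v i) = q u + q v" if "u \<in> syz N ?gs" "v \<in> syz N ?gs" for u v
    by (rule q_unique[OF submodD(3)[OF submod_syz that]]) (simp add: q that distrib_left)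
  have q_smult: "q (\<lambda>i. a * u i) = a * q u" if "a \<in> poly_over {..<N}" "u \<in> syz N ?gs" for a u
    by (rule q_unique[OF submodD(4)[OF submod_syz that]]) (simp add: q that mult.left_commute)
  have \<phi>: "\<phi> \<in> module_hom (mpoly_ring N) ?Z ?P"
  proof -
    have "\<phi> v \<in> syz N fs" if v: "v \<in> syz N ?gs" for v
    proof -
      have "dotp fs (\<phi> v) = dotp fs (\<lambda>i. v i + q v * \<gamma> i)" by (rule dotp_cong) (simp add: \<phi>_def)
      also have "\<dots> = dotp fs v + q v * g" by (simp add: dotp_add dotp_smult \<gamma>(2))
      finally have "f * dotp fs (\<phi> v) = f * dotp fs v + v ?m * g" by (simp add: q[OF v] algebra_simps)
      also have "\<dots> = 0" using v by (simp add: syz_def dotp_monoid_forms)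
      finally have "dotp fs (\<phi> v) = 0" using f(2) by simp
      then show ?thesis using vR[OF v] qR[OF v] vecs_memD[OF \<gamma>(1)]
        by (auto simp: syz_def vecs_def \<phi>_def poly_over_0 intro!: poly_over_add poly_over_mult)
    qed
    then show ?thesis
      by (auto simp: module_hom_def \<phi>_def q_add q_smult carrier_mpoly_ring fun_eq_iff algebra_simps)
  qed
  have \<phi>': "\<phi>' \<in> module_hom (mpoly_ring N) ?Z ?Q"
    using qR by (auto simp: module_hom_def \<phi>'_def q_add q_smult carrier_mpoly_ring vecs_def poly_over_0)
  have \<psi>: "(\<lambda>z. z) \<in> module_hom (mpoly_ring N) ?P ?Z"
    by (auto simp: module_hom_def syz_def dotp_monoid_forms len vecs_def)
  have \<psi>': "\<psi>' \<in> module_hom (mpoly_ring N) ?Q ?Z"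
  proof -
    have "\<psi>' s \<in> syz N ?gs" if s: "s \<in> vecs N 1" for s
    proof -
      have "dotp fs (\<psi>' s) = dotp fs (\<lambda>i. - s 0 * \<gamma> i)" by (rule dotp_cong) (simp add: \<psi>'_def)
      also have "\<dots> = - s 0 * g" unfolding dotp_smult \<gamma>(2) ..
      finally have "dotp ?gs (\<psi>' s) = 0" by (simp add: dotp_monoid_forms \<psi>'_def)
      then show ?thesis using vecs_memD[OF s] vecs_memD[OF \<gamma>(1)] f(1)
        by (auto simp: syz_def vecs_def len \<psi>'_def poly_over_0 intro!: poly_over_mult poly_over_uminus)
    qed
    then show ?thesis by (auto simp: module_hom_def \<psi>'_def fun_eq_iff algebra_simps)
  qed
  have "dual_basis (mpoly_ring N) ?Z (case_sum ((\<lambda>z. z) \<circ> w) (\<psi>' \<circ> unit_vec 1)) (\<lambda>z. case_sum (c (\<phi> z)) (\<phi>' z))"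
  proof (rule dual_basis_retract_of_two[OF module_fun_module[OF submod_syz] module_fun_module[OF submod_syz]
        module_fun_module[OF submod_vecs] db dual_basis_vecs \<phi> \<phi>' \<psi> \<psi>'])
    fix z assume z: "z \<in> carrier ?Z"
    then have "z i = 0" if "i > ?m" for i using that by (simp add: syz_def vecs_def len)
    then show "z = \<phi> z \<oplus>\<^bsub>?Z\<^esub> \<psi>' (\<phi>' z)"
      using q[of z] z by (auto simp: \<phi>_def \<phi>'_def \<psi>'_def fun_eq_iff)
  qed
  then show ?thesis by blast
qed

lemma height_attained:
  assumes "height R J = enat h"
  shows "\<exists>P. primeideal P R \<and> J \<subseteq> P \<and> prime_height R P = enat h"
proof -
  let ?A = "{prime_height R P |P. primeideal P R \<and> J \<subseteq> P}"
  have "?A \<noteq> {}"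
  proof
    assume "?A = {}"
    then have "height R J = \<infinity>" unfolding height_def by (simp only: Inf_enat_def) simp
    then show False using assms by simp
  qed
  then have "Inf ?A \<in> ?A" unfolding Inf_enat_def by (metis (no_types, lifting) LeastI ex_in_conv)
  then show ?thesis using assms unfolding height_def by auto
qed

text \<open>
  Upper bounds come from \<open>I\<close>: its syzygies control the projective dimension and a prime of
  height \<open>2\<close> over it controls the height. The lower bounds come from a regular sequence
  \<open>(g, b)\<close> in \<open>J\<close>. It exists since a common prime factor of \<open>J\<close> would divide \<open>g\<close>, hence not \<open>f\<close>,
  hence all \<open>f\<^sub>i\<close>.
\<close>

theorem perfect_codim2_monoid_forms:
  fixes fs :: "'k::field mpoly list"
  assumes can: "canonical_restrictions n d fs"
    and f: "f \<in> poly_over {..<n}" "f \<noteq> 0"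
    and g: "g \<in> Idl\<^bsub>mpoly_ring (Suc n)\<^esub> (base_ideal n fs)" "g \<noteq> 0"
    and gcd: "gcd_is_one (mpoly_ring (Suc n)) {f, g}"
    and perf: "perfect_codim2 (mpoly_ring n) (base_ideal n fs)"
  shows "perfect_codim2 (mpoly_ring (Suc n)) (base_ideal (Suc n) (monoid_forms fs f g))"
proof -
  let ?R = "mpoly_ring n :: 'k mpoly ring" and ?S = "mpoly_ring (Suc n) :: 'k mpoly ring"
  interpret R: cring ?R by (rule cring_mpoly_ring)
  interpret S: cring ?S by (rule cring_mpoly_ring)
  let ?I = "base_ideal n fs" and ?gs = "monoid_forms fs f g"
  let ?J = "base_ideal (Suc n) ?gs"
  have fsR: "set fs \<subseteq> poly_over {..<n}"
    using can by (auto simp: canonical_restrictions_def forms_def carrier_mpoly_ring)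
  have RS: "x \<in> poly_over {..<Suc n}" if "x \<in> poly_over {..<n}" for x :: "'k mpoly"
    using that by (rule poly_over_le) simp
  have fsS: "set fs \<subseteq> poly_over {..<Suc n}" using fsR RS by blast
  have fS: "f \<in> poly_over {..<Suc n}" using f RS by blast
  have I_eq: "?I = dotp fs ` vecs n (length fs)" unfolding base_ideal_def by (rule Idl_eq_dotp[OF fsR])
  have IS_eq: "Idl\<^bsub>?S\<^esub> (set fs) = dotp fs ` vecs (Suc n) (length fs)" by (rule Idl_eq_dotp[OF fsS])
  have idealIS: "ideal (Idl\<^bsub>?S\<^esub> (set fs)) ?S" using fsS by (intro S.genideal_ideal) (simp add: carrier_mpoly_ring)
  have "?I \<subseteq> Idl\<^bsub>?S\<^esub> (set fs)"
    unfolding I_eq IS_eq by (rule image_mono) (auto simp: vecs_def RS)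
  then have "Idl\<^bsub>?S\<^esub> ?I \<subseteq> Idl\<^bsub>?S\<^esub> (set fs)" by (rule S.genideal_minimal[OF idealIS])
  then obtain \<gamma> where \<gamma>: "\<gamma> \<in> vecs (Suc n) (length fs)" "g = dotp fs \<gamma>" using g(1) IS_eq by blast
  have gS: "g \<in> poly_over {..<Suc n}"
    using \<open>Idl\<^bsub>?S\<^esub> ?I \<subseteq> Idl\<^bsub>?S\<^esub> (set fs)\<close> g(1) ideal_mpolyD[OF idealIS] by blast
  have gsS: "set ?gs \<subseteq> poly_over {..<Suc n}"
    using fsS fS gS by (auto simp: monoid_forms_def intro!: poly_over_mult)
  have idealJ: "ideal ?J ?S" unfolding base_ideal_def using gsS by (intro S.genideal_ideal) (simp add: carrier_mpoly_ring)
  have gsJ: "set ?gs \<subseteq> ?J" unfolding base_ideal_def using gsS by (intro S.genideal_self) (simp add: carrier_mpoly_ring)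
  have coprime: "f dvd v" if "f dvd g * v" for v
    using coprime_dvd_cancel[OF gcd fS gS f(2) g(2) that] .

  have htI: "height ?R ?I = enat 2" and pdI: "proj_dim ?R (quotient_module ?R ?I) = grade ?R ?I"
    using perf by (auto simp: perfect_codim2_def perfect_ideal_def numeral_eq_enat)
  have "proj_dim ?R (quotient_module ?R ?I) \<le> 2"
    using R.grade_le_height[of ?I] htI pdI by (simp add: numeral_eq_enat)
  then obtain w :: "(nat \<Rightarrow> 'k mpoly) + nat \<Rightarrow> _" and c where "dual_basis ?R (fun_module (syz n fs)) w c"
    using syz_dual_basis_if_proj_dim_le_2[OF fsR] unfolding base_ideal_def by blast
  then obtain c' where "dual_basis ?S (fun_module (syz (Suc n) fs)) w c'"
    using syz_dual_basis_base_change[OF fsR] by blast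
  then obtain w' :: "((nat \<Rightarrow> 'k mpoly) + nat) + nat \<Rightarrow> _" and c''
    where "dual_basis ?S (fun_module (syz (Suc n) ?gs)) w' c''"
    using syz_dual_basis_monoid_forms[OF fS f(2) \<gamma> coprime] by blast
  then have pd_le: "proj_dim ?S (quotient_module ?S ?J) \<le> 2"
    using proj_dim_le_2_if_syz_dual_basis[OF gsS] unfolding base_ideal_def by blast

  obtain P where P: "primeideal P ?R" "?I \<subseteq> P" "prime_height ?R P = enat 2"
    using height_attained[OF htI] by blast
  note idealP = P(1)[unfolded primeideal_mpoly_ring_iff, THEN conjunct1]
  note primeE = primeideal_extended_ideal[OF P(1)]
  note E = primeE[unfolded primeideal_mpoly_ring_iff] and idealE = primeE[unfolded primeideal_mpoly_ring_iff, THEN conjunct1]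
  have PE: "P \<subseteq> extended_ideal n P"
    using extended_ideal_contract[of P n] ideal_mpolyD[OF idealP] by blast
  have "set fs \<subseteq> ?I" unfolding base_ideal_def using fsR by (intro R.genideal_self) (simp add: carrier_mpoly_ring)
  then have "set fs \<subseteq> extended_ideal n P" using P(2) PE by blast
  moreover have "Idl\<^bsub>?S\<^esub> ?I \<subseteq> extended_ideal n P"
    using P(2) PE by (intro S.genideal_minimal[OF idealE]) blast
  moreover have "h * f \<in> extended_ideal n P" if "h \<in> extended_ideal n P" for h
    using ideal_mpolyD[OF idealE] fS that by (metis mult.commute)
  ultimately have "set ?gs \<subseteq> extended_ideal n P" using g(1) by (auto simp: monoid_forms_def)
  then have JE: "?J \<subseteq> extended_ideal n P" unfolding base_ideal_def by (rule S.genideal_minimal[OF idealE])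
  then have oneJ: "1 \<notin> ?J" using E by blast
  have "height ?S ?J \<le> prime_height ?S (extended_ideal n P)"
    unfolding height_def by (rule Inf_lower) (use primeE JE in blast)
  also have "\<dots> \<le> enat 2" using prime_height_extended_ideal_le[OF P(1)] P(3) by simp
  finally have ht_le: "height ?S ?J \<le> 2" by (simp add: numeral_eq_enat)

  have noprime: "\<exists>b\<in>?J. \<not> p dvd b" if p: "prime_elem p" for p
  proof (cases "p dvd f")
    case True
    have "\<exists>b\<in>{f, g}. \<not> p dvd b"
      by (rule no_common_prime_if_gcd_is_one[OF gcd _ _ f(2) p]) (use fS gS in auto)
    then have "\<not> p dvd g" using True by blast
    then show ?thesis using gsJ by (auto simp: monoid_forms_def)
  next
    case False
    obtain h0 where "h0 \<in> set fs" "h0 \<noteq> 0" using can by (auto simp: canonical_restrictions_def)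
    then obtain h where "h \<in> set fs" "\<not> p dvd h"
      using no_common_prime_if_gcd_is_one[OF _ fsR _ _ p] can unfolding canonical_restrictions_def by blast
    then have "h * f \<in> ?J" "\<not> p dvd h * f"
      using gsJ False p by (auto simp: monoid_forms_def prime_elem_dvd_mult_iff)
    then show ?thesis by blast
  qed
  note Jprops = ideal_mpolyD[OF idealJ]
  have gJ: "g \<in> ?J" using gsJ by (auto simp: monoid_forms_def)
  have "\<exists>b\<in>?J. \<forall>v. g dvd b * v \<longrightarrow> g dvd v"
    by (rule regular_pair_exists[where V="{..<Suc n}"]) (use Jprops noprime gS g(2) in blast)+
  then obtain b where b: "b \<in> ?J" "\<And>v. g dvd b * v \<Longrightarrow> g dvd v" by blast
  have "enat (length [g, b]) \<le> grade ?S ?J"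
    unfolding grade_def
    by (rule Sup_upper) (use regular_sequence_pair[OF gJ b(1) g(2) b(2) idealJ oneJ] gJ b(1) in force)
  then have grade_ge: "2 \<le> grade ?S ?J" by (simp add: numeral_eq_enat numeral_2_eq_2)
  have pd_ge: "2 \<le> proj_dim ?S (quotient_module ?S ?J)"
    by (rule proj_dim_ge_2[OF idealJ oneJ gJ b(1) g(2) b(2)])
  have "grade ?S ?J = 2" "height ?S ?J = 2"
    using grade_ge ht_le S.grade_le_height[of ?J] by (auto intro: order_antisym order_trans)
  moreover have "?J \<noteq> carrier ?S" using oneJ poly_over_1 by (auto simp: carrier_mpoly_ring)
  ultimately show ?thesis
    using idealJ pd_le pd_ge by (simp add: perfect_codim2_def perfect_ideal_def)
qed

section \<open>The field generated by the forms\<close>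

abbreviation emb :: "'k::field mpoly \<Rightarrow> 'k mpoly fract"
  where "emb p \<equiv> Fract p 1"

lemma is_hom_emb: "is_hom (emb :: 'k::field mpoly \<Rightarrow> _)"
  by (simp add: is_hom_def One_fract_def)

lemmas emb_simps = is_homD[OF is_hom_emb]

lemma emb_eq_0_iff [simp]: "emb p = 0 \<longleftrightarrow> p = 0"
  by (simp add: Zero_fract_def eq_fract)

lemma type_ring_simps:
  "x \<otimes>\<^bsub>ring_of_type_algebra\<^esub> y = x * y" "x \<oplus>\<^bsub>ring_of_type_algebra\<^esub> y = x + y"
  "\<one>\<^bsub>ring_of_type_algebra\<^esub> = 1" "\<zero>\<^bsub>ring_of_type_algebra\<^esub> = 0" "carrier ring_of_type_algebra = UNIV"
  by (simp_all add: ring_of_type_algebra_def)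

lemma type_ring_uminus:
  "\<ominus>\<^bsub>ring_of_type_algebra\<^esub> x = - (x :: 'a::comm_ring_1)"
proof -
  interpret cring "ring_of_type_algebra :: 'a ring" by (rule cring_from_type_algebra)
  show ?thesis by (rule minus_equality) (auto simp: type_ring_simps)
qed

lemma type_ring_inverse:
  fixes x :: "'a::field" assumes "x \<noteq> 0"
  shows "inv\<^bsub>ring_of_type_algebra\<^esub> x = inverse x"
proof -
  interpret field "ring_of_type_algebra :: 'a ring" by (rule field_from_type_algebra)
  show ?thesis by (rule comm_inv_char) (use assms in \<open>auto simp: type_ring_simps\<close>)
qed

definition subfield_over_constants :: "'k::field mpoly fract set \<Rightarrow> bool"
  where "subfield_over_constants K \<longleftrightarrow> (\<forall>c. emb (Const c) \<in> K) \<and> (\<forall>x\<in>K. \<forall>y\<in>K. x + y \<in> K) \<and>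
    (\<forall>x\<in>K. \<forall>y\<in>K. x * y \<in> K) \<and> (\<forall>x\<in>K. inverse x \<in> K)"

lemma subfieldD:
  assumes "subfield_over_constants K"
  shows "emb (Const c) \<in> K" "x \<in> K \<Longrightarrow> y \<in> K \<Longrightarrow> x + y \<in> K" "x \<in> K \<Longrightarrow> y \<in> K \<Longrightarrow> x * y \<in> K"
    "x \<in> K \<Longrightarrow> inverse x \<in> K" "0 \<in> K" "1 \<in> K" "x \<in> K \<Longrightarrow> - x \<in> K" "x \<in> K \<Longrightarrow> y \<in> K \<Longrightarrow> x - y \<in> K"
    "x \<in> K \<Longrightarrow> y \<in> K \<Longrightarrow> x / y \<in> K" "x \<in> K \<Longrightarrow> x ^ n \<in> K"
proof -
  show const: "emb (Const c) \<in> K" and add: "x \<in> K \<Longrightarrow> y \<in> K \<Longrightarrow> x + y \<in> K"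
    and mult: "x \<in> K \<Longrightarrow> y \<in> K \<Longrightarrow> x * y \<in> K" and inverse: "x \<in> K \<Longrightarrow> inverse x \<in> K" for c x y
    using assms by (auto simp: subfield_over_constants_def)
  show "0 \<in> K" using const[of 0] by (simp add: Zero_fract_def)
  show one: "1 \<in> K" using const[of 1] by (simp add: One_fract_def)
  show minus: "- x \<in> K" if "x \<in> K" for x
  proof -
    have "emb (Const (- 1)) * x = - x" by (simp add: is_homD[OF is_hom_Const] emb_simps del: minus_fract)
    then show ?thesis using mult[OF const that] by metis
  qed
  show "x - y \<in> K" if "x \<in> K" "y \<in> K" using add[OF that(1) minus[OF that(2)]] by simp
  show "x / y \<in> K" if "x \<in> K" "y \<in> K" using mult[OF that(1) inverse[OF that(2)]] by (simp add: divide_inverse)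
  show "x ^ n \<in> K" if "x \<in> K" by (induction n) (use one mult that in auto)
qed

lemma subfield_sum:
  "subfield_over_constants K \<Longrightarrow> (\<And>x. x \<in> A \<Longrightarrow> u x \<in> K) \<Longrightarrow> sum u A \<in> K"
  by (induction A rule: infinite_finite_induct) (auto simp: subfieldD)

lemma subfield_prod:
  "subfield_over_constants K \<Longrightarrow> (\<And>x. x \<in> A \<Longrightarrow> u x \<in> K) \<Longrightarrow> prod u A \<in> K"
  by (induction A rule: infinite_finite_induct) (auto simp: subfieldD)

lemma field_adjoin_subfield: "subfield_over_constants (field_adjoin A)"
proof -
  have inv: "inverse x \<in> field_adjoin A" if "x \<in> field_adjoin A" for x
  proof (cases "x = 0")
    case False
    then show ?thesis using that generate_field.m_inv[of x ring_of_type_algebra]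
      by (simp add: field_adjoin_def type_ring_simps type_ring_inverse)
  qed (use that in simp)
  show ?thesis
    unfolding subfield_over_constants_def
    using inv generate_field.eng_add[of _ "ring_of_type_algebra"] generate_field.eng_mult[of _ "ring_of_type_algebra"]
    by (auto simp: field_adjoin_def type_ring_simps intro: generate_field.incl)
qed

lemma field_adjoin_incl: "p \<in> A \<Longrightarrow> emb p \<in> field_adjoin A"
  unfolding field_adjoin_def by (rule generate_field.incl) auto

lemma field_adjoin_induct [consumes 1, case_names const gen add mult minus inverse]:
  assumes "x \<in> field_adjoin A"
    and "\<And>c. P (emb (Const c))" "\<And>p. p \<in> A \<Longrightarrow> P (emb p)"
    and "\<And>x y. P x \<Longrightarrow> P y \<Longrightarrow> P (x + y)" "\<And>x y. P x \<Longrightarrow> P y \<Longrightarrow> P (x * y)"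
    and "\<And>x. P x \<Longrightarrow> P (- x)" "\<And>x. P x \<Longrightarrow> x \<noteq> 0 \<Longrightarrow> P (inverse x)"
  shows "P x"
  using assms(1) unfolding field_adjoin_def
proof (induction rule: generate_field.induct)
  case one
  show ?case using assms(2)[of 1] by (simp add: type_ring_simps One_fract_def)
next
  case (incl h)
  then show ?case using assms(2,3) by auto
next
  case (m_inv h)
  then show ?case using assms(7) by (simp add: type_ring_simps type_ring_inverse)
qed (use assms in \<open>auto simp: type_ring_simps type_ring_uminus\<close>)

lemma field_adjoin_least:
  assumes "subfield_over_constants K" "\<And>p. p \<in> A \<Longrightarrow> emb p \<in> K"
  shows "field_adjoin A \<subseteq> K"
proof
  fix x assume "x \<in> field_adjoin A"
  then show "x \<in> K" by (induction rule: field_adjoin_induct) (auto simp: subfieldD[OF assms(1)] assms(2))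
qed

lemma form_mult: "p \<in> forms N a \<Longrightarrow> q \<in> forms N b \<Longrightarrow> p * q \<in> forms N (a + b)"
  by (simp add: forms_iff grade_poly_simps mult_monom poly_over_mult)

lemma form_mono: "p \<in> forms N a \<Longrightarrow> N \<le> M \<Longrightarrow> p \<in> forms M a"
  by (auto simp: forms_iff intro: poly_over_le)

lemma form_in_field_adjoin_monomials:
  assumes "p \<in> forms N e" shows "emb p \<in> field_adjoin (monomials N e)"
proof -
  note K = field_adjoin_subfield[of "monomials N e"]
  have "emb p = (\<Sum>t\<in>keys p. emb (Const (lookup p t)) * emb (single t 1))"
    by (subst (1) mpoly_expand) (simp add: emb_simps(3,8) single_as_product del: mult_fract)
  moreover have "emb (single t 1) \<in> field_adjoin (monomials N e)" if "t \<in> keys p" for t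
    using assms that by (intro field_adjoin_incl) (auto simp: forms_def monomials_def mpoly_ring_def mvars_def)
  ultimately show ?thesis
    by (simp only:) (intro subfield_sum[OF K] subfieldD(3)[OF K] subfieldD(1)[OF K])
qed

text \<open>
  Let \<open>S\<close> be the set of polynomials whose components of degree \<open>i d\<close> become elements of \<open>K\<close>
  after division by \<open>f\<^sub>0\<^sup>i\<close>, and whose other components vanish. It is a ring containing \<open>F\<close>,
  so every element of \<open>k(F)\<close> is a fraction of elements of \<open>S\<close>. If \<open>p\<^sub>1 / p\<^sub>2 = A / B\<close> with
  \<open>p\<^sub>1, p\<^sub>2\<close> of the same degree, then \<open>A\<close> and \<open>B\<close> may be replaced by their components of any
  degree in which \<open>B\<close> does not vanish.
\<close>

lemma degree_zero_quotient:
  fixes f0 :: "'k::field mpoly"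
  assumes K: "subfield_over_constants K" and d: "1 \<le> d" and F: "F \<subseteq> forms N d"
    and f0: "f0 \<noteq> 0" and quot: "\<And>h. h \<in> F \<Longrightarrow> emb h / emb f0 \<in> K"
    and p: "p1 \<in> forms M d" "p2 \<in> forms M d" "p2 \<noteq> 0"
    and mem: "emb p1 \<in> field_adjoin F" "emb p2 \<in> field_adjoin F"
  shows "emb p1 / emb p2 \<in> K"
proof -
  let ?c = "\<lambda>p e. coeff (grade_poly p) e"
  define good where "good p e \<longleftrightarrow> (if d dvd e then emb (?c p e) / emb f0 ^ (e div d) \<in> K else ?c p e = 0)" for p e
  define S where "S = {p :: 'k mpoly. \<forall>e. good p e}"
  have S_const: "Const c \<in> S" for c
    using subfieldD[OF K] by (auto simp: S_def good_def grade_poly_Const coeff_pCons emb_simps(4) split: nat.splits)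
  have S_gen: "h \<in> S" if "h \<in> F" for h
  proof -
    have "grade_poly h = monom h d" using F that by (auto simp: forms_iff)
    then show ?thesis using quot[OF that] subfieldD[OF K] d by (auto simp: S_def good_def emb_simps(4))
  qed
  have S_add: "p + q \<in> S" if "p \<in> S" "q \<in> S" for p q
    using that subfieldD(2)[OF K] by (auto simp: S_def good_def grade_poly_simps emb_simps(2) add_divide_distrib simp del: add_fract split: if_splits)
  have S_minus: "- p \<in> S" if "p \<in> S" for p
    using that subfieldD(7)[OF K] by (auto simp: S_def good_def grade_poly_simps emb_simps(5) simp del: minus_fract split: if_splits)
  have S_mult: "p * q \<in> S" if p: "p \<in> S" and q: "q \<in> S" for p q
  proof -
    have "good (p * q) e" for e
    proof (cases "d dvd e")
      case False
      have "?c p i * ?c q (e - i) = 0" if "i \<le> e" for i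
      proof (cases "d dvd i")
        case True
        then have "\<not> d dvd (e - i)" using False that by (metis dvd_diffD)
        then show ?thesis using q by (simp add: S_def good_def)
      qed (use p in \<open>simp add: S_def good_def\<close>)
      then have "(\<Sum>i\<le>e. ?c p i * ?c q (e - i)) = 0" by (intro sum.neutral) blast
      then show ?thesis using False by (simp add: good_def grade_poly_simps coeff_mult)
    next
      case True
      have "emb (?c p i * ?c q (e - i)) / emb f0 ^ (e div d) \<in> K" if i: "i \<le> e" for i
      proof (cases "d dvd i")
        case di: True
        then have dei: "d dvd (e - i)" using True by (rule dvd_diff_nat[rotated])
        have "e div d = i div d + (e - i) div d" using di i by (metis div_plus_div_distrib_dvd_left le_add_diff_inverse)
        then have "emb (?c p i * ?c q (e - i)) / emb f0 ^ (e div d)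
            = (emb (?c p i) / emb f0 ^ (i div d)) * (emb (?c q (e - i)) / emb f0 ^ ((e - i) div d))"
          by (simp add: emb_simps(3) power_add del: mult_fract divide_fract)
        moreover have "emb (?c p i) / emb f0 ^ (i div d) \<in> K" "emb (?c q (e - i)) / emb f0 ^ ((e - i) div d) \<in> K"
          using p q di dei by (auto simp: S_def good_def)
        ultimately show ?thesis using subfieldD(3)[OF K] by (simp only:)
      next
        case False
        then show ?thesis using p subfieldD(5)[OF K] by (simp add: S_def good_def Zero_fract_def[symmetric])
      qed
      then have "(\<Sum>i\<le>e. emb (?c p i * ?c q (e - i)) / emb f0 ^ (e div d)) \<in> K"
        by (intro subfield_sum[OF K]) simp
      then have "emb (?c (p * q) e) / emb f0 ^ (e div d) \<in> K"
        by (simp add: grade_poly_simps(3) coeff_mult emb_simps(8) sum_divide_distrib del: divide_fract)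
      then show ?thesis using True by (simp add: good_def)
    qed
    then show ?thesis unfolding S_def by blast
  qed
  have rep: "\<exists>A\<in>S. \<exists>B\<in>S. B \<noteq> 0 \<and> x = Fract A B" if "x \<in> field_adjoin F" for x
    using that
  proof (induction rule: field_adjoin_induct)
    case (const c)
    show ?case using S_const[of 1] S_const[of c] by (metis Const_1 zero_neq_one)
  next
    case (gen p)
    then show ?case using S_const[of 1] S_gen[of p] by (metis Const_1 zero_neq_one)
  next
    case (add x y)
    then obtain A B C D where *: "A \<in> S" "B \<in> S" "B \<noteq> 0" "x = Fract A B" "C \<in> S" "D \<in> S" "D \<noteq> 0" "y = Fract C D" by blast
    then show ?case by (intro bexI[of _ "A * D + C * B"] bexI[of _ "B * D"]) (auto intro: S_add S_mult)
  next
    case (mult x y)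
    then obtain A B C D where *: "A \<in> S" "B \<in> S" "B \<noteq> 0" "x = Fract A B" "C \<in> S" "D \<in> S" "D \<noteq> 0" "y = Fract C D" by blast
    then show ?case by (intro bexI[of _ "A * C"] bexI[of _ "B * D"]) (auto intro: S_mult)
  next
    case (minus x)
    then obtain A B where *: "A \<in> S" "B \<in> S" "B \<noteq> 0" "x = Fract A B" by blast
    then show ?case by (intro bexI[of _ "- A"] bexI[of _ "B"]) (auto intro: S_minus)
  next
    case (inverse x)
    then obtain A B where *: "A \<in> S" "B \<in> S" "B \<noteq> 0" "x = Fract A B" by blast
    moreover have "A \<noteq> 0" using inverse(2) * by (auto simp: fract_collapse)
    ultimately show ?case by (intro bexI[of _ "B"] bexI[of _ "A"]) auto
  qed
  have "emb p1 / emb p2 \<in> field_adjoin F" using mem by (rule subfieldD(9)[OF field_adjoin_subfield])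
  then obtain A B where AB: "A \<in> S" "B \<in> S" "B \<noteq> 0" "emb p1 / emb p2 = Fract A B" using rep by blast
  then have eq: "p1 * B = A * p2" using p(3) by (simp add: eq_fract)
  have "grade_poly B \<noteq> 0" using AB(3) by simp
  then obtain e where e: "?c B e \<noteq> 0" by (metis leading_coeff_0_iff)
  have "coeff (monom p1 d * grade_poly B) (d + e)
      = coeff (monom p2 d * grade_poly A) (d + e)"
    using arg_cong[OF eq, of "\<lambda>p. coeff (grade_poly p) (d + e)"] p(1,2)
    by (simp add: grade_poly_simps forms_iff mult.commute)
  then have comp: "p1 * ?c B e = p2 * ?c A e" by (simp add: coeff_monom_mult)
  have de: "d dvd e" using AB(2) e by (auto simp: S_def good_def split: if_splits)
  have "emb p1 / emb p2 = emb (?c A e) / emb (?c B e)"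
    using comp p(3) e by (simp add: eq_fract mult.commute)
  also have "\<dots> = (emb (?c A e) / emb f0 ^ (e div d)) / (emb (?c B e) / emb f0 ^ (e div d))"
    using f0 by (simp del: divide_fract)
  also have "\<dots> \<in> K"
    by (rule subfieldD(9)[OF K]) (use AB(1,2) de in \<open>auto simp: S_def good_def\<close>)
  finally show ?thesis .
qed

lemma form_over_power_in_subfield:
  fixes x0 :: "'k::field mpoly"
  assumes K: "subfield_over_constants K" and x0: "x0 \<noteq> 0" and V: "\<And>i. i \<in> V \<Longrightarrow> emb (Var i) / emb x0 \<in> K"
    and p: "p \<in> poly_over V" "grade_poly p = monom p e"
  shows "emb p / emb x0 ^ e \<in> K"
proof -
  have p': "p \<in> forms N e \<Longrightarrow> mdeg t = e" if "t \<in> keys p" for t N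
    using that by (auto simp: forms_def)
  obtain N where "p \<in> poly_over {..<N}" using in_some_poly_over by blast
  then have pN: "p \<in> forms N e" using p(2) by (simp add: forms_iff)
  have monom: "emb (eval_monom Var t) / emb x0 ^ e \<in> K" if t: "t \<in> keys p" for t
  proof -
    have "emb (eval_monom Var t) / emb x0 ^ e = (\<Prod>i\<in>keys t. (emb (Var i) / emb x0) ^ lookup t i)"
      unfolding p'[OF t pN, symmetric] mdeg_def eval_monom_def
      by (simp add: emb_simps(7,9) power_sum power_divide prod_dividef del: divide_fract)
    also have "\<dots> \<in> K"
      using t p(1) by (intro subfield_prod[OF K] subfieldD(10)[OF K] V) (auto simp: poly_over_def mvars_def)
    finally show ?thesis .
  qed
  have "emb p / emb x0 ^ e = (\<Sum>t\<in>keys p. emb (Const (lookup p t)) * (emb (eval_monom Var t) / emb x0 ^ e))"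
    by (subst (1) mpoly_expand) (simp add: emb_simps(3,8) sum_divide_distrib del: mult_fract divide_fract)
  also have "\<dots> \<in> K" using monom by (intro subfield_sum[OF K] subfieldD(3)[OF K] subfieldD(1)[OF K])
  finally show ?thesis .
qed

lemma form_Var_power: "i < N \<Longrightarrow> Var i ^ e \<in> forms N e"
proof -
  assume i: "i < N"
  have "grade_poly (Var i ^ e) = monom (Var i ^ e) e"
    by (simp add: grade_poly_simps grade_poly_Var monom_linear_power)
  then show ?thesis using i by (auto simp: forms_iff intro!: poly_over_power poly_over_Var)
qed

lemma Var_nonzero: "Var i \<noteq> (0 :: 'k::field mpoly)"
  by (metis Var_def lookup_single_eq lookup_zero one_neq_zero)

lemma variable_if_nonconstant_form:
  assumes "p \<in> forms N d" "p \<noteq> 0" "1 \<le> d" shows "0 < N"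
proof (rule ccontr)
  assume "\<not> 0 < N"
  obtain t where t: "t \<in> keys p" using assms(2) by (metis keys_eq_empty ex_in_conv)
  then have "keys t \<subseteq> {..<N}" "mdeg t = d" using assms(1) by (auto simp: forms_def mpoly_ring_def mvars_def)
  then show False using \<open>\<not> 0 < N\<close> assms(3) by (simp add: mdeg_def)
qed

theorem birational_monoid_forms:
  fixes fs :: "'k::field mpoly list"
  assumes d: "1 \<le> d" and birat: "birational_onto_image n d fs"
    and f: "f \<in> forms n a" "f \<noteq> 0"
    and g: "g \<in> forms (Suc n) (a + d)" and monoid: "xn_monoid n (a + d) g"
  shows "birational_onto_image (Suc n) (a + d) (map (\<lambda>h. h * f) fs @ [g])"
proof -
  let ?gs = "map (\<lambda>h. h * f) fs @ [g]" and ?e = "a + d"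
  define K where "K = field_adjoin (set ?gs)"
  have K: "subfield_over_constants K" unfolding K_def by (rule field_adjoin_subfield)
  have fs: "set fs \<subseteq> forms n d" and eq: "field_adjoin (set fs) = field_adjoin (monomials n d)"
    using birat by (auto simp: birational_onto_image_def rational_map_def)
  obtain f0 where f0: "f0 \<in> set fs" "f0 \<noteq> 0"
    using birat by (auto simp: birational_onto_image_def rational_map_def)
  have f0n: "f0 \<in> forms n d" using fs f0 by blast
  have n: "0 < n" by (rule variable_if_nonconstant_form[OF f0n f0(2) d])
  have gens: "emb (h * f) \<in> K" if "h \<in> set fs" for h
    unfolding K_def using that by (intro field_adjoin_incl) auto
  have quot: "emb h / emb f0 \<in> K" if "h \<in> set fs" for h
  proof -
    have "emb h / emb f0 = emb (h * f) / emb (f0 * f)" using f(2) f0(2) by (simp add: eq_fract mult.left_commute mult.commute)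
    then show ?thesis using subfieldD(9)[OF K gens[OF that] gens[OF f0(1)]] by simp
  qed
  define x0 :: "'k mpoly" where "x0 = Var 0"
  have x0: "x0 \<noteq> 0" by (simp add: x0_def Var_nonzero)
  have ratio: "emb (Var i) / emb x0 \<in> K" if i: "i < n" for i
  proof -
    let ?p1 = "Var i * Var 0 ^ (d - 1) :: 'k mpoly" and ?p2 = "Var 0 ^ d :: 'k mpoly"
    have d': "Suc (d - 1) = d" using d by simp
    have p1: "?p1 \<in> forms n d" using form_mult[OF form_Var_power[OF i, of 1] form_Var_power[OF n, of "d - 1"]] d' by simp
    have p2: "?p2 \<in> forms n d" by (rule form_Var_power[OF n])
    have "emb ?p1 / emb ?p2 \<in> K"
      by (rule degree_zero_quotient[OF K d fs f0(2) quot p1 p2])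
         (use p1 p2 in \<open>simp_all add: eq form_in_field_adjoin_monomials Var_nonzero\<close>)
    moreover have "?p2 = Var 0 * Var 0 ^ (d - 1)" by (metis d' power_Suc)
    then have "emb ?p1 / emb ?p2 = emb (Var i) / emb x0"
      by (simp add: eq_fract x0_def mult_ac Var_nonzero)
    ultimately show ?thesis by simp
  qed
  have form_ratio: "emb p / emb x0 ^ e \<in> K" if "p \<in> forms n e" for p e
    using form_over_power_in_subfield[OF K x0, of "{..<n}" p e] ratio that by (auto simp: forms_iff)
  have x0e: "emb x0 ^ ?e \<in> K"
  proof -
    have "f0 * f \<in> forms n ?e" using form_mult[OF f0n f(1)] by (simp add: add.commute)
    then have "emb (f0 * f) / emb x0 ^ ?e \<in> K" by (rule form_ratio)
    then have "emb (f0 * f) / (emb (f0 * f) / emb x0 ^ ?e) \<in> K" by (rule subfieldD(9)[OF K gens[OF f0(1)]])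
    moreover have "emb (f0 * f) \<noteq> 0" using f(2) f0(2) by simp
    ultimately show ?thesis by (simp del: divide_fract)
  qed
  obtain p q where pq: "1 \<le> ?e" "p \<in> forms n (?e - 1)" "q \<in> forms n ?e" "p \<noteq> 0" "g = p * Var n + q"
    using monoid by (auto simp: xn_monoid_def)
  have gK: "emb g \<in> K" unfolding K_def by (intro field_adjoin_incl) auto
  have xn: "emb (Var n) / emb x0 \<in> K"
  proof -
    have "(emb g / emb x0 ^ ?e - emb q / emb x0 ^ ?e) / (emb p / emb x0 ^ (?e - 1)) \<in> K"
      by (rule subfieldD(9)[OF K subfieldD(8)[OF K subfieldD(9)[OF K gK x0e] form_ratio[OF pq(3)]] form_ratio[OF pq(2)]])
    moreover have "emb x0 ^ ?e = emb x0 * emb x0 ^ (?e - 1)" using pq(1) by (metis Suc_diff_1 less_eq_Suc_le One_nat_def power_Suc)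
    then have "(emb g / emb x0 ^ ?e - emb q / emb x0 ^ ?e) / (emb p / emb x0 ^ (?e - 1)) = emb (Var n) / emb x0"
      using x0 pq(4) unfolding pq(5) emb_simps(2,3) by (simp add: field_simps del: add_fract mult_fract divide_fract diff_fract)
    ultimately show ?thesis by simp
  qed
  have ratio': "emb (Var i) / emb x0 \<in> K" if "i \<in> {..<Suc n}" for i
    using that ratio xn by (cases "i = n") auto
  have "field_adjoin (monomials (Suc n) ?e) \<subseteq> K"
  proof (rule field_adjoin_least[OF K])
    fix p :: "'k mpoly" assume "p \<in> monomials (Suc n) ?e"
    then have "p \<in> forms (Suc n) ?e" by (auto simp: monomials_def forms_def mpoly_ring_def mvars_def)
    then have "emb p / emb x0 ^ ?e \<in> K"
      using form_over_power_in_subfield[OF K x0, of "{..<Suc n}" p ?e] ratio' by (auto simp: forms_iff)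
    then have "emb p / emb x0 ^ ?e * emb x0 ^ ?e \<in> K" using x0e by (rule subfieldD(3)[OF K])
    then show "emb p \<in> K" using x0 by (simp del: divide_fract mult_fract)
  qed
  moreover have gs: "set ?gs \<subseteq> forms (Suc n) ?e"
  proof -
    have "h * f \<in> forms (Suc n) ?e" if "h \<in> set fs" for h
      using form_mono[OF form_mult[of h n d f a]] fs f(1) that by (auto simp: add.commute)
    then show ?thesis using g by auto
  qed
  then have "K \<subseteq> field_adjoin (monomials (Suc n) ?e)"
    unfolding K_def by (intro field_adjoin_least[OF field_adjoin_subfield] form_in_field_adjoin_monomials) auto
  moreover have "f0 * f \<in> set ?gs" "f0 * f \<noteq> 0" using f0 f(2) by auto
  then have "rational_map (Suc n) ?e ?gs"
    unfolding rational_map_def using gs pq(1) by blast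
  ultimately show ?thesis by (auto simp: birational_onto_image_def K_def)
qed

section \<open>Dominance\<close>

lemma is_hom_map_poly:
  assumes "is_hom h" shows "is_hom (map_poly h)"
proof -
  note h = is_homD[OF assms]
  have "map_poly h (p + q) = map_poly h p + map_poly h q" "map_poly h (p * q) = map_poly h p * map_poly h q" for p q
    by (rule poly_eqI; simp add: coeff_map_poly h coeff_mult)+
  then show ?thesis by (simp add: is_hom_def map_poly_1 h)
qed

lemma is_hom_pcompose: "is_hom (\<lambda>p. pcompose p q)"
  by (simp add: is_hom_def pcompose_1 pcompose_add pcompose_mult)

lemma map_poly_eq_0_coeff:
  assumes "is_hom h" "map_poly h p = 0" shows "h (coeff p i) = 0"
  using assms(2) coeff_map_poly[of h p i] is_homD(4)[OF assms(1)] by simp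

lemma coeff_grade_poly_in:
  assumes "p \<in> poly_over V" shows "coeff (grade_poly p) e \<in> poly_over V"
proof -
  have "grade_poly p \<in> polys_with_coeffs (poly_over V)"
    unfolding grade_poly_def
    by (rule mpoly_subst_closed[OF assms])
       (auto simp: polys_with_coeffs_def coeff_mult coeff_pCons one_pCons
          intro!: poly_over_intros split: nat.splits)
  then show ?thesis by (simp add: polys_with_coeffs_def)
qed

text \<open>
  Two injectivity arguments for polynomial composition. In the variable \<open>x\<^sub>n\<close>, evaluation
  at the new forms is composition with the linear polynomial \<open>p x\<^sub>n + q = g\<close>; after
  grading, evaluation at the \<open>f\<^sub>i f\<close> is composition with \<open>f T\<^sup>a\<^sup>+\<^sup>d\<close> of the evaluation at the
  \<open>f\<^sub>i\<close>.
\<close>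

theorem dominant_monoid_forms:
  fixes fs :: "'k::field mpoly list"
  assumes dom: "dominant fs" and len: "length fs = n" and fs: "set fs \<subseteq> forms n d"
    and f: "f \<in> forms n a" "f \<noteq> 0" and monoid: "xn_monoid n (a + d) g"
  shows "dominant (map (\<lambda>h. h * f) fs @ [g])"
proof -
  let ?gs = "map (\<lambda>h. h * f) fs @ [g]" and ?e = "a + d"
  let ?E = "eval_mpoly (\<lambda>i. fs ! i)" and ?E' = "eval_mpoly (\<lambda>i. fs ! i * f)" and ?G = "eval_mpoly (\<lambda>i. ?gs ! i)"
  have hom: "is_hom (eval_mpoly v)" for v :: "nat \<Rightarrow> 'k mpoly"
    unfolding eval_mpoly_conv by (rule is_hom_subst[OF is_hom_Const])
  have ev_Const: "eval_mpoly v (Const c) = Const c" and ev_Var: "eval_mpoly v (Var i) = v i" for v :: "nat \<Rightarrow> 'k mpoly" and c i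
    by (simp_all add: eval_mpoly_conv mpoly_subst_Const[OF is_hom_Const] mpoly_subst_Var[OF is_hom_Const])
  obtain p q where pq: "1 \<le> ?e" "p \<in> forms n (?e - 1)" "q \<in> forms n ?e" "p \<noteq> 0" "g = p * Var n + q"
    using monoid by (auto simp: xn_monoid_def)
  have hf: "fs ! i * f \<in> forms n ?e" if "i < n" for i
    using form_mult[OF subsetD[OF fs nth_mem[of i fs]] f(1)] len that by (simp add: add.commute)
  have split_g: "split_var n g = [:q, p:]"
    using pq(2,3) split_var_const[of p n] split_var_const[of q n]
    by (simp add: pq(5) split_var_simps split_var_Var forms_iff)
  have vanish_E': "r = 0" if r: "r \<in> poly_over {..<n}" "?E' r = 0" for r
  proof -
    have "grade_poly (?E' r) = pcompose (map_poly ?E (grade_poly r)) (monom f ?e)"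
    proof (rule hom_unique[OF is_hom_comp[OF is_hom_grade_poly hom]
          is_hom_comp[OF is_hom_pcompose is_hom_comp[OF is_hom_map_poly[OF hom] is_hom_grade_poly]] _ _ r(1)])
      show "grade_poly (?E' (Const c)) = pcompose (map_poly ?E (grade_poly (Const c))) (monom f ?e)" for c
        by (simp add: ev_Const grade_poly_Const map_poly_pCons is_homD(4)[OF hom])
      show "grade_poly (?E' (Var i)) = pcompose (map_poly ?E (grade_poly (Var i))) (monom f ?e)" if "i \<in> {..<n}" for i
        using hf[of i] that
        by (simp add: ev_Var grade_poly_Var map_poly_pCons is_homD(4)[OF hom] pcompose_pCons forms_iff smult_monom mult.commute)
    qed
    then have "pcompose (map_poly ?E (grade_poly r)) (monom f ?e) = 0"
      using r(2) by (simp add: grade_poly_simps)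
    then have z: "map_poly ?E (grade_poly r) = 0"
      by (rule pcompose_eq_0) (use f(2) pq(1) in \<open>simp add: Polynomial.degree_monom_eq, linarith\<close>)
    have "coeff (grade_poly r) i = 0" for i
      using dom map_poly_eq_0_coeff[OF hom z, of i] coeff_grade_poly_in[OF r(1), of i]
      by (simp add: dominant_def len carrier_mpoly_ring)
    then have "grade_poly r = 0" by (intro poly_eqI) simp
    then show ?thesis by simp
  qed
  have "r = 0" if r: "r \<in> poly_over {..<Suc n}" "?G r = 0" for r
  proof -
    have "split_var n (?G r) = pcompose (map_poly ?E' (split_var n r)) [:q, p:]"
    proof (rule hom_unique[OF is_hom_comp[OF is_hom_split_var hom]
          is_hom_comp[OF is_hom_pcompose is_hom_comp[OF is_hom_map_poly[OF hom] is_hom_split_var]] _ _ r(1)])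
      show "split_var n (?G (Const c)) = pcompose (map_poly ?E' (split_var n (Const c))) [:q, p:]" for c
        by (simp add: ev_Const split_var_Const map_poly_pCons is_homD(4)[OF hom])
      show "split_var n (?G (Var i)) = pcompose (map_poly ?E' (split_var n (Var i))) [:q, p:]" if "i \<in> {..<Suc n}" for i
      proof (cases "i = n")
        case True
        then show ?thesis using split_g len
          by (simp add: ev_Var split_var_Var map_poly_pCons is_homD(1,4)[OF hom] pcompose_pCons nth_append)
      next
        case False
        then have "i < n" using that by simp
        then show ?thesis using hf[of i] len
          by (simp add: ev_Var split_var_Var map_poly_pCons is_homD(1,4)[OF hom] nth_append forms_iff split_var_const)
      qed
    qed
    then have "pcompose (map_poly ?E' (split_var n r)) [:q, p:] = 0" using r(2) by (simp add: split_var_simps)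
    then have z: "map_poly ?E' (split_var n r) = 0" by (rule pcompose_eq_0) (use pq(4) in simp)
    have "coeff (split_var n r) i = 0" for i
      using vanish_E'[OF split_var_coeff_Suc[OF r(1)] map_poly_eq_0_coeff[OF hom z]] .
    then have "split_var n r = 0" by (intro poly_eqI) simp
    then show ?thesis by simp
  qed
  then show ?thesis by (simp add: dominant_def len carrier_mpoly_ring)
qed

section \<open>Extending a birational map by a monoid\<close>

theorem theorem2p7:
  fixes fs :: "'k::field mpoly list" and f g :: "'k mpoly" and n m d a :: nat
  assumes "infinite (UNIV :: 'k set)"
    and "length fs = m"
    and "canonical_restrictions n d fs"
    and "f \<in> forms n a" and "f \<noteq> 0"
    and "g \<in> Idl\<^bsub>mpoly_ring (Suc n)\<^esub> (base_ideal n fs)"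
    and "g \<in> forms (Suc n) (a + d)" and "g \<noteq> 0"
    and "gcd_is_one (mpoly_ring (Suc n)) {f, g}"
    and i: "perfect_codim2 (mpoly_ring n) (base_ideal n fs)"
    and ii: "xn_monoid n (a + d) g"
    and iii: "birational_onto_image n d fs"
  shows "let gs = map (\<lambda>h. h * f) fs @ [g] in
         (birational_onto_image (Suc n) (a + d) gs \<and>
          perfect_codim2 (mpoly_ring (Suc n)) (base_ideal (Suc n) gs)) \<and>
         (perfect_codim2_cremona n d fs \<longrightarrow> perfect_codim2_cremona (Suc n) (a + d) gs)"
proof -
  define gs where "gs = map (\<lambda>h. h * f) fs @ [g]"
  have gs: "gs = monoid_forms fs f g" by (simp add: gs_def monoid_forms_def)
  have d: "1 \<le> d" and fs: "set fs \<subseteq> forms n d"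
    using assms(3) by (auto simp: canonical_restrictions_def)
  have f: "f \<in> poly_over {..<n}" using assms(4) by (simp add: forms_iff)
  have birational: "birational_onto_image (Suc n) (a + d) gs"
    unfolding gs_def by (rule birational_monoid_forms[OF d iii assms(4,5,7) ii])
  moreover have perfect: "perfect_codim2 (mpoly_ring (Suc n)) (base_ideal (Suc n) gs)"
    unfolding gs by (rule perfect_codim2_monoid_forms[OF assms(3) f assms(5,6,8,9) i])
  moreover have "perfect_codim2_cremona (Suc n) (a + d) gs" if "perfect_codim2_cremona n d fs"
  proof -
    have "length fs = n" "dominant fs" using that by (auto simp: perfect_codim2_cremona_def cremona_map_def)
    moreover from this have "dominant gs"
      unfolding gs_def using dominant_monoid_forms[OF _ _ fs assms(4,5) ii] by blast
    ultimately show ?thesis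
      using birational perfect by (simp add: perfect_codim2_cremona_def cremona_map_def gs_def)
  qed
  ultimately show ?thesis unfolding gs_def[symmetric] Let_def by blast
qed

end
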